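(* Let $k$ be a commutative ring, $S=k[x_1,\ldots,x_n]$, $\Delta\subset\mathbb{N}^n$ a standard set of finite size $d\geq1$, and $N$ a standard set in $\mathbb{N}^n$ containing $\Delta$. Then the functor $\mathcal{H}{\rm ilb}^{\Delta}_{S/k}$ is represented by the affine scheme ${\rm Hilb}^{\Delta}_{S/k}={\rm Spec}\,R^\Delta$, where $R^\Delta=R/I^\Delta$, $R$ is the polynomial ring $R=k[T_{\alpha,\beta};\alpha\in N\cup N^{(1)},\beta\in\Delta]$, and $I^\Delta=I^\Delta_1+I^\Delta_2+I^\Delta_3$ is the sum of the following ideals of $R$: - $I^\Delta_1$ is generated by all $T_{\alpha,\beta}-\delta_{\alpha,\beta}$ with $\alpha\in\Delta$, $\beta\in\Delta$; - $I^\Delta_2$ is generated by all $T_{\alpha+\lambda,\beta}-\sum_{\gamma\in\Delta}T_{\alpha,\gamma}T_{\gamma+\lambda,\beta}$ with $\alpha\in N\cup N^{(1)}$, $\lambda\in\{e_1,\ldots,e_n\}$ such that $\alpha+\lambda\in N\cup N^{(1)}$, and $\beta\in\Delta$; - $I^\Delta_3$ is generated by all $\sum_{\gamma\in\Delta}T_{\alpha,\gamma}T_{\gamma+\lambda,\beta}-\sum_{\gamma\in\Delta}T_{\alpha',\gamma}T_{\gamma+\lambda',\beta}$ with $\alpha,\alpha'\in N^{(1)}$, $\lambda,\lambda'\in\{e_1,\ldots,e_n\}$ such that $\alpha+\lambda=\alpha'+\lambda'\in N^{(2)}$, and $\beta\in\Delta$.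
   Context: All rings are commutative with $1$; $x^\alpha=x_1^{\alpha_1}\cdots x_n^{\alpha_n}$ for $\alpha\in\mathbb{N}^n$, $B[x]=B[x_1,\ldots,x_n]$; $e_i$ is the $i$-th standard basis vector and $\delta$ the Kronecker delta. A standard set is a subset $N\subset\mathbb{N}^n$ with $(\mathbb{N}^n-N)+\mathbb{N}^n\subset\mathbb{N}^n-N$. Its border is $\mathscr{B}(N)=\bigcup_{i=1}^n(N+e_i)-N$. Put $N^{(1)}=\mathscr{B}(N)$ and $N^{(2)}=\mathscr{B}(N\cup N^{(1)})$. The functor $\mathcal{H}{\rm ilb}^{\Delta}_{S/k}:(k\text{-Alg})\to({\rm Sets})$ sends $B$ to the set of surjective $B$-algebra homomorphisms $\phi:B[x]\to Q$ such that $(\phi(x^\beta))_{\beta\in\Delta}$ is a $B$-basis of $Q$, modulo the equivalence $\phi\sim\phi'$ iff $\ker\phi=\ker\phi'$, with functoriality by base change. The representation is the one under which a $k$-algebra homomorphism $R^\Delta\to B$, $T_{\alpha,\beta}\mapsto a_{\alpha,\beta}$, corresponds to the class of $\phi$ with $\phi(x^\alpha)=\sum_{\beta\in\Delta}a_{\alpha,\beta}\phi(x^\beta)$ for all $\alpha\in N\cup N^{(1)}$. *)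

theory Defs
  imports "HOL-Algebra.Algebra" "HOL-Algebra.Indexed_Polynomials"
begin

text \<open>
  The elements of $\mathbb{N}^n$ are the multisets over the index set \<open>{1..n}\<close>: the entry
  $\alpha_i$ is the multiplicity of \<open>i\<close> in \<open>\<alpha>\<close>, the standard basis vector $e_i$ is \<open>{#i#}\<close>, and
  addition is multiset addition.  This is the encoding of monomials in
  \<^theory>\<open>HOL-Algebra.Indexed_Polynomials\<close>.
\<close>

definition expts :: "nat \<Rightarrow> nat multiset set" where
  "expts n = {\<alpha>. set_mset \<alpha> \<subseteq> {1..n}}"

definition standard_set :: "nat \<Rightarrow> nat multiset set \<Rightarrow> bool" where
  "standard_set n M \<longleftrightarrow>
     M \<subseteq> expts n \<and> {\<alpha> + \<gamma> | \<alpha> \<gamma>. \<alpha> \<in> expts n - M \<and> \<gamma> \<in> expts n} \<subseteq> expts n - M"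

definition border :: "nat \<Rightarrow> nat multiset set \<Rightarrow> nat multiset set" where
  "border n M = (\<Union>i\<in>{1..n}. {\<alpha> + {#i#} | \<alpha>. \<alpha> \<in> M}) - M"

abbreviation border1 :: "nat \<Rightarrow> nat multiset set \<Rightarrow> nat multiset set" where
  "border1 n M \<equiv> border n M"

abbreviation border2 :: "nat \<Rightarrow> nat multiset set \<Rightarrow> nat multiset set" where
  "border2 n M \<equiv> border n (M \<union> border1 n M)"


text \<open>
  The polynomial algebra \<open>R[X\<^sub>i ; i \<in> I]\<close>.  Carrier, constants, variables and sum are those of
  \<^theory>\<open>HOL-Algebra.Indexed_Polynomials\<close>, which has no product of two polynomials.
\<close>

definition mpoly_alg :: "('a, 'm) ring_scheme \<Rightarrow> 'c set \<Rightarrow> ('a, 'c multiset \<Rightarrow> 'a) module" where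
  "mpoly_alg R I =
    \<lparr> carrier = ring.indexed_pset R I (carrier R),
      monoid.mult = (\<lambda>P Q m. \<Oplus>\<^bsub>R\<^esub>u\<in>{u. u \<subseteq># m}. P u \<otimes>\<^bsub>R\<^esub> Q (m - u)),
      one = ring.indexed_const R \<one>\<^bsub>R\<^esub>,
      ring.zero = ring.indexed_const R \<zero>\<^bsub>R\<^esub>,
      add = ring.indexed_padd R,
      smult = (\<lambda>c P m. c \<otimes>\<^bsub>R\<^esub> P m) \<rparr>"

definition mpoly_monom :: "('a, 'm) ring_scheme \<Rightarrow> 'c multiset \<Rightarrow> ('c multiset \<Rightarrow> 'a)" where
  "mpoly_monom R \<alpha> = (\<lambda>m. if m = \<alpha> then \<one>\<^bsub>R\<^esub> else \<zero>\<^bsub>R\<^esub>)"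

abbreviation polyring :: "nat \<Rightarrow> ('a, 'm) ring_scheme \<Rightarrow> ('a, nat multiset \<Rightarrow> 'a) module" where
  "polyring n R \<equiv> mpoly_alg R {1..n}"


definition alg_hom ::
  "('a, 'k) ring_scheme \<Rightarrow> ('a, 'b, 'm) module_scheme \<Rightarrow> ('a, 'c, 'l) module_scheme \<Rightarrow> ('b \<Rightarrow> 'c) set"
where
  "alg_hom R A B =
    {h \<in> ring_hom A B. \<forall>c\<in>carrier R. \<forall>x\<in>carrier A. h (c \<odot>\<^bsub>A\<^esub> x) = c \<odot>\<^bsub>B\<^esub> h x}"

definition quot_alg :: "('a, 'b, 'm) module_scheme \<Rightarrow> 'b set \<Rightarrow> ('a, 'b set) module" where
  "quot_alg A J =
    \<lparr> carrier = carrier (A Quot J),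
      monoid.mult = monoid.mult (A Quot J),
      one = one (A Quot J),
      ring.zero = ring.zero (A Quot J),
      add = add (A Quot J),
      smult = (\<lambda>c S. \<Union>x\<in>S. J +>\<^bsub>A\<^esub> (c \<odot>\<^bsub>A\<^esub> x)) \<rparr>"

text \<open>Only meant for finite \<open>I\<close>: \<^const>\<open>finsum\<close> is degenerate over infinite sets.\<close>

definition is_basis ::
  "('a, 'k) ring_scheme \<Rightarrow> ('a, 'b, 'm) module_scheme \<Rightarrow> 'i set \<Rightarrow> ('i \<Rightarrow> 'b) \<Rightarrow> bool"
where
  "is_basis R M I v \<longleftrightarrow>
     v \<in> I \<rightarrow> carrier M \<and>
     (\<forall>c \<in> I \<rightarrow> carrier R. (\<Oplus>\<^bsub>M\<^esub>i\<in>I. c i \<odot>\<^bsub>M\<^esub> v i) = \<zero>\<^bsub>M\<^esub> \<longrightarrow> (\<forall>i\<in>I. c i = \<zero>\<^bsub>R\<^esub>)) \<and>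
     (\<forall>q \<in> carrier M. \<exists>c \<in> I \<rightarrow> carrier R. q = (\<Oplus>\<^bsub>M\<^esub>i\<in>I. c i \<odot>\<^bsub>M\<^esub> v i))"


definition hilb_hom ::
  "nat \<Rightarrow> nat multiset set \<Rightarrow> ('b, 'm) ring_scheme \<Rightarrow> ('b, 'q) module
    \<Rightarrow> ((nat multiset \<Rightarrow> 'b) \<Rightarrow> 'q) \<Rightarrow> bool"
where
  "hilb_hom n \<Delta> B Q \<phi> \<longleftrightarrow>
     algebra B Q \<and>
     \<phi> \<in> alg_hom B (polyring n B) Q \<and>
     \<phi> ` carrier (polyring n B) = carrier Q \<and>
     is_basis B Q \<Delta> (\<lambda>\<beta>. \<phi> (mpoly_monom B \<beta>))"

text \<open>
  To have a set of pairs \<open>(Q, \<phi>)\<close>, the elements of \<open>Q\<close> are taken in one fixed type, that of the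
  residue classes of \<open>B[x]\<close>.  Every surjection from \<open>B[x]\<close> onto an arbitrary \<open>Q\<close> is equivalent to
  one of this kind, namely to the projection onto \<open>B[x] / ker \<phi>\<close>.
\<close>

type_synonym 'b hilb_datum =
  "('b, (nat multiset \<Rightarrow> 'b) set) module \<times> ((nat multiset \<Rightarrow> 'b) \<Rightarrow> (nat multiset \<Rightarrow> 'b) set)"

definition hilb_data ::
  "nat \<Rightarrow> nat multiset set \<Rightarrow> ('b, 'm) ring_scheme \<Rightarrow> 'b hilb_datum set"
where
  "hilb_data n \<Delta> B = {(Q, \<phi>). hilb_hom n \<Delta> B Q \<phi>}"

definition hilb_rel ::
  "nat \<Rightarrow> nat multiset set \<Rightarrow> ('b, 'm) ring_scheme \<Rightarrow> ('b hilb_datum \<times> 'b hilb_datum) set"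
where
  "hilb_rel n \<Delta> B =
    {((Q, \<phi>), (Q', \<phi>')). (Q, \<phi>) \<in> hilb_data n \<Delta> B \<and> (Q', \<phi>') \<in> hilb_data n \<Delta> B \<and>
       a_kernel (polyring n B) Q \<phi> = a_kernel (polyring n B) Q' \<phi>'}"

definition hilb_functor ::
  "nat \<Rightarrow> nat multiset set \<Rightarrow> ('b, 'm) ring_scheme \<Rightarrow> 'b hilb_datum set set"
where
  "hilb_functor n \<Delta> B = hilb_data n \<Delta> B // hilb_rel n \<Delta> B"

text \<open>The class of \<open>\<phi> : B[x] \<rightarrow> Q\<close>, for \<open>Q\<close> over an arbitrary type.\<close>

definition hilb_class ::
  "nat \<Rightarrow> nat multiset set \<Rightarrow> ('b, 'm) ring_scheme \<Rightarrow> ('b, 'q) module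
    \<Rightarrow> ((nat multiset \<Rightarrow> 'b) \<Rightarrow> 'q) \<Rightarrow> 'b hilb_datum set"
where
  "hilb_class n \<Delta> B Q \<phi> =
    {(Q', \<phi>') \<in> hilb_data n \<Delta> B.
       a_kernel (polyring n B) Q' \<phi>' = a_kernel (polyring n B) Q \<phi>}"


text \<open>
  Base change.  For a ring homomorphism \<open>f : B \<rightarrow> C\<close> and a \<open>B\<close>-algebra \<open>Q\<close>, the \<open>C\<close>-algebra
  \<open>C \<otimes>\<^sub>B Q\<close> is presented by one generator \<open>X\<^sub>q = 1 \<otimes> q\<close> for each \<open>q \<in> Q\<close>, subject to the relations
  saying that \<open>q \<mapsto> 1 \<otimes> q\<close> is a homomorphism of \<open>B\<close>-algebras.  Thus \<open>C\<close>-algebra homomorphisms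
  \<open>C \<otimes>\<^sub>B Q \<rightarrow> D\<close> are the same as \<open>B\<close>-algebra homomorphisms \<open>Q \<rightarrow> D\<close>.
\<close>

definition tensor_rels ::
  "('b, 'm) ring_scheme \<Rightarrow> ('c, 'l) ring_scheme \<Rightarrow> ('b \<Rightarrow> 'c) \<Rightarrow> ('b, 'q) module
    \<Rightarrow> ('q multiset \<Rightarrow> 'c) set"
where
  "tensor_rels B C f Q =
    (let P = mpoly_alg C (carrier Q); v = ring.indexed_var C in
      {v (q \<oplus>\<^bsub>Q\<^esub> r) \<ominus>\<^bsub>P\<^esub> (v q \<oplus>\<^bsub>P\<^esub> v r) | q r. q \<in> carrier Q \<and> r \<in> carrier Q} \<union>
      {v (q \<otimes>\<^bsub>Q\<^esub> r) \<ominus>\<^bsub>P\<^esub> (v q \<otimes>\<^bsub>P\<^esub> v r) | q r. q \<in> carrier Q \<and> r \<in> carrier Q} \<union>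
      {v \<one>\<^bsub>Q\<^esub> \<ominus>\<^bsub>P\<^esub> \<one>\<^bsub>P\<^esub>} \<union>
      {v (b \<odot>\<^bsub>Q\<^esub> q) \<ominus>\<^bsub>P\<^esub> (f b \<odot>\<^bsub>P\<^esub> v q) | b q. b \<in> carrier B \<and> q \<in> carrier Q})"

definition tensor_ideal ::
  "('b, 'm) ring_scheme \<Rightarrow> ('c, 'l) ring_scheme \<Rightarrow> ('b \<Rightarrow> 'c) \<Rightarrow> ('b, 'q) module
    \<Rightarrow> ('q multiset \<Rightarrow> 'c) set"
where
  "tensor_ideal B C f Q = genideal (mpoly_alg C (carrier Q)) (tensor_rels B C f Q)"

definition tensor_alg ::
  "('b, 'm) ring_scheme \<Rightarrow> ('c, 'l) ring_scheme \<Rightarrow> ('b \<Rightarrow> 'c) \<Rightarrow> ('b, 'q) module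
    \<Rightarrow> ('c, ('q multiset \<Rightarrow> 'c) set) module"
where
  "tensor_alg B C f Q = quot_alg (mpoly_alg C (carrier Q)) (tensor_ideal B C f Q)"

definition one_tensor ::
  "('b, 'm) ring_scheme \<Rightarrow> ('c, 'l) ring_scheme \<Rightarrow> ('b \<Rightarrow> 'c) \<Rightarrow> ('b, 'q) module
    \<Rightarrow> 'q \<Rightarrow> ('q multiset \<Rightarrow> 'c) set"
where
  "one_tensor B C f Q q =
    tensor_ideal B C f Q +>\<^bsub>mpoly_alg C (carrier Q)\<^esub> ring.indexed_var C q"

text \<open>
  \<open>C \<otimes>\<^sub>B \<phi>\<close>, with \<open>C \<otimes>\<^sub>B B[x]\<close> identified with \<open>C[x]\<close>: the polynomial with coefficients \<open>p \<alpha>\<close> is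
  mapped to the sum of the \<open>p \<alpha> \<otimes> \<phi>(x\<^sup>\<alpha>)\<close>.
\<close>

definition base_change_hom ::
  "('b, 'm) ring_scheme \<Rightarrow> ('c, 'l) ring_scheme \<Rightarrow> ('b \<Rightarrow> 'c) \<Rightarrow> ('b, 'q) module
    \<Rightarrow> ((nat multiset \<Rightarrow> 'b) \<Rightarrow> 'q) \<Rightarrow> (nat multiset \<Rightarrow> 'c) \<Rightarrow> ('q multiset \<Rightarrow> 'c) set"
where
  "base_change_hom B C f Q \<phi> p =
    (\<Oplus>\<^bsub>tensor_alg B C f Q\<^esub>\<alpha>\<in>{\<alpha>. p \<alpha> \<noteq> \<zero>\<^bsub>C\<^esub>}.
       p \<alpha> \<odot>\<^bsub>tensor_alg B C f Q\<^esub> one_tensor B C f Q (\<phi> (mpoly_monom B \<alpha>)))"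

definition hilb_map ::
  "nat \<Rightarrow> nat multiset set \<Rightarrow> ('b, 'm) ring_scheme \<Rightarrow> ('c, 'l) ring_scheme \<Rightarrow> ('b \<Rightarrow> 'c)
    \<Rightarrow> 'b hilb_datum set \<Rightarrow> 'c hilb_datum set"
where
  "hilb_map n \<Delta> B C f Y =
    (\<Union>(Q, \<phi>)\<in>Y. hilb_class n \<Delta> C (tensor_alg B C f Q) (base_change_hom B C f Q \<phi>))"


type_synonym Tindex = "nat multiset \<times> nat multiset"

definition T_ring ::
  "('k, 'm) ring_scheme \<Rightarrow> nat \<Rightarrow> nat multiset set \<Rightarrow> nat multiset set
    \<Rightarrow> ('k, Tindex multiset \<Rightarrow> 'k) module"
where
  "T_ring K n N \<Delta> = mpoly_alg K ((N \<union> border1 n N) \<times> \<Delta>)"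

definition T_var ::
  "('k, 'm) ring_scheme \<Rightarrow> nat multiset \<Rightarrow> nat multiset \<Rightarrow> (Tindex multiset \<Rightarrow> 'k)"
where
  "T_var K \<alpha> \<beta> = ring.indexed_var K (\<alpha>, \<beta>)"

definition T_sum ::
  "('k, 'm) ring_scheme \<Rightarrow> nat \<Rightarrow> nat multiset set \<Rightarrow> nat multiset set
    \<Rightarrow> nat multiset \<Rightarrow> nat multiset \<Rightarrow> nat multiset \<Rightarrow> (Tindex multiset \<Rightarrow> 'k)"
where
  "T_sum K n N \<Delta> \<alpha> l \<beta> =
    (\<Oplus>\<^bsub>T_ring K n N \<Delta>\<^esub>\<gamma>\<in>\<Delta>. T_var K \<alpha> \<gamma> \<otimes>\<^bsub>T_ring K n N \<Delta>\<^esub> T_var K (\<gamma> + l) \<beta>)"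

definition unit_vectors :: "nat \<Rightarrow> nat multiset set" where
  "unit_vectors n = {{#i#} | i. i \<in> {1..n}}"

definition I1 ::
  "('k, 'm) ring_scheme \<Rightarrow> nat \<Rightarrow> nat multiset set \<Rightarrow> nat multiset set
    \<Rightarrow> (Tindex multiset \<Rightarrow> 'k) set"
where
  "I1 K n N \<Delta> = (let R = T_ring K n N \<Delta> in
    genideal R {T_var K \<alpha> \<beta> \<ominus>\<^bsub>R\<^esub> (if \<alpha> = \<beta> then \<one>\<^bsub>R\<^esub> else \<zero>\<^bsub>R\<^esub>) | \<alpha> \<beta>. \<alpha> \<in> \<Delta> \<and> \<beta> \<in> \<Delta>})"

definition I2 ::
  "('k, 'm) ring_scheme \<Rightarrow> nat \<Rightarrow> nat multiset set \<Rightarrow> nat multiset set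
    \<Rightarrow> (Tindex multiset \<Rightarrow> 'k) set"
where
  "I2 K n N \<Delta> = (let R = T_ring K n N \<Delta> in
    genideal R {T_var K (\<alpha> + l) \<beta> \<ominus>\<^bsub>R\<^esub> T_sum K n N \<Delta> \<alpha> l \<beta> | \<alpha> l \<beta>.
      \<alpha> \<in> N \<union> border1 n N \<and> l \<in> unit_vectors n \<and> \<alpha> + l \<in> N \<union> border1 n N \<and> \<beta> \<in> \<Delta>})"

definition I3 ::
  "('k, 'm) ring_scheme \<Rightarrow> nat \<Rightarrow> nat multiset set \<Rightarrow> nat multiset set
    \<Rightarrow> (Tindex multiset \<Rightarrow> 'k) set"
where
  "I3 K n N \<Delta> = (let R = T_ring K n N \<Delta> in
    genideal R {T_sum K n N \<Delta> \<alpha> l \<beta> \<ominus>\<^bsub>R\<^esub> T_sum K n N \<Delta> \<alpha>' l' \<beta> | \<alpha> \<alpha>' l l' \<beta>.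
      \<alpha> \<in> border1 n N \<and> \<alpha>' \<in> border1 n N \<and> l \<in> unit_vectors n \<and> l' \<in> unit_vectors n \<and>
      \<alpha> + l = \<alpha>' + l' \<and> \<alpha> + l \<in> border2 n N \<and> \<beta> \<in> \<Delta>})"

definition hilb_ideal ::
  "('k, 'm) ring_scheme \<Rightarrow> nat \<Rightarrow> nat multiset set \<Rightarrow> nat multiset set
    \<Rightarrow> (Tindex multiset \<Rightarrow> 'k) set"
where
  "hilb_ideal K n N \<Delta> =
    set_add (T_ring K n N \<Delta>)
      (set_add (T_ring K n N \<Delta>) (I1 K n N \<Delta>) (I2 K n N \<Delta>)) (I3 K n N \<Delta>)"

definition hilb_alg ::
  "('k, 'm) ring_scheme \<Rightarrow> nat \<Rightarrow> nat multiset set \<Rightarrow> nat multiset set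
    \<Rightarrow> ('k, (Tindex multiset \<Rightarrow> 'k) set) module"
where
  "hilb_alg K n N \<Delta> = quot_alg (T_ring K n N \<Delta>) (hilb_ideal K n N \<Delta>)"

definition T_class ::
  "('k, 'm) ring_scheme \<Rightarrow> nat \<Rightarrow> nat multiset set \<Rightarrow> nat multiset set
    \<Rightarrow> nat multiset \<Rightarrow> nat multiset \<Rightarrow> (Tindex multiset \<Rightarrow> 'k) set"
where
  "T_class K n N \<Delta> \<alpha> \<beta> = hilb_ideal K n N \<Delta> +>\<^bsub>T_ring K n N \<Delta>\<^esub> T_var K \<alpha> \<beta>"

text \<open>
  \<open>Hom\<^sub>K(R\<^sup>\<Delta>, B)\<close>, that is, the morphisms of \<open>K\<close>-schemes from \<open>Spec B\<close> to \<open>Spec R\<^sup>\<Delta>\<close>.  Homomorphisms are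
  made extensional so that they are determined by their values on the carrier.
\<close>

definition hilb_homset ::
  "('k, 'm) ring_scheme \<Rightarrow> nat \<Rightarrow> nat multiset set \<Rightarrow> nat multiset set \<Rightarrow> ('k, 'b) module
    \<Rightarrow> ((Tindex multiset \<Rightarrow> 'k) set \<Rightarrow> 'b) set"
where
  "hilb_homset K n N \<Delta> B =
    alg_hom K (hilb_alg K n N \<Delta>) B \<inter> extensional (carrier (hilb_alg K n N \<Delta>))"

definition hilb_corresponds ::
  "('k, 'm) ring_scheme \<Rightarrow> nat \<Rightarrow> nat multiset set \<Rightarrow> nat multiset set \<Rightarrow> ('k, 'b) module
    \<Rightarrow> ((Tindex multiset \<Rightarrow> 'k) set \<Rightarrow> 'b) \<Rightarrow> ('b, 'q) module
    \<Rightarrow> ((nat multiset \<Rightarrow> 'b) \<Rightarrow> 'q) \<Rightarrow> bool"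
where
  "hilb_corresponds K n N \<Delta> B u Q \<phi> \<longleftrightarrow>
    (\<forall>\<alpha> \<in> N \<union> border1 n N.
       \<phi> (mpoly_monom B \<alpha>) =
         (\<Oplus>\<^bsub>Q\<^esub>\<beta>\<in>\<Delta>. u (T_class K n N \<Delta> \<alpha> \<beta>) \<odot>\<^bsub>Q\<^esub> \<phi> (mpoly_monom B \<beta>)))"

definition hilb_rep ::
  "('k, 'm) ring_scheme \<Rightarrow> nat \<Rightarrow> nat multiset set \<Rightarrow> nat multiset set \<Rightarrow> ('k, 'b) module
    \<Rightarrow> ((Tindex multiset \<Rightarrow> 'k) set \<Rightarrow> 'b) \<Rightarrow> 'b hilb_datum set"
where
  "hilb_rep K n N \<Delta> B u = {(Q, \<phi>) \<in> hilb_data n \<Delta> B. hilb_corresponds K n N \<Delta> B u Q \<phi>}"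

end

theory Submission
  imports Defs
begin

text \<open>
  A \<open>B\<close>-point of the representing scheme is a matrix \<open>a \<alpha> \<beta>\<close> in \<open>B\<close> that satisfies the three families of
  equations.  Its entries \<open>a (\<gamma> + e\<^sub>i) \<beta>\<close> with \<open>\<gamma> \<in> \<Delta>\<close> describe multiplication by \<open>x\<^sub>i\<close> on the free module
  with basis \<open>\<Delta>\<close>.  These operators commute: whether $\gamma + e_i + e_j$ lies in $N \cup N^{(1)}$ or
  in $N^{(2)}$, the second or the third family applies.  Hence every polynomial has
  coordinates, obtained by letting it act on the basis vector of exponent \<open>0\<close>; the polynomials with zero
  coordinates form an ideal whose quotient has basis \<open>\<Delta>\<close>, and this ideal is the kernel of every \<open>\<phi>\<close>
  that corresponds to \<open>a\<close>.  Conversely, the coordinates of the \<open>\<phi>(x\<^sup>\<alpha>)\<close> satisfy the equations, by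
  comparing coefficients.  For the base change, the linear independence of \<open>\<Delta>\<close> in \<open>C \<otimes>\<^sub>B Q\<close>
  follows by mapping \<open>C \<otimes>\<^sub>B Q\<close> to the quotient of \<open>C[x]\<close> constructed from \<open>f \<circ> a\<close>.
\<close>

section \<open>Polynomial algebras\<close>

text \<open>The equations speak only of exponents in \<open>N \<union> border1 n N\<close>, so they
  do not say directly how a longer monomial expands. What extends to all of B[x] is the action of
  the variables on \<Delta>, since \<gamma> + e_i with \<gamma> in \<Delta> never leaves that set.
  The two cases of commutation are exhaustive: if \<gamma> + e_i + e_j falls outside, then neither
  \<gamma> + e_i nor \<gamma> + e_j lies in N, hence both lie in N^(1) and the sum in N^(2). The
  action reproduces all given entries because \<open>N \<union> border1 n N\<close> is closed under
  removing a variable, so that each of its exponents is reached from 0 without leaving it.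

  A point fixes the kernel of every corresponding \<phi>; conversely each relation between monomials
  is a membership in the kernel, so correspondence is a property of the equivalence class. In the
  base change, generators and relations show that \<Delta> spans, but a presentation bounds a module
  only from above; independence needs a map into a module already known to be free.\<close>

lemma finite_submultisets: "finite {u. u \<subseteq># m}"
proof (induction m)
  case empty
  then show ?case by simp
next
  case (add i m)
  have "{u. u \<subseteq># add_mset i m} \<subseteq> {u. u \<subseteq># m} \<union> add_mset i ` {u. u \<subseteq># m}"
  proof
    fix u assume u: "u \<in> {u. u \<subseteq># add_mset i m}"
    show "u \<in> {u. u \<subseteq># m} \<union> add_mset i ` {u. u \<subseteq># m}"
    proof (cases "i \<in># u")
      case True
      then obtain w where "u = add_mset i w" by (metis multi_member_split)
      with u show ?thesis by auto
    next
      case False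
      with u have "u \<subseteq># m"
        by (metis diff_single_trivial add_mset_remove_trivial mem_Collect_eq subset_eq_diff_conv
            add_mset_add_single)
      then show ?thesis by simp
    qed
  qed
  with add show ?case by (meson finite_UnI finite_imageI finite_subset)
qed

lemma (in abelian_monoid) finsum_swap:
  assumes "finite A" "finite B" "\<And>x y. x \<in> A \<Longrightarrow> y \<in> B \<Longrightarrow> f x y \<in> carrier G"
  shows "(\<Oplus>x\<in>A. \<Oplus>y\<in>B. f x y) = (\<Oplus>y\<in>B. \<Oplus>x\<in>A. f x y)"
  using assms(1,3)
proof (induction A rule: finite_induct)
  case (insert x A)
  then have "(\<Oplus>x\<in>insert x A. \<Oplus>y\<in>B. f x y) = (\<Oplus>y\<in>B. f x y) \<oplus> (\<Oplus>y\<in>B. \<Oplus>x\<in>A. f x y)"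
    by (simp add: Pi_def)
  also have "\<dots> = (\<Oplus>y\<in>B. f x y \<oplus> (\<Oplus>x\<in>A. f x y))"
    using insert by (subst finsum_addf) (auto simp: Pi_def)
  also have "\<dots> = (\<Oplus>y\<in>B. \<Oplus>x\<in>insert x A. f x y)"
    using insert by (intro finsum_cong') (auto simp: Pi_def)
  finally show ?case .
qed simp

text \<open>
  Pairwise commuting operators \<open>M i\<close> on \<open>V\<close> have a well-defined monomial orbit of \<open>e\<close>.  The operators
  are extended by the identity outside \<open>V\<close>, since \<^const>\<open>fold_mset\<close> needs commutation everywhere.
\<close>

lemma commuting_orbit:
  assumes closed: "\<And>i v. i \<in> I \<Longrightarrow> v \<in> V \<Longrightarrow> M i v \<in> V"
    and commute: "\<And>i j v. i \<in> I \<Longrightarrow> j \<in> I \<Longrightarrow> v \<in> V \<Longrightarrow> M i (M j v) = M j (M i v)"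
    and "e \<in> V"
  obtains g where "g {#} = e" "\<And>\<alpha>. set_mset \<alpha> \<subseteq> I \<Longrightarrow> g \<alpha> \<in> V"
    "\<And>i \<alpha>. i \<in> I \<Longrightarrow> set_mset \<alpha> \<subseteq> I \<Longrightarrow> g (add_mset i \<alpha>) = M i (g \<alpha>)"
proof -
  define M' where "M' i v = (if i \<in> I \<and> v \<in> V then M i v else v)" for i v
  interpret comp_fun_commute M'
    by standard (auto simp: M'_def fun_eq_iff closed commute)
  define g where "g = fold_mset M' e"
  have V: "g \<alpha> \<in> V" for \<alpha>
    by (induction \<alpha>) (auto simp: g_def M'_def closed \<open>e \<in> V\<close>)
  show thesis
  proof
    show "g {#} = e" by (simp add: g_def)
    show "g \<alpha> \<in> V" for \<alpha> by (rule V)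
    show "g (add_mset i \<alpha>) = M i (g \<alpha>)" if "i \<in> I" for i \<alpha>
      using V[of \<alpha>] that by (simp add: g_def M'_def)
  qed
qed

section \<open>The ring structure of a polynomial algebra\<close>

lemma mpoly_simps:
  "carrier (mpoly_alg R I) = ring.indexed_pset R I (carrier R)"
  "P \<otimes>\<^bsub>mpoly_alg R I\<^esub> Q = (\<lambda>m. \<Oplus>\<^bsub>R\<^esub>u\<in>{u. u \<subseteq># m}. P u \<otimes>\<^bsub>R\<^esub> Q (m - u))"
  "\<one>\<^bsub>mpoly_alg R I\<^esub> = ring.indexed_const R \<one>\<^bsub>R\<^esub>"
  "\<zero>\<^bsub>mpoly_alg R I\<^esub> = ring.indexed_const R \<zero>\<^bsub>R\<^esub>"
  "P \<oplus>\<^bsub>mpoly_alg R I\<^esub> Q = ring.indexed_padd R P Q"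
  "c \<odot>\<^bsub>mpoly_alg R I\<^esub> P = (\<lambda>m. c \<otimes>\<^bsub>R\<^esub> P m)"
  by (simp_all add: mpoly_alg_def)

context cring
begin

lemma indexed_pset_coeff: "p \<in> indexed_pset I (carrier R) \<Longrightarrow> p \<alpha> \<in> carrier R"
  using indexed_pset_in_carrier[of "carrier R" p I] carrier_coeffE by blast

text \<open>Each of the three constructors of the carrier preserves finite support. The sums over
  the support in \<open>mpoly_lin\<close> depend on this, as \<open>finsum\<close> is degenerate
  over infinite sets.\<close>

lemma indexed_pset_finite: "p \<in> indexed_pset I (carrier R) \<Longrightarrow> finite {\<alpha>. p \<alpha> \<noteq> \<zero>}"
proof (induction rule: indexed_pset.induct)
  case (indexed_const k)
  then show ?case by (auto simp: indexed_const_def intro: finite_subset[of _ "{{#}}"])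
next
  case (indexed_padd P Q)
  then show ?case
    by (auto simp: indexed_padd_def intro: finite_subset[of _ "{\<alpha>. P \<alpha> \<noteq> \<zero>} \<union> {\<alpha>. Q \<alpha> \<noteq> \<zero>}"])
next
  case (indexed_pmult P i)
  have "{\<alpha>. indexed_pmult P i \<alpha> \<noteq> \<zero>} \<subseteq> add_mset i ` {\<alpha>. P \<alpha> \<noteq> \<zero>}"
    by (auto simp: indexed_pmult_def image_iff intro!: exI[of _ "_ - {#i#}"])
  with indexed_pmult show ?case by (meson finite_imageI finite_subset)
qed

lemma indexed_pset_supp:
  "p \<in> indexed_pset I (carrier R) \<Longrightarrow> p \<alpha> \<noteq> \<zero> \<Longrightarrow> set_mset \<alpha> \<subseteq> I"
proof (induction arbitrary: \<alpha> rule: indexed_pset.induct)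
  case (indexed_const k)
  then show ?case by (auto simp: indexed_const_def split: if_splits)
next
  case (indexed_padd P Q)
  then have "P \<alpha> \<noteq> \<zero> \<or> Q \<alpha> \<noteq> \<zero>" by (auto simp: indexed_padd_def)
  with indexed_padd.IH show ?case by blast
next
  case (indexed_pmult P i)
  then have "i \<in># \<alpha>" "P (\<alpha> - {#i#}) \<noteq> \<zero>" by (auto simp: indexed_pmult_def split: if_splits)
  with indexed_pmult show ?case by (metis insert_DiffM insert_subset set_mset_add_mset_insert)
qed

lemma mpoly_var_in: "i \<in> I \<Longrightarrow> indexed_var i \<in> carrier (mpoly_alg R I)"
  unfolding indexed_var_def mpoly_simps
  by (intro indexed_pset.indexed_pmult indexed_pset.indexed_const) auto

lemma mpoly_monom_empty: "mpoly_monom R {#} = indexed_const \<one>"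
  by (auto simp: mpoly_monom_def indexed_const_def)

lemma mpoly_monom_add_mset: "mpoly_monom R (add_mset i \<alpha>) = indexed_pmult (mpoly_monom R \<alpha>) i"
  by (auto simp: mpoly_monom_def indexed_pmult_def fun_eq_iff dest!: multi_member_split)

lemma mpoly_monom_single: "mpoly_monom R {#i#} = indexed_var i"
  by (simp add: mpoly_monom_add_mset mpoly_monom_empty indexed_var_def)

lemma mpoly_monom_in: "set_mset \<alpha> \<subseteq> I \<Longrightarrow> mpoly_monom R \<alpha> \<in> carrier (mpoly_alg R I)"
  by (induction \<alpha>)
    (auto simp: mpoly_simps mpoly_monom_empty mpoly_monom_add_mset
      intro: indexed_pset.indexed_const indexed_pset.indexed_pmult)

text \<open>The carrier is generated by constants, sums and multiplication by a variable. This lemma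
  and the next two compute a product whose left factor has one of these forms, which reduces closure
  and associativity to induction on the left factor.\<close>

lemma mpoly_mult_const:
  assumes "k \<in> carrier R" "\<And>\<alpha>. q \<alpha> \<in> carrier R"
  shows "indexed_const k \<otimes>\<^bsub>mpoly_alg R I\<^esub> q = k \<odot>\<^bsub>mpoly_alg R I\<^esub> q"
proof
  fix m
  have "(\<Oplus>u\<in>{u. u \<subseteq># m}. indexed_const k u \<otimes> q (m - u)) = (\<Oplus>u\<in>{{#}}. k \<otimes> q (m - u))"
    using assms by (intro add.finprod_mono_neutral_cong_right)
      (auto simp: finite_submultisets indexed_const_def Pi_def)
  then show "(indexed_const k \<otimes>\<^bsub>mpoly_alg R I\<^esub> q) m = (k \<odot>\<^bsub>mpoly_alg R I\<^esub> q) m"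
    using assms by (simp add: mpoly_simps)
qed

lemma mpoly_mult_add:
  assumes "\<And>\<alpha>. p \<alpha> \<in> carrier R" "\<And>\<alpha>. q \<alpha> \<in> carrier R" "\<And>\<alpha>. r \<alpha> \<in> carrier R"
  shows "indexed_padd p q \<otimes>\<^bsub>mpoly_alg R I\<^esub> r =
    indexed_padd (p \<otimes>\<^bsub>mpoly_alg R I\<^esub> r) (q \<otimes>\<^bsub>mpoly_alg R I\<^esub> r)"
  using assms by (simp add: mpoly_simps indexed_padd_def fun_eq_iff l_distr Pi_def)

lemma mpoly_mult_pmult:
  assumes "\<And>\<alpha>. p \<alpha> \<in> carrier R" "\<And>\<alpha>. q \<alpha> \<in> carrier R"
  shows "indexed_pmult p i \<otimes>\<^bsub>mpoly_alg R I\<^esub> q = indexed_pmult (p \<otimes>\<^bsub>mpoly_alg R I\<^esub> q) i"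
proof
  fix m
  show "(indexed_pmult p i \<otimes>\<^bsub>mpoly_alg R I\<^esub> q) m = indexed_pmult (p \<otimes>\<^bsub>mpoly_alg R I\<^esub> q) i m"
  proof (cases "i \<in># m")
    case True
    then obtain m' where m: "m = add_mset i m'" by (metis multi_member_split)
    \<comment> \<open>Only the \<open>u\<close> that contain \<open>i\<close> contribute; removing
      one \<open>i\<close> from them gives exactly the submultisets of \<open>m'\<close>.\<close>
    have "(\<Oplus>u\<in>{u. u \<subseteq># m}. indexed_pmult p i u \<otimes> q (m - u)) =
        (\<Oplus>u\<in>add_mset i ` {u. u \<subseteq># m'}. indexed_pmult p i u \<otimes> q (m - u))"
      using assms
    proof (intro add.finprod_mono_neutral_cong_right)
      show "\<And>u. u \<in> {u. u \<subseteq># m} - add_mset i ` {u. u \<subseteq># m'} \<Longrightarrow> indexed_pmult p i u \<otimes> q (m - u) = \<zero>"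
        using assms by (auto simp: indexed_pmult_def m image_iff dest!: multi_member_split)
    qed (auto simp: finite_submultisets indexed_pmult_def m)
    also have "\<dots> = (\<Oplus>u\<in>{u. u \<subseteq># m'}. indexed_pmult p i (add_mset i u) \<otimes> q (m - add_mset i u))"
      using assms by (intro finsum_reindex) (auto simp: indexed_pmult_def inj_on_def)
    finally show ?thesis by (simp add: mpoly_simps indexed_pmult_def m)
  next
    case False
    \<comment> \<open>No submultiset of \<open>m\<close> contains \<open>i\<close>, so every summand
      on the left vanishes.\<close>
    then have "i \<notin># u" if "u \<subseteq># m" for u using that by (meson mset_subset_eqD)
    with False assms show ?thesis
      by (auto simp: mpoly_simps indexed_pmult_def intro!: add.finprod_one_eqI)
  qed
qed

text \<open>The substitution of \<open>m - u\<close> for \<open>u\<close> is an involution of the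
  submultisets of \<open>m\<close> and exchanges the arguments of the two factors in each
  summand.\<close>

lemma mpoly_mult_comm:
  fixes p q :: "'c multiset \<Rightarrow> 'a"
  assumes "\<And>\<alpha>. p \<alpha> \<in> carrier R" "\<And>\<alpha>. q \<alpha> \<in> carrier R"
  shows "p \<otimes>\<^bsub>mpoly_alg R I\<^esub> q = q \<otimes>\<^bsub>mpoly_alg R I\<^esub> p"
proof
  fix m :: "'c multiset"
  have inv: "m - (m - u) = u" if "u \<subseteq># m" for u
    using that by (simp add: multiset_eq_iff subseteq_mset_def)
  have inj: "inj_on ((-) m) {u. u \<subseteq># m}"
    by (rule inj_on_inverseI[where g = "(-) m"]) (simp add: inv)
  have im: "(-) m ` {u. u \<subseteq># m} = {u. u \<subseteq># m}"
  proof (intro equalityI subsetI)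
    fix u assume "u \<in> {u. u \<subseteq># m}"
    then show "u \<in> (-) m ` {u. u \<subseteq># m}"
      by (intro image_eqI[of _ _ "m - u"]) (auto simp: inv)
  qed auto
  have "(\<Oplus>u\<in>{u. u \<subseteq># m}. p u \<otimes> q (m - u)) = (\<Oplus>u\<in>(-) m ` {u. u \<subseteq># m}. p u \<otimes> q (m - u))"
    by (simp add: im)
  also have "\<dots> = (\<Oplus>u\<in>{u. u \<subseteq># m}. p (m - u) \<otimes> q (m - (m - u)))"
    using assms inj by (intro finsum_reindex) auto
  also have "\<dots> = (\<Oplus>u\<in>{u. u \<subseteq># m}. q u \<otimes> p (m - u))"
    using assms by (intro finsum_cong') (auto simp: inv m_comm)
  finally show "(p \<otimes>\<^bsub>mpoly_alg R I\<^esub> q) m = (q \<otimes>\<^bsub>mpoly_alg R I\<^esub> p) m"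
    by (simp add: mpoly_simps)
qed

text \<open>Membership in the carrier is inductive and not pointwise, so the scalar is pushed
  through the three constructors. The scalar -1 provides the additive inverses in
  \<open>mpoly_abelian_group\<close>.\<close>

lemma mpoly_smult_in:
  assumes "p \<in> carrier (mpoly_alg R I)" "k \<in> carrier R"
  shows "k \<odot>\<^bsub>mpoly_alg R I\<^esub> p \<in> carrier (mpoly_alg R I)"
  using assms(1) unfolding mpoly_simps
proof (induction rule: indexed_pset.induct)
  case (indexed_const c)
  have eq: "(\<lambda>m. k \<otimes> indexed_const c m) = indexed_const (k \<otimes> c)"
    using assms by (auto simp: indexed_const_def)
  show ?case unfolding eq using indexed_const assms by (intro indexed_pset.indexed_const) simp
next
  case (indexed_padd p q)
  have eq: "(\<lambda>m. k \<otimes> indexed_padd p q m) = indexed_padd (\<lambda>m. k \<otimes> p m) (\<lambda>m. k \<otimes> q m)"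
    using assms indexed_padd.hyps[THEN indexed_pset_coeff] by (auto simp: indexed_padd_def r_distr)
  show ?case unfolding eq using indexed_padd.IH by (rule indexed_pset.indexed_padd)
next
  case (indexed_pmult p i)
  have eq: "(\<lambda>m. k \<otimes> indexed_pmult p i m) = indexed_pmult (\<lambda>m. k \<otimes> p m) i"
    using assms by (auto simp: indexed_pmult_def)
  show ?case unfolding eq using indexed_pmult.IH indexed_pmult.hyps(2) by (rule indexed_pset.indexed_pmult)
qed

lemma mpoly_mult_in:
  assumes "p \<in> carrier (mpoly_alg R I)" "q \<in> carrier (mpoly_alg R I)"
  shows "p \<otimes>\<^bsub>mpoly_alg R I\<^esub> q \<in> carrier (mpoly_alg R I)"
proof -
  have q: "q \<alpha> \<in> carrier R" for \<alpha> using assms(2) by (simp add: mpoly_simps indexed_pset_coeff)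
  from assms(1)[unfolded mpoly_simps] show ?thesis
  proof (induction rule: indexed_pset.induct)
    case (indexed_const k)
    then show ?case using mpoly_smult_in[OF assms(2)] q by (simp add: mpoly_mult_const)
  next
    case (indexed_padd p p')
    then show ?case using q
      by (simp add: mpoly_mult_add indexed_pset_coeff)
        (auto simp: mpoly_simps(1) intro: indexed_pset.indexed_padd)
  next
    case (indexed_pmult p i)
    then show ?case using q
      by (simp add: mpoly_mult_pmult indexed_pset_coeff)
        (auto simp: mpoly_simps(1) intro: indexed_pset.indexed_pmult)
  qed
qed

lemma mpoly_mult_assoc:
  assumes "p \<in> carrier (mpoly_alg R I)" "q \<in> carrier (mpoly_alg R I)" "r \<in> carrier (mpoly_alg R I)"
  shows "p \<otimes>\<^bsub>mpoly_alg R I\<^esub> q \<otimes>\<^bsub>mpoly_alg R I\<^esub> r = p \<otimes>\<^bsub>mpoly_alg R I\<^esub> (q \<otimes>\<^bsub>mpoly_alg R I\<^esub> r)"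
proof -
  have coeff: "p \<alpha> \<in> carrier R" if "p \<in> carrier (mpoly_alg R I)" for p \<alpha>
    using that by (simp add: mpoly_simps indexed_pset_coeff)
  note q = coeff[OF assms(2)] and r = coeff[OF assms(3)]
  note qr = coeff[OF mpoly_mult_in[OF assms(2,3)]]
  from assms(1)[unfolded mpoly_simps] show ?thesis
  proof (induction rule: indexed_pset.induct)
    case (indexed_const k)
    have "(k \<odot>\<^bsub>mpoly_alg R I\<^esub> q) \<otimes>\<^bsub>mpoly_alg R I\<^esub> r = k \<odot>\<^bsub>mpoly_alg R I\<^esub> (q \<otimes>\<^bsub>mpoly_alg R I\<^esub> r)"
      using indexed_const q r
      by (simp add: mpoly_simps fun_eq_iff finsum_rdistr finite_submultisets Pi_def m_assoc)
    then show ?case using indexed_const q r qr by (simp add: mpoly_mult_const)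
  next
    case (indexed_padd p p')
    note p = indexed_padd.hyps[folded mpoly_simps(1)[of R]]
    note p[THEN coeff] and p[THEN mpoly_mult_in, OF assms(2), THEN coeff]
    with indexed_padd.IH q r qr show ?case by (simp add: mpoly_mult_add)
  next
    case (indexed_pmult p i)
    note p = indexed_pmult.hyps(1)[folded mpoly_simps(1)[of R]]
    note coeff[OF p] and coeff[OF mpoly_mult_in[OF p assms(2)]]
    with indexed_pmult.IH q r qr show ?case by (simp add: mpoly_mult_pmult)
  qed
qed

lemma mpoly_abelian_group: "abelian_group (mpoly_alg R I)"
proof (rule abelian_groupI)
  fix p q r assume p: "p \<in> carrier (mpoly_alg R I)" and q: "q \<in> carrier (mpoly_alg R I)"
    and r: "r \<in> carrier (mpoly_alg R I)"
  note [simp] = p[unfolded mpoly_simps, THEN indexed_pset_coeff]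
    q[unfolded mpoly_simps, THEN indexed_pset_coeff] r[unfolded mpoly_simps, THEN indexed_pset_coeff]
  show "p \<oplus>\<^bsub>mpoly_alg R I\<^esub> q \<in> carrier (mpoly_alg R I)"
    using p q by (auto simp: mpoly_simps intro: indexed_pset.indexed_padd)
  show "p \<oplus>\<^bsub>mpoly_alg R I\<^esub> q \<oplus>\<^bsub>mpoly_alg R I\<^esub> r = p \<oplus>\<^bsub>mpoly_alg R I\<^esub> (q \<oplus>\<^bsub>mpoly_alg R I\<^esub> r)"
    "p \<oplus>\<^bsub>mpoly_alg R I\<^esub> q = q \<oplus>\<^bsub>mpoly_alg R I\<^esub> p"
    by (auto simp: mpoly_simps indexed_padd_def a_ac)
  show "\<zero>\<^bsub>mpoly_alg R I\<^esub> \<oplus>\<^bsub>mpoly_alg R I\<^esub> p = p"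
    by (auto simp: mpoly_simps indexed_padd_def indexed_const_def)
  have "\<ominus> \<one> \<odot>\<^bsub>mpoly_alg R I\<^esub> p \<in> carrier (mpoly_alg R I)"
    using p by (intro mpoly_smult_in) auto
  moreover have "(\<ominus> \<one> \<odot>\<^bsub>mpoly_alg R I\<^esub> p) \<oplus>\<^bsub>mpoly_alg R I\<^esub> p = \<zero>\<^bsub>mpoly_alg R I\<^esub>"
    by (auto simp: mpoly_simps indexed_padd_def indexed_const_def l_minus l_neg)
  ultimately show "\<exists>q\<in>carrier (mpoly_alg R I). q \<oplus>\<^bsub>mpoly_alg R I\<^esub> p = \<zero>\<^bsub>mpoly_alg R I\<^esub>" by blast
qed (auto simp: mpoly_simps intro: indexed_pset.indexed_const)

lemma mpoly_algebra: "algebra R (mpoly_alg R I)"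
proof (rule algebraI)
  let ?P = "mpoly_alg R I"
  have coeff: "p \<alpha> \<in> carrier R" if "p \<in> carrier ?P" for p \<alpha>
    using that by (simp add: mpoly_simps indexed_pset_coeff)
  have one: "\<one>\<^bsub>?P\<^esub> \<in> carrier ?P" by (auto simp: mpoly_simps intro: indexed_pset.indexed_const)
  show "cring ?P"
  proof (rule cringI[OF mpoly_abelian_group])
    show "comm_monoid ?P"
    proof (rule comm_monoidI)
      show "\<one>\<^bsub>?P\<^esub> \<otimes>\<^bsub>?P\<^esub> p = p" if "p \<in> carrier ?P" for p
        using coeff[OF that] mpoly_mult_const[of \<one> p I] by (simp add: mpoly_simps)
    qed (auto simp: one mpoly_mult_in mpoly_mult_assoc coeff intro: mpoly_mult_comm)
    show "(p \<oplus>\<^bsub>?P\<^esub> q) \<otimes>\<^bsub>?P\<^esub> r = p \<otimes>\<^bsub>?P\<^esub> r \<oplus>\<^bsub>?P\<^esub> q \<otimes>\<^bsub>?P\<^esub> r"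
      if "p \<in> carrier ?P" "q \<in> carrier ?P" "r \<in> carrier ?P" for p q r
      using that[THEN coeff] mpoly_mult_add[of p q r I] by (simp add: mpoly_simps)
  qed
  fix k p q assume k: "k \<in> carrier R" and p: "p \<in> carrier ?P" and q: "q \<in> carrier ?P"
  show "(k \<odot>\<^bsub>?P\<^esub> p) \<otimes>\<^bsub>?P\<^esub> q = k \<odot>\<^bsub>?P\<^esub> (p \<otimes>\<^bsub>?P\<^esub> q)"
    using k coeff[OF p] coeff[OF q]
    by (simp add: mpoly_simps fun_eq_iff finsum_rdistr finite_submultisets Pi_def m_assoc)
qed (auto simp: is_cring mpoly_smult_in,
  auto simp: mpoly_simps indexed_padd_def l_distr r_distr m_assoc indexed_pset_coeff)

lemma indexed_const_eq:
  assumes "k \<in> carrier R"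
  shows "indexed_const k = k \<odot>\<^bsub>mpoly_alg R I\<^esub> \<one>\<^bsub>mpoly_alg R I\<^esub>"
  using assms by (auto simp: mpoly_simps indexed_const_def)

lemma indexed_pmult_eq:
  assumes "p \<in> carrier (mpoly_alg R I)"
  shows "indexed_pmult p i = indexed_var i \<otimes>\<^bsub>mpoly_alg R I\<^esub> p"
proof -
  note p = indexed_pset_coeff[OF assms[unfolded mpoly_simps]]
  have "indexed_var i \<otimes>\<^bsub>mpoly_alg R I\<^esub> p = indexed_pmult (indexed_const \<one> \<otimes>\<^bsub>mpoly_alg R I\<^esub> p) i"
    unfolding indexed_var_def by (rule mpoly_mult_pmult) (auto simp: indexed_const_def p)
  also have "\<dots> = indexed_pmult p i"
    using p by (simp add: mpoly_mult_const) (simp add: mpoly_simps)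
  finally show ?thesis ..
qed

lemma mpoly_monom_add_mset_eq:
  assumes "set_mset \<alpha> \<subseteq> I"
  shows "mpoly_monom R (add_mset i \<alpha>) = indexed_var i \<otimes>\<^bsub>mpoly_alg R I\<^esub> mpoly_monom R \<alpha>"
  using indexed_pmult_eq[OF mpoly_monom_in[OF assms]] by (simp add: mpoly_monom_add_mset)

text \<open>Phrased with the operations of the algebra instead of the constructors of
  \<open>indexed_pset\<close>, so that a homomorphism can be applied in every case.\<close>

lemma mpoly_induct [consumes 1, case_names const add var]:
  assumes "p \<in> carrier (mpoly_alg R I)"
    and "\<And>k. k \<in> carrier R \<Longrightarrow> Pr (k \<odot>\<^bsub>mpoly_alg R I\<^esub> \<one>\<^bsub>mpoly_alg R I\<^esub>)"
    and "\<And>p q. p \<in> carrier (mpoly_alg R I) \<Longrightarrow> q \<in> carrier (mpoly_alg R I) \<Longrightarrow> Pr p \<Longrightarrow> Pr q \<Longrightarrow>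
      Pr (p \<oplus>\<^bsub>mpoly_alg R I\<^esub> q)"
    and "\<And>p i. p \<in> carrier (mpoly_alg R I) \<Longrightarrow> i \<in> I \<Longrightarrow> Pr p \<Longrightarrow>
      Pr (indexed_var i \<otimes>\<^bsub>mpoly_alg R I\<^esub> p)"
  shows "Pr p"
  using assms(1)[unfolded mpoly_simps]
proof (induction rule: indexed_pset.induct)
  case (indexed_const k)
  with assms(2) show ?case by (simp add: indexed_const_eq[symmetric])
next
  case (indexed_padd p q)
  with assms(3)[of p q] show ?case by (simp add: mpoly_simps)
next
  case (indexed_pmult p i)
  with assms(4)[of p i] indexed_pmult_eq[of p I i] show ?case by (simp add: mpoly_simps(1))
qed

end

section \<open>Quotients and evaluation\<close>

lemma (in algebra) smult_one_mult:
  assumes "c \<in> carrier R" "x \<in> carrier M"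
  shows "(c \<odot>\<^bsub>M\<^esub> \<one>\<^bsub>M\<^esub>) \<otimes>\<^bsub>M\<^esub> x = c \<odot>\<^bsub>M\<^esub> x"
  using assms by (simp add: smult_assoc2)

text \<open>This is the structure map of the algebra. Evaluation takes its coefficients through a
  ring homomorphism; with this one it applies to algebras.\<close>

lemma (in algebra) smult_one_hom: "(\<lambda>c. c \<odot>\<^bsub>M\<^esub> \<one>\<^bsub>M\<^esub>) \<in> ring_hom R M"
  by (rule ring_hom_memI) (auto simp: smult_assoc2 smult_assoc1 smult_l_distr)

lemma alg_hom_ring_hom: "h \<in> alg_hom R A B \<Longrightarrow> h \<in> ring_hom A B"
  by (simp add: alg_hom_def)

lemma alg_hom_smult:
  "h \<in> alg_hom R A B \<Longrightarrow> c \<in> carrier R \<Longrightarrow> x \<in> carrier A \<Longrightarrow> h (c \<odot>\<^bsub>A\<^esub> x) = c \<odot>\<^bsub>B\<^esub> h x"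
  by (simp add: alg_hom_def)

lemma alg_hom_ring_hom_cring:
  assumes "algebra R A" "algebra R B" "h \<in> alg_hom R A B"
  shows "ring_hom_cring A B h"
  using assms
  by (simp add: ring_hom_cring_def ring_hom_cring_axioms_def alg_hom_ring_hom algebra.M_cring)

lemma ring_hom_cring_kernel_ideal:
  assumes "ring_hom_cring A B h"
  shows "ideal (a_kernel A B h) A"
proof -
  interpret ring_hom_cring A B h by fact
  have "ring_hom_ring A B h"
    by (intro ring_hom_ringI2 homh R.ring_axioms S.ring_axioms)
  then show ?thesis by (rule ring_hom_ring.kernel_is_ideal)
qed

lemma a_kernel_iff: "x \<in> a_kernel A B h \<longleftrightarrow> x \<in> carrier A \<and> h x = \<zero>\<^bsub>B\<^esub>"
  by (auto simp: a_kernel_def')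

locale quotient_algebra = A: algebra R A + J: ideal J A for R (structure) and A (structure) and J
begin

lemma quot_carrier: "carrier (quot_alg A J) = (\<lambda>x. J +>\<^bsub>A\<^esub> x) ` carrier A"
  by (auto simp: quot_alg_def FactRing_def A_RCOSETS_def')

text \<open>\<open>quot_alg\<close> forms a union over all representatives of a coset. The union
  collapses to one coset because J is closed under scalars: c acts on J as multiplication by the
  ring element \<open>c \<odot> \<one>\<close>.\<close>

lemma quot_smult:
  assumes "c \<in> carrier R" "x \<in> carrier A"
  shows "c \<odot>\<^bsub>quot_alg A J\<^esub> (J +>\<^bsub>A\<^esub> x) = J +>\<^bsub>A\<^esub> (c \<odot>\<^bsub>A\<^esub> x)"
proof -
  have "J +>\<^bsub>A\<^esub> (c \<odot>\<^bsub>A\<^esub> y) = J +>\<^bsub>A\<^esub> (c \<odot>\<^bsub>A\<^esub> x)" if y: "y \<in> J +>\<^bsub>A\<^esub> x" for y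
  proof -
    from y obtain j where j: "j \<in> J" "y = j \<oplus>\<^bsub>A\<^esub> x" by (auto simp: a_r_coset_def')
    then have jA: "j \<in> carrier A" by (simp add: J.Icarr)
    have "c \<odot>\<^bsub>A\<^esub> j = (c \<odot>\<^bsub>A\<^esub> \<one>\<^bsub>A\<^esub>) \<otimes>\<^bsub>A\<^esub> j" using assms jA by (simp add: A.smult_one_mult)
    also have "\<dots> \<in> J" using assms j by (intro J.I_l_closed) auto
    finally have "c \<odot>\<^bsub>A\<^esub> y \<in> J +>\<^bsub>A\<^esub> (c \<odot>\<^bsub>A\<^esub> x)"
      using assms j jA by (auto simp: a_r_coset_def' A.smult_r_distr)
    then show ?thesis using assms by (intro J.a_repr_independence'[symmetric]) auto
  qed
  then have "(\<Union>y\<in>J +>\<^bsub>A\<^esub> x. J +>\<^bsub>A\<^esub> (c \<odot>\<^bsub>A\<^esub> y)) = (\<Union>y\<in>J +>\<^bsub>A\<^esub> x. J +>\<^bsub>A\<^esub> (c \<odot>\<^bsub>A\<^esub> x))"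
    by (rule SUP_cong[OF refl])
  moreover have "x \<in> J +>\<^bsub>A\<^esub> x" using assms by (intro J.a_rcos_self)
  ultimately show ?thesis unfolding quot_alg_def by fastforce
qed

lemma quot_proj_ring_hom: "(\<lambda>x. J +>\<^bsub>A\<^esub> x) \<in> ring_hom A (quot_alg A J)"
  using J.rcos_ring_hom by (simp add: ring_hom_def quot_alg_def)

lemma quot_zero: "\<zero>\<^bsub>quot_alg A J\<^esub> = J"
  by (simp add: quot_alg_def FactRing_def)

lemma quot_cring: "cring (quot_alg A J)"
proof -
  note hom = quot_proj_ring_hom
  have zero: "J +>\<^bsub>A\<^esub> \<zero>\<^bsub>A\<^esub> = \<zero>\<^bsub>quot_alg A J\<^esub>"
    by (simp add: J.a_rcos_const quot_zero)
  \<comment> \<open>The image of a ring under a homomorphism is a ring for the record with carrier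
    and zero replaced; here both replacements change nothing.\<close>
  have "ring (quot_alg A J \<lparr>carrier := (\<lambda>x. J +>\<^bsub>A\<^esub> x) ` carrier A, ring.zero := J +>\<^bsub>A\<^esub> \<zero>\<^bsub>A\<^esub>\<rparr>)"
    by (rule A.ring_hom_imp_img_ring[OF hom])
  moreover have "quot_alg A J \<lparr>carrier := (\<lambda>x. J +>\<^bsub>A\<^esub> x) ` carrier A, ring.zero := J +>\<^bsub>A\<^esub> \<zero>\<^bsub>A\<^esub>\<rparr> = quot_alg A J"
    unfolding quot_carrier[symmetric] zero by simp
  ultimately interpret Q: ring "quot_alg A J" by simp
  show ?thesis
    by unfold_locales (auto simp: quot_carrier ring_hom_mult[OF hom, symmetric] A.m_comm)
qed

lemma quot_algebra: "algebra R (quot_alg A J)"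
proof -
  interpret Q: cring "quot_alg A J" by (rule quot_cring)
  note hom = quot_proj_ring_hom
  note add = ring_hom_add[OF hom, symmetric] and mult = ring_hom_mult[OF hom, symmetric]
  show ?thesis
    by (rule algebraI)
      (auto simp: A.R_cring Q.is_cring quot_carrier quot_smult add mult
        A.smult_l_distr A.smult_r_distr A.smult_assoc1 A.smult_assoc2)
qed

lemma quot_proj_hom: "(\<lambda>x. J +>\<^bsub>A\<^esub> x) \<in> alg_hom R A (quot_alg A J)"
  by (auto simp: alg_hom_def quot_proj_ring_hom quot_smult)

lemma quot_proj_zero_iff:
  assumes "x \<in> carrier A"
  shows "J +>\<^bsub>A\<^esub> x = \<zero>\<^bsub>quot_alg A J\<^esub> \<longleftrightarrow> x \<in> J"
  using assms J.a_rcos_const J.a_rcos_self by (auto simp: quot_zero)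

lemma quot_lift:
  assumes B: "algebra R B" and h: "h \<in> alg_hom R A B" and ker: "\<And>x. x \<in> J \<Longrightarrow> h x = \<zero>\<^bsub>B\<^esub>"
  obtains u where "u \<in> alg_hom R (quot_alg A J) B" "u \<in> extensional (carrier (quot_alg A J))"
    "\<And>x. x \<in> carrier A \<Longrightarrow> u (J +>\<^bsub>A\<^esub> x) = h x"
proof -
  interpret B: algebra R B by fact
  interpret h: ring_hom_cring A B h using A.algebra_axioms B h by (rule alg_hom_ring_hom_cring)
  interpret Q: algebra R "quot_alg A J" by (rule quot_algebra)
  \<comment> \<open>The value is read off from a chosen representative; two representatives differ
    by an element of J, which \<open>h\<close> kills. \<open>restrict\<close> supplies the
    extensionality demanded by \<open>hilb_homset\<close>.\<close>
  define u where "u = restrict (\<lambda>S. h (SOME x. x \<in> S)) (carrier (quot_alg A J))"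
  have u: "u (J +>\<^bsub>A\<^esub> x) = h x" if x: "x \<in> carrier A" for x
  proof -
    have "(SOME y. y \<in> J +>\<^bsub>A\<^esub> x) \<in> J +>\<^bsub>A\<^esub> x" using J.a_rcos_self[OF x] by (rule someI)
    then obtain j where j: "j \<in> J" "(SOME y. y \<in> J +>\<^bsub>A\<^esub> x) = j \<oplus>\<^bsub>A\<^esub> x" by (auto simp: a_r_coset_def')
    then have "j \<in> carrier A" by (simp add: J.Icarr)
    with j x show ?thesis by (auto simp: u_def quot_carrier ker)
  qed
  show thesis
  proof
    show "u \<in> alg_hom R (quot_alg A J) B"
      unfolding alg_hom_def
    proof (intro CollectI conjI ballI ring_hom_memI)
      show "u \<one>\<^bsub>quot_alg A J\<^esub> = \<one>\<^bsub>B\<^esub>"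
        using u[of "\<one>\<^bsub>A\<^esub>"] ring_hom_one[OF quot_proj_ring_hom] by simp
    qed (auto simp: quot_carrier u quot_smult alg_hom_smult[OF h]
        ring_hom_add[OF quot_proj_ring_hom, symmetric] ring_hom_mult[OF quot_proj_ring_hom, symmetric])
    show "u \<in> extensional (carrier (quot_alg A J))" by (simp add: u_def)
  qed (rule u)
qed

end

section \<open>Linear maps and evaluation homomorphisms out of a polynomial algebra\<close>

definition mpoly_lin ::
  "('a, 'm) ring_scheme \<Rightarrow> ('e, 'l) ring_scheme \<Rightarrow> ('a \<Rightarrow> 'e) \<Rightarrow> ('c multiset \<Rightarrow> 'e) \<Rightarrow> ('c multiset \<Rightarrow> 'a) \<Rightarrow> 'e"
where
  "mpoly_lin R A h g p = (\<Oplus>\<^bsub>A\<^esub>\<alpha>\<in>{\<alpha>. p \<alpha> \<noteq> \<zero>\<^bsub>R\<^esub>}. h (p \<alpha>) \<otimes>\<^bsub>A\<^esub> g \<alpha>)"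

text \<open>Multiplicativity of \<open>g\<close> is added only in \<open>mpoly_eval\<close>, because
  \<open>mpoly_lin\<close> also serves for the coordinate functionals of a point, which are linear
  but not multiplicative.\<close>

locale mpoly_linear = R: cring R + A: cring A
  for R :: "('a, 'm) ring_scheme" and A :: "('e, 'l) ring_scheme" +
  fixes I :: "'c set" and h :: "'a \<Rightarrow> 'e" and g :: "'c multiset \<Rightarrow> 'e"
  assumes h_hom: "h \<in> ring_hom R A"
    and g_closed: "\<And>\<alpha>. set_mset \<alpha> \<subseteq> I \<Longrightarrow> g \<alpha> \<in> carrier A"
begin

abbreviation "lin \<equiv> mpoly_lin R A h g"
abbreviation "P \<equiv> mpoly_alg R I"

sublocale h: ring_hom_cring R A h
  by unfold_locales (rule h_hom)

sublocale P: algebra R P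
  by (rule R.mpoly_algebra)

lemma coeff: "p \<in> carrier P \<Longrightarrow> p \<alpha> \<in> carrier R"
  by (simp add: mpoly_simps R.indexed_pset_coeff)

lemma finite_supp: "p \<in> carrier P \<Longrightarrow> finite {\<alpha>. p \<alpha> \<noteq> \<zero>\<^bsub>R\<^esub>}"
  by (simp add: mpoly_simps R.indexed_pset_finite)

lemma supp_subset: "p \<in> carrier P \<Longrightarrow> p \<alpha> \<noteq> \<zero>\<^bsub>R\<^esub> \<Longrightarrow> set_mset \<alpha> \<subseteq> I"
  by (simp add: mpoly_simps R.indexed_pset_supp)

lemma g_supp: "p \<in> carrier P \<Longrightarrow> p \<alpha> \<noteq> \<zero>\<^bsub>R\<^esub> \<Longrightarrow> g \<alpha> \<in> carrier A"
  by (rule g_closed[OF supp_subset])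

text \<open>Supports shrink under cancellation, so sums for p, q and their sum have different index
  sets. Padding with zero terms brings them to a common finite one.\<close>

lemma lin_superset:
  assumes "p \<in> carrier P" "finite F" "{\<alpha>. p \<alpha> \<noteq> \<zero>\<^bsub>R\<^esub>} \<subseteq> F" "\<And>\<alpha>. \<alpha> \<in> F \<Longrightarrow> set_mset \<alpha> \<subseteq> I"
  shows "lin p = (\<Oplus>\<^bsub>A\<^esub>\<alpha>\<in>F. h (p \<alpha>) \<otimes>\<^bsub>A\<^esub> g \<alpha>)"
  unfolding mpoly_lin_def using assms coeff[OF assms(1)]
  by (intro A.add.finprod_mono_neutral_cong_left) (auto simp: g_closed)

lemma lin_closed: "p \<in> carrier P \<Longrightarrow> lin p \<in> carrier A"
  unfolding mpoly_lin_def
  by (intro A.finsum_closed) (auto simp: coeff g_supp)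

lemma lin_add:
  assumes "p \<in> carrier P" "q \<in> carrier P"
  shows "lin (p \<oplus>\<^bsub>P\<^esub> q) = lin p \<oplus>\<^bsub>A\<^esub> lin q"
proof -
  let ?F = "{\<alpha>. p \<alpha> \<noteq> \<zero>\<^bsub>R\<^esub>} \<union> {\<alpha>. q \<alpha> \<noteq> \<zero>\<^bsub>R\<^esub>}"
  have F: "finite ?F" "\<And>\<alpha>. \<alpha> \<in> ?F \<Longrightarrow> set_mset \<alpha> \<subseteq> I"
    using finite_supp supp_subset assms by blast+
  note cf = assms[THEN coeff]
  have "lin (p \<oplus>\<^bsub>P\<^esub> q) = (\<Oplus>\<^bsub>A\<^esub>\<alpha>\<in>?F. h ((p \<oplus>\<^bsub>P\<^esub> q) \<alpha>) \<otimes>\<^bsub>A\<^esub> g \<alpha>)"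
    using assms F P.a_closed[OF assms]
    by (intro lin_superset) (auto simp: mpoly_simps(5) R.indexed_padd_def)
  also have "\<dots> = (\<Oplus>\<^bsub>A\<^esub>\<alpha>\<in>?F. h (p \<alpha>) \<otimes>\<^bsub>A\<^esub> g \<alpha> \<oplus>\<^bsub>A\<^esub> h (q \<alpha>) \<otimes>\<^bsub>A\<^esub> g \<alpha>)"
    using F cf g_closed
    by (intro A.finsum_cong') (auto simp: mpoly_simps R.indexed_padd_def A.l_distr)
  also have "\<dots> = lin p \<oplus>\<^bsub>A\<^esub> lin q"
    using F cf g_closed lin_superset[OF assms(1) F(1) _ F(2)] lin_superset[OF assms(2) F(1) _ F(2)]
    by (subst A.finsum_addf) auto
  finally show ?thesis .
qed

lemma lin_smult:
  assumes "p \<in> carrier P" "c \<in> carrier R"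
  shows "lin (c \<odot>\<^bsub>P\<^esub> p) = h c \<otimes>\<^bsub>A\<^esub> lin p"
proof -
  let ?F = "{\<alpha>. p \<alpha> \<noteq> \<zero>\<^bsub>R\<^esub>}"
  have F: "finite ?F" "\<And>\<alpha>. \<alpha> \<in> ?F \<Longrightarrow> set_mset \<alpha> \<subseteq> I"
    using finite_supp supp_subset assms by blast+
  note cf = assms(1)[THEN coeff]
  have "lin (c \<odot>\<^bsub>P\<^esub> p) = (\<Oplus>\<^bsub>A\<^esub>\<alpha>\<in>?F. h ((c \<odot>\<^bsub>P\<^esub> p) \<alpha>) \<otimes>\<^bsub>A\<^esub> g \<alpha>)"
    using assms F P.smult_closed[OF assms(2,1)] by (intro lin_superset) (auto simp: mpoly_simps(6))
  also have "\<dots> = (\<Oplus>\<^bsub>A\<^esub>\<alpha>\<in>?F. h c \<otimes>\<^bsub>A\<^esub> (h (p \<alpha>) \<otimes>\<^bsub>A\<^esub> g \<alpha>))"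
    using F cf g_closed assms by (intro A.finsum_cong') (auto simp: mpoly_simps A.m_assoc)
  also have "\<dots> = h c \<otimes>\<^bsub>A\<^esub> lin p"
    unfolding mpoly_lin_def using assms F cf g_closed by (intro A.finsum_rdistr[symmetric]) auto
  finally show ?thesis .
qed

lemma lin_one: "lin \<one>\<^bsub>P\<^esub> = g {#}"
proof -
  have "lin \<one>\<^bsub>P\<^esub> = (\<Oplus>\<^bsub>A\<^esub>\<alpha>\<in>{{#}}. h (\<one>\<^bsub>P\<^esub> \<alpha>) \<otimes>\<^bsub>A\<^esub> g \<alpha>)"
    by (intro lin_superset P.one_closed) (auto simp: mpoly_simps(3) R.indexed_const_def)
  also have "\<dots> = g {#}" using g_closed[of "{#}"] by (simp add: mpoly_simps R.indexed_const_def)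
  finally show ?thesis .
qed

text \<open>Multiplying by a variable shifts the support, and the shift is moved from p to
  \<open>g\<close>. For an evaluation the shifted \<open>g\<close> is a multiple of
  \<open>g\<close>; for coordinates it is the operator \<open>mul i\<close> applied to them.\<close>

lemma lin_var:
  assumes "p \<in> carrier P" "i \<in> I"
  shows "lin (ring.indexed_var R i \<otimes>\<^bsub>P\<^esub> p) = mpoly_lin R A h (\<lambda>\<alpha>. g (add_mset i \<alpha>)) p"
proof -
  have eq: "ring.indexed_var R i \<otimes>\<^bsub>P\<^esub> p = ring.indexed_pmult R p i"
    using assms by (simp add: R.indexed_pmult_eq)
  have supp: "{\<alpha>. ring.indexed_pmult R p i \<alpha> \<noteq> \<zero>\<^bsub>R\<^esub>} = add_mset i ` {\<alpha>. p \<alpha> \<noteq> \<zero>\<^bsub>R\<^esub>}"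
    by (auto simp: R.indexed_pmult_def image_iff intro!: exI[of _ "_ - {#i#}"])
  have "lin (ring.indexed_pmult R p i) =
      (\<Oplus>\<^bsub>A\<^esub>\<alpha>\<in>{\<alpha>. p \<alpha> \<noteq> \<zero>\<^bsub>R\<^esub>}. h (ring.indexed_pmult R p i (add_mset i \<alpha>)) \<otimes>\<^bsub>A\<^esub> g (add_mset i \<alpha>))"
    unfolding mpoly_lin_def supp using assms
    by (intro A.finsum_reindex)
      (auto simp: inj_on_def R.indexed_pmult_def coeff intro!: A.m_closed g_closed
        dest: supp_subset[OF assms(1), THEN subsetD])
  then show ?thesis by (simp add: eq mpoly_lin_def R.indexed_pmult_def)
qed

lemma lin_monom:
  assumes "set_mset \<alpha> \<subseteq> I"
  shows "lin (mpoly_monom R \<alpha>) = g \<alpha>"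
proof -
  have "lin (mpoly_monom R \<alpha>) = (\<Oplus>\<^bsub>A\<^esub>\<gamma>\<in>{\<alpha>}. h (mpoly_monom R \<alpha> \<gamma>) \<otimes>\<^bsub>A\<^esub> g \<gamma>)"
    using assms by (intro lin_superset R.mpoly_monom_in) (auto simp: mpoly_monom_def split: if_splits)
  also have "\<dots> = g \<alpha>" using g_closed[OF assms] by (simp add: mpoly_monom_def)
  finally show ?thesis .
qed

end

locale mpoly_eval = mpoly_linear +
  assumes g_empty: "g {#} = \<one>\<^bsub>A\<^esub>"
    and g_add: "\<And>i \<alpha>. i \<in> I \<Longrightarrow> set_mset \<alpha> \<subseteq> I \<Longrightarrow> g (add_mset i \<alpha>) = g {#i#} \<otimes>\<^bsub>A\<^esub> g \<alpha>"
begin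

lemma eval_var:
  assumes "p \<in> carrier P" "i \<in> I"
  shows "lin (ring.indexed_var R i \<otimes>\<^bsub>P\<^esub> p) = g {#i#} \<otimes>\<^bsub>A\<^esub> lin p"
proof -
  \<comment> \<open>The name hides \<open>{#i#}\<close>, which is itself an \<open>add_mset\<close>:
    otherwise \<open>g_add\<close> would rewrite its own right-hand side.\<close>
  define x where "x = g {#i#}"
  have x: "x \<in> carrier A" "\<And>\<alpha>. set_mset \<alpha> \<subseteq> I \<Longrightarrow> g (add_mset i \<alpha>) = x \<otimes>\<^bsub>A\<^esub> g \<alpha>"
    unfolding x_def using assms(2) g_closed[of "{#i#}"] by (simp, intro g_add)
  have "mpoly_lin R A h (\<lambda>\<alpha>. g (add_mset i \<alpha>)) p =
      (\<Oplus>\<^bsub>A\<^esub>\<alpha>\<in>{\<alpha>. p \<alpha> \<noteq> \<zero>\<^bsub>R\<^esub>}. x \<otimes>\<^bsub>A\<^esub> (h (p \<alpha>) \<otimes>\<^bsub>A\<^esub> g \<alpha>))"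
    unfolding mpoly_lin_def using assms x(1) coeff[OF assms(1)]
    by (intro A.finsum_cong')
      (auto simp: g_supp x(2) A.m_lcomm supp_subset)
  also have "\<dots> = x \<otimes>\<^bsub>A\<^esub> lin p"
    unfolding mpoly_lin_def
    using assms x(1) coeff[OF assms(1)] finite_supp[OF assms(1)]
    by (intro A.finsum_rdistr[symmetric]) (auto simp: g_supp)
  finally show ?thesis by (simp add: lin_var[OF assms] x_def)
qed

text \<open>By induction on the left factor, the only product to be known in advance is the one with
  a single variable, which is \<open>eval_var\<close>.\<close>

lemma eval_ring_hom: "lin \<in> ring_hom P A"
proof (rule ring_hom_memI)
  fix p q assume p: "p \<in> carrier P" and q: "q \<in> carrier P"
  show "lin p \<in> carrier A" by (rule lin_closed[OF p])
  show "lin (p \<oplus>\<^bsub>P\<^esub> q) = lin p \<oplus>\<^bsub>A\<^esub> lin q" by (rule lin_add[OF p q])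
  show "lin (p \<otimes>\<^bsub>P\<^esub> q) = lin p \<otimes>\<^bsub>A\<^esub> lin q"
    using p
  proof (induction rule: R.mpoly_induct)
    case (const k)
    then show ?case using q
      by (simp add: P.smult_one_mult lin_smult lin_one g_empty lin_closed)
  next
    case (add p p')
    then show ?case using q
      by (simp add: P.l_distr lin_add A.l_distr lin_closed)
  next
    case (var p i)
    then show ?case using q R.mpoly_var_in[of i I] g_closed[of "{#i#}"]
      by (simp add: P.m_assoc eval_var A.m_assoc lin_closed)
  qed
qed (simp add: lin_one g_empty)

end

text \<open>Uniqueness half of the universal property: constants and variables generate the
  polynomial algebra. The existence half is \<open>mpoly_evalE\<close>.\<close>

lemma mpoly_hom_eqI:
  assumes "cring R" "\<phi> \<in> ring_hom (mpoly_alg R I) A" "\<psi> \<in> ring_hom (mpoly_alg R I) A"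
    and "\<And>k. k \<in> carrier R \<Longrightarrow> \<phi> (k \<odot>\<^bsub>mpoly_alg R I\<^esub> \<one>\<^bsub>mpoly_alg R I\<^esub>) = \<psi> (k \<odot>\<^bsub>mpoly_alg R I\<^esub> \<one>\<^bsub>mpoly_alg R I\<^esub>)"
    and "\<And>i. i \<in> I \<Longrightarrow> \<phi> (ring.indexed_var R i) = \<psi> (ring.indexed_var R i)"
    and "p \<in> carrier (mpoly_alg R I)"
  shows "\<phi> p = \<psi> p"
proof -
  interpret cring R by fact
  from assms(6) show ?thesis
  proof (induction rule: mpoly_induct)
    case (const k)
    then show ?case by (rule assms(4))
  next
    case (add p q)
    then show ?case by (simp add: assms(2,3)[THEN ring_hom_add])
  next
    case (var p i)
    then show ?case by (simp add: assms(2,3)[THEN ring_hom_mult] mpoly_var_in assms(5))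
  qed
qed

lemma mpoly_hom_eval:
  assumes "cring R" "cring A" "\<phi> \<in> ring_hom (mpoly_alg R I) A"
  shows "mpoly_eval R A I (\<lambda>k. \<phi> (k \<odot>\<^bsub>mpoly_alg R I\<^esub> \<one>\<^bsub>mpoly_alg R I\<^esub>)) (\<lambda>\<alpha>. \<phi> (mpoly_monom R \<alpha>))"
proof -
  interpret R: cring R by fact
  interpret A: cring A by fact
  interpret P: algebra R "mpoly_alg R I" by (rule R.mpoly_algebra)
  have "(\<lambda>k. \<phi> (k \<odot>\<^bsub>mpoly_alg R I\<^esub> \<one>\<^bsub>mpoly_alg R I\<^esub>)) \<in> ring_hom R A"
    using ring_hom_trans[OF P.smult_one_hom assms(3)] by (simp add: o_def)
  then show ?thesis
    by unfold_locales
      (auto simp: ring_hom_closed[OF assms(3)] R.mpoly_monom_in R.mpoly_monom_add_mset_eq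
        R.mpoly_monom_single R.mpoly_var_in ring_hom_mult[OF assms(3)] R.mpoly_monom_empty
        ring_hom_one[OF assms(3)] mpoly_simps(3)[of R I, symmetric])
qed

text \<open>Brings an abstract homomorphism, such as the \<phi> of a quotient, into the form
  \<open>mpoly_lin\<close>, to which the results on coordinates apply.\<close>

lemma mpoly_hom_eq_lin:
  assumes "cring R" "cring A" "\<phi> \<in> ring_hom (mpoly_alg R I) A" "p \<in> carrier (mpoly_alg R I)"
  shows "\<phi> p = mpoly_lin R A (\<lambda>k. \<phi> (k \<odot>\<^bsub>mpoly_alg R I\<^esub> \<one>\<^bsub>mpoly_alg R I\<^esub>)) (\<lambda>\<alpha>. \<phi> (mpoly_monom R \<alpha>)) p"
proof -
  interpret mpoly_eval R A I "\<lambda>k. \<phi> (k \<odot>\<^bsub>mpoly_alg R I\<^esub> \<one>\<^bsub>mpoly_alg R I\<^esub>)" "\<lambda>\<alpha>. \<phi> (mpoly_monom R \<alpha>)"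
    by (rule mpoly_hom_eval[OF assms(1-3)])
  show ?thesis
  proof (rule mpoly_hom_eqI[OF assms(1,3) eval_ring_hom _ _ assms(4)])
    fix i assume "i \<in> I"
    then show "\<phi> (ring.indexed_var R i) = lin (ring.indexed_var R i)"
      using lin_monom[of "{#i#}"] by (simp add: R.mpoly_monom_single)
  next
    fix k assume "k \<in> carrier R"
    then show "\<phi> (k \<odot>\<^bsub>P\<^esub> \<one>\<^bsub>P\<^esub>) = lin (k \<odot>\<^bsub>P\<^esub> \<one>\<^bsub>P\<^esub>)"
      by (simp add: lin_smult lin_one g_empty)
  qed
qed

text \<open>Multiplications by the \<open>v i\<close> commute, so the orbit of 1 under them supplies
  the values on monomials.\<close>

lemma mpoly_evalE:
  assumes "cring R" "cring A" "h \<in> ring_hom R A" "v \<in> I \<rightarrow> carrier A"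
  obtains \<phi> where "\<phi> \<in> ring_hom (mpoly_alg R I) A"
    "\<And>k. k \<in> carrier R \<Longrightarrow> \<phi> (k \<odot>\<^bsub>mpoly_alg R I\<^esub> \<one>\<^bsub>mpoly_alg R I\<^esub>) = h k"
    "\<And>i. i \<in> I \<Longrightarrow> \<phi> (ring.indexed_var R i) = v i"
proof -
  interpret R: cring R by fact
  interpret A: cring A by fact
  have v: "i \<in> I \<Longrightarrow> v i \<in> carrier A" for i using assms(4) by auto
  obtain g where g: "g {#} = \<one>\<^bsub>A\<^esub>" "\<And>\<alpha>. set_mset \<alpha> \<subseteq> I \<Longrightarrow> g \<alpha> \<in> carrier A"
    "\<And>i \<alpha>. i \<in> I \<Longrightarrow> set_mset \<alpha> \<subseteq> I \<Longrightarrow> g (add_mset i \<alpha>) = v i \<otimes>\<^bsub>A\<^esub> g \<alpha>"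
    by (rule commuting_orbit[of I "carrier A" "\<lambda>i x. v i \<otimes>\<^bsub>A\<^esub> x" "\<one>\<^bsub>A\<^esub>"])
      (use v in \<open>auto simp: A.m_lcomm\<close>)
  interpret mpoly_eval R A I h g
    by unfold_locales (auto simp: assms(3) g v)
  show thesis
  proof (rule that[OF eval_ring_hom])
    fix i assume "i \<in> I"
    then show "lin (ring.indexed_var R i) = v i"
      using lin_monom[of "{#i#}"] v by (simp add: R.mpoly_monom_single g)
  next
    fix k assume "k \<in> carrier R"
    then show "lin (k \<odot>\<^bsub>P\<^esub> \<one>\<^bsub>P\<^esub>) = h k"
      by (simp add: lin_smult lin_one g_empty)
  qed
qed

section \<open>Points of the representing scheme\<close>

text \<open>Otherwise the index set \<open>{1..n}\<close> is rewritten to \<open>{Suc 0..n}\<close> and facts about it no longer match.\<close>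

declare One_nat_def [simp del]

section \<open>Standard sets and their borders\<close>

lemma expts_iff: "\<alpha> \<in> expts n \<longleftrightarrow> set_mset \<alpha> \<subseteq> {1..n}"
  by (simp add: expts_def)

lemma standard_set_expts: "standard_set n M \<Longrightarrow> \<alpha> \<in> M \<Longrightarrow> set_mset \<alpha> \<subseteq> {1..n}"
  by (auto simp: standard_set_def expts_def)

text \<open>If \<beta> were missing, then \<alpha> = \<beta> + (\<alpha> - \<beta>) would be missing
  too. Thus a standard set contains all divisors of its monomials.\<close>

lemma standard_set_subset:
  assumes "standard_set n M" "\<alpha> \<in> M" "\<beta> \<subseteq># \<alpha>"
  shows "\<beta> \<in> M"
proof (rule ccontr)
  assume "\<beta> \<notin> M"
  have \<alpha>: "set_mset \<alpha> \<subseteq> {1..n}" using assms by (intro standard_set_expts)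
  with assms(3) have "\<beta> \<in> expts n" "\<alpha> - \<beta> \<in> expts n"
    by (auto simp: expts_iff dest: mset_subset_eqD in_diffD)
  with \<open>\<beta> \<notin> M\<close> have "\<beta> + (\<alpha> - \<beta>) \<in> expts n - M"
    using assms(1) unfolding standard_set_def by blast
  with assms show False by simp
qed

lemma border_iff: "\<alpha> \<in> border n M \<longleftrightarrow> (\<exists>i\<in>{1..n}. \<exists>\<gamma>\<in>M. \<alpha> = add_mset i \<gamma>) \<and> \<alpha> \<notin> M"
  by (auto simp: border_def)

lemma add_mset_in_Un_border:
  "i \<in> {1..n} \<Longrightarrow> \<alpha> \<in> M \<Longrightarrow> add_mset i \<alpha> \<in> M \<union> border n M"
  by (auto simp: border_iff)

lemma Un_border_expts:
  assumes "standard_set n M" "\<alpha> \<in> M \<union> border n M"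
  shows "set_mset \<alpha> \<subseteq> {1..n}"
  using assms standard_set_expts[OF assms(1)] by (fastforce simp: border_iff)

text \<open>A border element is \<gamma> + e_j with \<gamma> in M. Removing e_j returns \<gamma>;
  removing another e_i gives (\<gamma> - e_i) + e_j, where \<gamma> - e_i is still in M. Inductions
  on exponents can therefore stay inside M and its border.\<close>

lemma Un_border_pred:
  assumes "standard_set n M" "add_mset i \<alpha> \<in> M \<union> border n M"
  shows "\<alpha> \<in> M \<union> border n M"
proof (cases "add_mset i \<alpha> \<in> M")
  case True
  then show ?thesis using standard_set_subset[OF assms(1) True, of \<alpha>] by simp
next
  case False
  with assms obtain j \<gamma> where j: "j \<in> {1..n}" "\<gamma> \<in> M" "add_mset i \<alpha> = add_mset j \<gamma>"
    by (auto simp: border_iff)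
  show ?thesis
  proof (cases "i = j")
    case True
    with j show ?thesis by simp
  next
    case False
    with j(3) obtain \<delta> where "\<alpha> = add_mset j \<delta>" "\<gamma> = add_mset i \<delta>"
      by (auto simp: add_eq_conv_ex)
    with j standard_set_subset[OF assms(1) j(2), of \<delta>] show ?thesis
      using add_mset_in_Un_border[of j n \<delta> M] by simp
  qed
qed

text \<open>Associativity for a row, a matrix and a column. The index sets S and T are separate
  because the row may run over the support of a polynomial while the column runs over
  \<Delta>.\<close>

lemma (in cring) finsum_matrix_assoc:
  assumes "finite S" "finite T" "x \<in> S \<rightarrow> carrier R" "\<And>i j. i \<in> S \<Longrightarrow> j \<in> T \<Longrightarrow> y i j \<in> carrier R"
    "z \<in> T \<rightarrow> carrier R"
  shows "(\<Oplus>i\<in>S. x i \<otimes> (\<Oplus>j\<in>T. y i j \<otimes> z j)) = (\<Oplus>j\<in>T. (\<Oplus>i\<in>S. x i \<otimes> y i j) \<otimes> z j)"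
proof -
  have "(\<Oplus>i\<in>S. x i \<otimes> (\<Oplus>j\<in>T. y i j \<otimes> z j)) = (\<Oplus>i\<in>S. \<Oplus>j\<in>T. x i \<otimes> y i j \<otimes> z j)"
    using assms by (intro finsum_cong') (auto simp: finsum_rdistr m_assoc Pi_iff intro!: finsum_cong')
  also have "\<dots> = (\<Oplus>j\<in>T. \<Oplus>i\<in>S. x i \<otimes> y i j \<otimes> z j)"
    using assms by (intro finsum_swap) (auto simp: Pi_iff)
  also have "\<dots> = (\<Oplus>j\<in>T. (\<Oplus>i\<in>S. x i \<otimes> y i j) \<otimes> z j)"
    using assms by (intro finsum_cong') (auto simp: finsum_ldistr Pi_iff)
  finally show ?thesis .
qed

lemma alg_hom_finsum:
  assumes "algebra R A" "algebra R B" "h \<in> alg_hom R A B" "finite F"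
    "c \<in> F \<rightarrow> carrier R" "v \<in> F \<rightarrow> carrier A"
  shows "h (\<Oplus>\<^bsub>A\<^esub>i\<in>F. c i \<odot>\<^bsub>A\<^esub> v i) = (\<Oplus>\<^bsub>B\<^esub>i\<in>F. c i \<odot>\<^bsub>B\<^esub> h (v i))"
proof -
  interpret A: algebra R A by fact
  interpret B: algebra R B by fact
  interpret h: ring_hom_cring A B h by (rule alg_hom_ring_hom_cring[OF assms(1-3)])
  have "h (\<Oplus>\<^bsub>A\<^esub>i\<in>F. c i \<odot>\<^bsub>A\<^esub> v i) = (\<Oplus>\<^bsub>B\<^esub>i\<in>F. h (c i \<odot>\<^bsub>A\<^esub> v i))"
    using assms by (subst h.hom_finsum) (auto simp: o_def)
  also have "\<dots> = (\<Oplus>\<^bsub>B\<^esub>i\<in>F. c i \<odot>\<^bsub>B\<^esub> h (v i))"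
    using assms(4-6) by (intro B.finsum_cong') (auto simp: alg_hom_smult[OF assms(3)] Pi_iff)
  finally show ?thesis .
qed

text \<open>
  A \<open>B\<close>-valued point of the representing scheme: elements \<open>a \<alpha> \<beta>\<close> of \<open>B\<close> that satisfy the equations
  defining $I^\Delta_1$, $I^\Delta_2$ and $I^\Delta_3$.
\<close>

locale hilb_point = B: cring B for B :: "('b, 'm) ring_scheme" +
  fixes n :: nat and \<Delta> N :: "nat multiset set" and a :: "nat multiset \<Rightarrow> nat multiset \<Rightarrow> 'b"
  assumes \<Delta>_standard: "standard_set n \<Delta>" and \<Delta>_finite: "finite \<Delta>" and empty_in_\<Delta>: "{#} \<in> \<Delta>"
    and N_standard: "standard_set n N" and \<Delta>_subset: "\<Delta> \<subseteq> N"
    and a_closed: "\<And>\<alpha> \<beta>. \<alpha> \<in> N \<union> border1 n N \<Longrightarrow> \<beta> \<in> \<Delta> \<Longrightarrow> a \<alpha> \<beta> \<in> carrier B"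
    and a_unit: "\<And>\<alpha> \<beta>. \<alpha> \<in> \<Delta> \<Longrightarrow> \<beta> \<in> \<Delta> \<Longrightarrow> a \<alpha> \<beta> = (if \<alpha> = \<beta> then \<one>\<^bsub>B\<^esub> else \<zero>\<^bsub>B\<^esub>)"
    and a_step: "\<And>\<alpha> i \<beta>. i \<in> {1..n} \<Longrightarrow> add_mset i \<alpha> \<in> N \<union> border1 n N \<Longrightarrow> \<beta> \<in> \<Delta> \<Longrightarrow>
      a (add_mset i \<alpha>) \<beta> = (\<Oplus>\<^bsub>B\<^esub>\<gamma>\<in>\<Delta>. a \<alpha> \<gamma> \<otimes>\<^bsub>B\<^esub> a (add_mset i \<gamma>) \<beta>)"
    and a_border: "\<And>\<alpha> \<alpha>' i j \<beta>. \<alpha> \<in> border1 n N \<Longrightarrow> \<alpha>' \<in> border1 n N \<Longrightarrow> i \<in> {1..n} \<Longrightarrow> j \<in> {1..n} \<Longrightarrow>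
      add_mset i \<alpha> = add_mset j \<alpha>' \<Longrightarrow> add_mset i \<alpha> \<in> border2 n N \<Longrightarrow> \<beta> \<in> \<Delta> \<Longrightarrow>
      (\<Oplus>\<^bsub>B\<^esub>\<gamma>\<in>\<Delta>. a \<alpha> \<gamma> \<otimes>\<^bsub>B\<^esub> a (add_mset i \<gamma>) \<beta>) = (\<Oplus>\<^bsub>B\<^esub>\<gamma>\<in>\<Delta>. a \<alpha>' \<gamma> \<otimes>\<^bsub>B\<^esub> a (add_mset j \<gamma>) \<beta>)"
begin

abbreviation "P \<equiv> polyring n B"

sublocale P: algebra B P
  by (rule B.mpoly_algebra)

lemma \<Delta>_in: "\<gamma> \<in> \<Delta> \<Longrightarrow> \<gamma> \<in> N \<union> border1 n N"
  using \<Delta>_subset by blast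

lemma \<Delta>_add_in: "i \<in> {1..n} \<Longrightarrow> \<gamma> \<in> \<Delta> \<Longrightarrow> add_mset i \<gamma> \<in> N \<union> border1 n N"
  using \<Delta>_subset by (intro add_mset_in_Un_border) auto

lemma a_add_closed: "i \<in> {1..n} \<Longrightarrow> \<gamma> \<in> \<Delta> \<Longrightarrow> \<beta> \<in> \<Delta> \<Longrightarrow> a (add_mset i \<gamma>) \<beta> \<in> carrier B"
  by (intro a_closed \<Delta>_add_in)

lemma \<Delta>_expts: "\<gamma> \<in> \<Delta> \<Longrightarrow> set_mset \<gamma> \<subseteq> {1..n}"
  by (rule standard_set_expts[OF \<Delta>_standard])

lemma \<Delta>_monom: "\<gamma> \<in> \<Delta> \<Longrightarrow> mpoly_monom B \<gamma> \<in> carrier P"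
  by (intro B.mpoly_monom_in \<Delta>_expts)

text \<open>Multiplication by \<open>x\<^sub>i\<close> in the coordinates with respect to the basis \<open>\<Delta>\<close>.\<close>

definition mul :: "nat \<Rightarrow> (nat multiset \<Rightarrow> 'b) \<Rightarrow> nat multiset \<Rightarrow> 'b" where
  "mul i v = (\<lambda>\<beta>\<in>\<Delta>. \<Oplus>\<^bsub>B\<^esub>\<gamma>\<in>\<Delta>. v \<gamma> \<otimes>\<^bsub>B\<^esub> a (add_mset i \<gamma>) \<beta>)"

lemma mul_closed: "i \<in> {1..n} \<Longrightarrow> v \<in> \<Delta> \<rightarrow>\<^sub>E carrier B \<Longrightarrow> mul i v \<in> \<Delta> \<rightarrow>\<^sub>E carrier B"
  by (auto simp: mul_def PiE_iff intro!: B.finsum_closed a_add_closed)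

text \<open>Both sides are candidates for the \<beta>-coefficient of x_i x_j times the basis vector
  \<gamma>. Inside \<open>N \<union> border1 n N\<close>, two uses of \<open>a_step\<close> identify
  both with the same entry; outside, \<open>a_border\<close> equates them.\<close>

lemma mul_basis_commute:
  assumes "i \<in> {1..n}" "j \<in> {1..n}" "\<gamma> \<in> \<Delta>" "\<beta> \<in> \<Delta>"
  shows "(\<Oplus>\<^bsub>B\<^esub>\<delta>\<in>\<Delta>. a (add_mset j \<gamma>) \<delta> \<otimes>\<^bsub>B\<^esub> a (add_mset i \<delta>) \<beta>) =
    (\<Oplus>\<^bsub>B\<^esub>\<delta>\<in>\<Delta>. a (add_mset i \<gamma>) \<delta> \<otimes>\<^bsub>B\<^esub> a (add_mset j \<delta>) \<beta>)"
proof (cases "add_mset i (add_mset j \<gamma>) \<in> N \<union> border1 n N")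
  case True
  then have "add_mset j (add_mset i \<gamma>) \<in> N \<union> border1 n N" by (simp add: add_mset_commute)
  with True assms show ?thesis
    using a_step[of i "add_mset j \<gamma>" \<beta>] a_step[of j "add_mset i \<gamma>" \<beta>]
    by (simp add: add_mset_commute)
next
  case False
  then have False': "add_mset j (add_mset i \<gamma>) \<notin> N \<union> border1 n N" by (simp add: add_mset_commute)
  \<comment> \<open>Had one of the two exponents been in N, adding the other variable would have led
    to N or its border, against the case assumption.\<close>
  have "add_mset i \<gamma> \<in> border1 n N" "add_mset j \<gamma> \<in> border1 n N"
    using \<Delta>_add_in[OF assms(1,3)] \<Delta>_add_in[OF assms(2,3)]
      add_mset_in_Un_border[OF assms(1), of _ N] add_mset_in_Un_border[OF assms(2), of _ N] False False'
    by blast+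
  moreover from this have "add_mset i (add_mset j \<gamma>) \<in> border2 n N"
    using False assms by (subst border_iff) blast
  ultimately show ?thesis
    using assms by (intro a_border) (auto simp: add_mset_commute)
qed

text \<open>Isolates the vector v from the product of the two matrices, so that commutation has to
  be checked on basis vectors only.\<close>

lemma mul_mul:
  assumes "i \<in> {1..n}" "j \<in> {1..n}" "v \<in> \<Delta> \<rightarrow>\<^sub>E carrier B" "\<beta> \<in> \<Delta>"
  shows "mul i (mul j v) \<beta> =
    (\<Oplus>\<^bsub>B\<^esub>\<gamma>\<in>\<Delta>. v \<gamma> \<otimes>\<^bsub>B\<^esub> (\<Oplus>\<^bsub>B\<^esub>\<delta>\<in>\<Delta>. a (add_mset j \<gamma>) \<delta> \<otimes>\<^bsub>B\<^esub> a (add_mset i \<delta>) \<beta>))"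
proof -
  have cl: "a (add_mset i \<gamma>) \<delta> \<in> carrier B" "a (add_mset j \<gamma>) \<delta> \<in> carrier B" if "\<gamma> \<in> \<Delta>" "\<delta> \<in> \<Delta>" for \<gamma> \<delta>
    using that assms by (auto intro!: a_add_closed)
  have "mul i (mul j v) \<beta> =
      (\<Oplus>\<^bsub>B\<^esub>\<delta>\<in>\<Delta>. (\<Oplus>\<^bsub>B\<^esub>\<gamma>\<in>\<Delta>. v \<gamma> \<otimes>\<^bsub>B\<^esub> a (add_mset j \<gamma>) \<delta>) \<otimes>\<^bsub>B\<^esub> a (add_mset i \<delta>) \<beta>)"
    using assms cl by (auto simp: mul_def PiE_iff intro!: B.finsum_cong' B.finsum_closed)
  also have "\<dots> = (\<Oplus>\<^bsub>B\<^esub>\<gamma>\<in>\<Delta>. v \<gamma> \<otimes>\<^bsub>B\<^esub> (\<Oplus>\<^bsub>B\<^esub>\<delta>\<in>\<Delta>. a (add_mset j \<gamma>) \<delta> \<otimes>\<^bsub>B\<^esub> a (add_mset i \<delta>) \<beta>))"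
    using assms cl \<Delta>_finite by (intro B.finsum_matrix_assoc[symmetric]) (auto simp: PiE_iff)
  finally show ?thesis .
qed

text \<open>Equality as functions, as \<open>commuting_orbit\<close> demands; outside \<Delta> both
  sides are undefined in the same way, since \<open>mul\<close> is restricted to \<Delta>.\<close>

lemma mul_commute:
  assumes "i \<in> {1..n}" "j \<in> {1..n}" "v \<in> \<Delta> \<rightarrow>\<^sub>E carrier B"
  shows "mul i (mul j v) = mul j (mul i v)"
proof
  fix \<beta>
  show "mul i (mul j v) \<beta> = mul j (mul i v) \<beta>"
  proof (cases "\<beta> \<in> \<Delta>")
    case True
    have "(\<Oplus>\<^bsub>B\<^esub>\<delta>\<in>\<Delta>. a (add_mset i \<gamma>) \<delta> \<otimes>\<^bsub>B\<^esub> a (add_mset j \<delta>) \<beta>) \<in> carrier B" if "\<gamma> \<in> \<Delta>" for \<gamma>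
      using that assms True by (intro B.finsum_closed) (auto intro!: a_add_closed)
    then show ?thesis
      unfolding mul_mul[OF assms True] mul_mul[OF assms(2,1,3) True]
      using assms by (intro B.finsum_cong')
        (auto simp: PiE_iff mul_basis_commute[OF assms(1,2) _ True])
  qed (simp add: mul_def)
qed

lemma ex_monom_coord:
  "\<exists>g. g {#} = (\<lambda>\<beta>\<in>\<Delta>. a {#} \<beta>) \<and> (\<forall>\<alpha>. set_mset \<alpha> \<subseteq> {1..n} \<longrightarrow> g \<alpha> \<in> \<Delta> \<rightarrow>\<^sub>E carrier B) \<and>
    (\<forall>i \<alpha>. i \<in> {1..n} \<longrightarrow> set_mset \<alpha> \<subseteq> {1..n} \<longrightarrow> g (add_mset i \<alpha>) = mul i (g \<alpha>))"
proof -
  \<comment> \<open>By \<open>a_unit\<close> this row is the basis vector of exponent 0. Written as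
    a row of \<open>a\<close>, it makes the base case of \<open>monom_coord_eq\<close>
    immediate.\<close>
  have e: "(\<lambda>\<beta>\<in>\<Delta>. a {#} \<beta>) \<in> \<Delta> \<rightarrow>\<^sub>E carrier B"
    using \<Delta>_in[OF empty_in_\<Delta>] by (auto simp: a_closed)
  show ?thesis
    by (rule commuting_orbit[of "{1..n}" "\<Delta> \<rightarrow>\<^sub>E carrier B" mul "\<lambda>\<beta>\<in>\<Delta>. a {#} \<beta>"])
      (use mul_closed mul_commute e in blast)+
qed

text \<open>Choice turns the orbit just obtained into a constant of the locale; the recursion
  determines it on all exponents in the variables 1 to n.\<close>

definition monom_coord :: "nat multiset \<Rightarrow> nat multiset \<Rightarrow> 'b" where
  "monom_coord = (SOME g. g {#} = (\<lambda>\<beta>\<in>\<Delta>. a {#} \<beta>) \<and>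
    (\<forall>\<alpha>. set_mset \<alpha> \<subseteq> {1..n} \<longrightarrow> g \<alpha> \<in> \<Delta> \<rightarrow>\<^sub>E carrier B) \<and>
    (\<forall>i \<alpha>. i \<in> {1..n} \<longrightarrow> set_mset \<alpha> \<subseteq> {1..n} \<longrightarrow> g (add_mset i \<alpha>) = mul i (g \<alpha>)))"

lemma
  shows monom_coord_empty: "monom_coord {#} = (\<lambda>\<beta>\<in>\<Delta>. a {#} \<beta>)"
    and monom_coord_PiE: "set_mset \<alpha> \<subseteq> {1..n} \<Longrightarrow> monom_coord \<alpha> \<in> \<Delta> \<rightarrow>\<^sub>E carrier B"
    and monom_coord_add:
      "i \<in> {1..n} \<Longrightarrow> set_mset \<alpha> \<subseteq> {1..n} \<Longrightarrow> monom_coord (add_mset i \<alpha>) = mul i (monom_coord \<alpha>)"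
  using someI_ex[OF ex_monom_coord] unfolding monom_coord_def[symmetric] by blast+

lemma monom_coord_closed: "set_mset \<alpha> \<subseteq> {1..n} \<Longrightarrow> \<beta> \<in> \<Delta> \<Longrightarrow> monom_coord \<alpha> \<beta> \<in> carrier B"
  using monom_coord_PiE by blast

text \<open>The orbit and the entries obey the same recursion, \<open>mul i\<close> on one side and
  \<open>a_step\<close> on the other, and by \<open>Un_border_pred\<close> the induction never
  leaves the set where the entries are defined.\<close>

lemma monom_coord_eq:
  assumes "\<alpha> \<in> N \<union> border1 n N" "\<beta> \<in> \<Delta>"
  shows "monom_coord \<alpha> \<beta> = a \<alpha> \<beta>"
  using assms
proof (induction \<alpha> arbitrary: \<beta>)
  case empty
  then show ?case by (simp add: monom_coord_empty)
next
  case (add i \<alpha>)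
  note \<alpha> = Un_border_pred[OF N_standard add.prems(1)]
  from Un_border_expts[OF N_standard add.prems(1)] have i: "i \<in> {1..n}" "set_mset \<alpha> \<subseteq> {1..n}" by auto
  have "mul i (monom_coord \<alpha>) \<beta> = (\<Oplus>\<^bsub>B\<^esub>\<gamma>\<in>\<Delta>. a \<alpha> \<gamma> \<otimes>\<^bsub>B\<^esub> a (add_mset i \<gamma>) \<beta>)"
    using add.prems(2) a_closed[OF \<alpha>] a_add_closed[OF i(1)]
    by (auto simp: mul_def add.IH[OF \<alpha>] intro!: B.finsum_cong')
  also have "\<dots> = a (add_mset i \<alpha>) \<beta>" using add.prems i by (intro a_step[symmetric])
  finally show ?case using i by (simp add: monom_coord_add)
qed

definition coord :: "(nat multiset \<Rightarrow> 'b) \<Rightarrow> nat multiset \<Rightarrow> 'b" where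
  "coord p \<beta> = mpoly_lin B B (\<lambda>x. x) (\<lambda>\<alpha>. monom_coord \<alpha> \<beta>) p"

lemma coord_linear: "\<beta> \<in> \<Delta> \<Longrightarrow> mpoly_linear B B {1..n} (\<lambda>x. x) (\<lambda>\<alpha>. monom_coord \<alpha> \<beta>)"
  by unfold_locales (auto simp: monom_coord_closed ring_hom_def)

lemma coord_closed: "p \<in> carrier P \<Longrightarrow> \<beta> \<in> \<Delta> \<Longrightarrow> coord p \<beta> \<in> carrier B"
  unfolding coord_def by (rule mpoly_linear.lin_closed[OF coord_linear])

lemma coord_add: "p \<in> carrier P \<Longrightarrow> q \<in> carrier P \<Longrightarrow> \<beta> \<in> \<Delta> \<Longrightarrow>
    coord (p \<oplus>\<^bsub>P\<^esub> q) \<beta> = coord p \<beta> \<oplus>\<^bsub>B\<^esub> coord q \<beta>"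
  unfolding coord_def by (rule mpoly_linear.lin_add[OF coord_linear])

lemma coord_smult: "p \<in> carrier P \<Longrightarrow> c \<in> carrier B \<Longrightarrow> \<beta> \<in> \<Delta> \<Longrightarrow>
    coord (c \<odot>\<^bsub>P\<^esub> p) \<beta> = c \<otimes>\<^bsub>B\<^esub> coord p \<beta>"
  unfolding coord_def by (rule mpoly_linear.lin_smult[OF coord_linear])

lemma coord_one: "\<beta> \<in> \<Delta> \<Longrightarrow> coord \<one>\<^bsub>P\<^esub> \<beta> = a {#} \<beta>"
  unfolding coord_def using mpoly_linear.lin_one[OF coord_linear, of \<beta>]
  by (simp add: monom_coord_empty)

lemma coord_zero: "\<beta> \<in> \<Delta> \<Longrightarrow> coord \<zero>\<^bsub>P\<^esub> \<beta> = \<zero>\<^bsub>B\<^esub>"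
  using coord_smult[OF P.one_closed B.zero_closed] coord_one \<Delta>_in[OF empty_in_\<Delta>] by (simp add: a_closed)

lemma coord_monom: "set_mset \<alpha> \<subseteq> {1..n} \<Longrightarrow> \<beta> \<in> \<Delta> \<Longrightarrow> coord (mpoly_monom B \<alpha>) \<beta> = monom_coord \<alpha> \<beta>"
  unfolding coord_def by (rule mpoly_linear.lin_monom[OF coord_linear])

text \<open>Coordinates turn multiplication by x_i into the matrix of x_i: true on monomials by the
  recursion of \<open>monom_coord\<close>, and carried to p by exchanging the sum over the support
  with the sum over \<Delta>.\<close>

lemma coord_var:
  assumes "p \<in> carrier P" "i \<in> {1..n}" "\<beta> \<in> \<Delta>"
  shows "coord (ring.indexed_var B i \<otimes>\<^bsub>P\<^esub> p) \<beta> = (\<Oplus>\<^bsub>B\<^esub>\<gamma>\<in>\<Delta>. coord p \<gamma> \<otimes>\<^bsub>B\<^esub> a (add_mset i \<gamma>) \<beta>)"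
proof -
  note L = coord_linear[OF assms(3)]
  note p = mpoly_linear.coeff[OF L assms(1)]
  have supp: "set_mset \<alpha> \<subseteq> {1..n}" if "p \<alpha> \<noteq> \<zero>\<^bsub>B\<^esub>" for \<alpha> using mpoly_linear.supp_subset[OF L assms(1) that] .
  have cl: "a (add_mset i \<gamma>) \<beta> \<in> carrier B" if "\<gamma> \<in> \<Delta>" for \<gamma>
    using that assms by (auto intro!: a_add_closed)
  have "coord (ring.indexed_var B i \<otimes>\<^bsub>P\<^esub> p) \<beta> =
      (\<Oplus>\<^bsub>B\<^esub>\<alpha>\<in>{\<alpha>. p \<alpha> \<noteq> \<zero>\<^bsub>B\<^esub>}. p \<alpha> \<otimes>\<^bsub>B\<^esub> monom_coord (add_mset i \<alpha>) \<beta>)"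
    unfolding coord_def mpoly_linear.lin_var[OF L assms(1,2)] by (simp only: mpoly_lin_def)
  also have "\<dots> = (\<Oplus>\<^bsub>B\<^esub>\<alpha>\<in>{\<alpha>. p \<alpha> \<noteq> \<zero>\<^bsub>B\<^esub>}. p \<alpha> \<otimes>\<^bsub>B\<^esub> (\<Oplus>\<^bsub>B\<^esub>\<gamma>\<in>\<Delta>. monom_coord \<alpha> \<gamma> \<otimes>\<^bsub>B\<^esub> a (add_mset i \<gamma>) \<beta>))"
    using assms supp cl p
    by (intro B.finsum_cong')
      (auto simp: monom_coord_add mul_def intro!: B.m_closed B.finsum_closed monom_coord_closed)
  also have "\<dots> = (\<Oplus>\<^bsub>B\<^esub>\<gamma>\<in>\<Delta>. (\<Oplus>\<^bsub>B\<^esub>\<alpha>\<in>{\<alpha>. p \<alpha> \<noteq> \<zero>\<^bsub>B\<^esub>}. p \<alpha> \<otimes>\<^bsub>B\<^esub> monom_coord \<alpha> \<gamma>) \<otimes>\<^bsub>B\<^esub> a (add_mset i \<gamma>) \<beta>)"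
    using assms supp cl p \<Delta>_finite mpoly_linear.finite_supp[OF L assms(1)]
    by (intro B.finsum_matrix_assoc) (auto intro!: monom_coord_closed)
  finally show ?thesis by (simp only: coord_def mpoly_lin_def)
qed

text \<open>Here \<open>a_unit\<close> enters: monomials in \<Delta> have unit vectors as
  coordinates. This is the source of linear independence in the quotient.\<close>

lemma coord_lincomb:
  assumes "c \<in> \<Delta> \<rightarrow> carrier B" "\<gamma> \<in> \<Delta>"
  shows "coord (\<Oplus>\<^bsub>P\<^esub>\<beta>\<in>\<Delta>. c \<beta> \<odot>\<^bsub>P\<^esub> mpoly_monom B \<beta>) \<gamma> = c \<gamma>"
proof -
  have "F \<subseteq> \<Delta> \<Longrightarrow> coord (\<Oplus>\<^bsub>P\<^esub>\<beta>\<in>F. c \<beta> \<odot>\<^bsub>P\<^esub> mpoly_monom B \<beta>) \<gamma> = (\<Oplus>\<^bsub>B\<^esub>\<beta>\<in>F. if \<gamma> = \<beta> then c \<beta> else \<zero>\<^bsub>B\<^esub>)"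
    if "finite F" for F
    using that
  proof (induction F rule: finite_induct)
    case empty
    then show ?case using assms by (simp add: coord_zero)
  next
    case (insert \<beta> F)
    then have \<beta>: "\<beta> \<in> \<Delta>" "c \<beta> \<in> carrier B" "\<And>\<delta>. \<delta> \<in> F \<Longrightarrow> c \<delta> \<in> carrier B"
      "\<And>\<delta>. \<delta> \<in> F \<Longrightarrow> mpoly_monom B \<delta> \<in> carrier P"
      using assms \<Delta>_monom by auto
    have "coord (c \<beta> \<odot>\<^bsub>P\<^esub> mpoly_monom B \<beta>) \<gamma> = (if \<gamma> = \<beta> then c \<beta> else \<zero>\<^bsub>B\<^esub>)"
      using \<beta>(1,2) assms(2) \<Delta>_in[of \<beta>]
      by (simp add: coord_smult \<Delta>_monom coord_monom \<Delta>_expts monom_coord_eq a_unit)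
    with insert \<beta> assms(2) show ?case
      by (simp add: Pi_def coord_add \<Delta>_monom)
  qed
  from this[OF \<Delta>_finite] show ?thesis
    using assms \<Delta>_finite B.finsum_singleton[of \<gamma> \<Delta> c] by simp
qed

section \<open>The quotient attached to a point\<close>

definition rel_ideal :: "(nat multiset \<Rightarrow> 'b) set" where
  "rel_ideal = {p \<in> carrier P. \<forall>\<beta>\<in>\<Delta>. coord p \<beta> = \<zero>\<^bsub>B\<^esub>}"

text \<open>By \<open>coord_var\<close> the coordinates of x_i q are linear in those of q, so
  vanishing coordinates stay zero under every variable and hence, by induction, under every
  polynomial.\<close>

lemma rel_ideal_mult:
  assumes "q \<in> rel_ideal" "p \<in> carrier P"
  shows "p \<otimes>\<^bsub>P\<^esub> q \<in> rel_ideal"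
  using assms(2)
proof (induction rule: B.mpoly_induct)
  case (const k)
  with assms(1) show ?case by (simp add: rel_ideal_def P.smult_one_mult coord_smult)
next
  case (add p p')
  with assms(1) show ?case by (simp add: rel_ideal_def P.l_distr coord_add)
next
  case (var p i)
  have "(\<Oplus>\<^bsub>B\<^esub>\<gamma>\<in>\<Delta>. coord (p \<otimes>\<^bsub>P\<^esub> q) \<gamma> \<otimes>\<^bsub>B\<^esub> a (add_mset i \<gamma>) \<beta>) = \<zero>\<^bsub>B\<^esub>" if "\<beta> \<in> \<Delta>" for \<beta>
    using var that by (intro B.add.finprod_one_eqI) (simp add: rel_ideal_def a_add_closed)
  with var assms(1) show ?case
    using B.mpoly_var_in[of i "{1..n}"] by (simp add: rel_ideal_def P.m_assoc coord_var)
qed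

lemma rel_ideal_ideal: "ideal rel_ideal P"
proof (rule idealI)
  show "ring P" by (rule P.ring_axioms)
  show "subgroup rel_ideal (add_monoid P)"
  proof (rule P.add.subgroupI)
    have "\<zero>\<^bsub>P\<^esub> \<in> rel_ideal" by (simp add: rel_ideal_def coord_zero)
    then show "rel_ideal \<noteq> {}" by blast
    show "\<ominus>\<^bsub>P\<^esub> q \<in> rel_ideal" if q: "q \<in> rel_ideal" for q
    proof -
      have qP: "q \<in> carrier P" using q by (simp add: rel_ideal_def)
      then have "\<ominus>\<^bsub>P\<^esub> q = (\<ominus>\<^bsub>P\<^esub> \<one>\<^bsub>P\<^esub>) \<otimes>\<^bsub>P\<^esub> q" by (simp add: P.l_minus)
      with rel_ideal_mult[OF q, of "\<ominus>\<^bsub>P\<^esub> \<one>\<^bsub>P\<^esub>"] show ?thesis by simp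
    qed
  qed (auto simp: rel_ideal_def coord_add)
  fix q p assume q: "q \<in> rel_ideal" and p: "p \<in> carrier P"
  then have "q \<in> carrier P" by (simp add: rel_ideal_def)
  show "p \<otimes>\<^bsub>P\<^esub> q \<in> rel_ideal" by (rule rel_ideal_mult[OF q p])
  with P.m_comm[OF p \<open>q \<in> carrier P\<close>] show "q \<otimes>\<^bsub>P\<^esub> p \<in> rel_ideal" by simp
qed

sublocale J: quotient_algebra B P rel_ideal
  by (intro quotient_algebra.intro P.algebra_axioms rel_ideal_ideal)

lemma quot_proj_lincomb:
  assumes "p \<in> carrier P"
  shows "rel_ideal +>\<^bsub>P\<^esub> p =
    (\<Oplus>\<^bsub>quot_alg P rel_ideal\<^esub>\<beta>\<in>\<Delta>. coord p \<beta> \<odot>\<^bsub>quot_alg P rel_ideal\<^esub> (rel_ideal +>\<^bsub>P\<^esub> mpoly_monom B \<beta>))"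
proof -
  let ?s = "\<Oplus>\<^bsub>P\<^esub>\<beta>\<in>\<Delta>. coord p \<beta> \<odot>\<^bsub>P\<^esub> mpoly_monom B \<beta>"
  have s: "?s \<in> carrier P" using assms by (intro P.finsum_closed) (auto simp: coord_closed \<Delta>_monom)
  \<comment> \<open>Subtraction is rewritten as adding the (-1)-multiple, the operations with which
    \<open>coord\<close> is known to be compatible.\<close>
  have eq: "p \<ominus>\<^bsub>P\<^esub> ?s = p \<oplus>\<^bsub>P\<^esub> (\<ominus>\<^bsub>B\<^esub> \<one>\<^bsub>B\<^esub>) \<odot>\<^bsub>P\<^esub> ?s"
    using s by (simp add: P.smult_l_minus a_minus_def)
  have "coord (p \<ominus>\<^bsub>P\<^esub> ?s) \<beta> = \<zero>\<^bsub>B\<^esub>" if "\<beta> \<in> \<Delta>" for \<beta>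
    unfolding eq using assms s that
    by (simp add: coord_add coord_smult coord_lincomb coord_closed Pi_def B.l_minus B.r_neg)
  then have "p \<ominus>\<^bsub>P\<^esub> ?s \<in> rel_ideal"
    using P.minus_closed[OF assms s] unfolding rel_ideal_def by blast
  then have "rel_ideal +>\<^bsub>P\<^esub> p = rel_ideal +>\<^bsub>P\<^esub> ?s"
    using P.quotient_eq_iff_same_a_r_cos[OF rel_ideal_ideal assms s] by blast
  then show ?thesis
    using alg_hom_finsum[OF P.algebra_axioms J.quot_algebra J.quot_proj_hom \<Delta>_finite,
        of "coord p" "mpoly_monom B"] assms
    by (simp add: Pi_def coord_closed \<Delta>_monom)
qed

text \<open>Independence: a combination of \<Delta> lying in \<open>rel_ideal\<close> has zero
  coordinates, and these are its coefficients. Spanning: a polynomial is congruent to the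
  combination given by its coordinates.\<close>

lemma quot_hilb_hom: "hilb_hom n \<Delta> B (quot_alg P rel_ideal) (\<lambda>p. rel_ideal +>\<^bsub>P\<^esub> p)"
  unfolding hilb_hom_def is_basis_def
proof (intro conjI ballI impI)
  show "algebra B (quot_alg P rel_ideal)" by (rule J.quot_algebra)
  show "(\<lambda>p. rel_ideal +>\<^bsub>P\<^esub> p) \<in> alg_hom B P (quot_alg P rel_ideal)" by (rule J.quot_proj_hom)
  show "(\<lambda>p. rel_ideal +>\<^bsub>P\<^esub> p) ` carrier P = carrier (quot_alg P rel_ideal)" by (simp add: J.quot_carrier)
  show "(\<lambda>\<beta>. rel_ideal +>\<^bsub>P\<^esub> mpoly_monom B \<beta>) \<in> \<Delta> \<rightarrow> carrier (quot_alg P rel_ideal)"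
    by (auto simp: J.quot_carrier \<Delta>_monom)
next
  fix c \<gamma>
  assume c: "c \<in> \<Delta> \<rightarrow> carrier B" and \<gamma>: "\<gamma> \<in> \<Delta>"
    and z: "(\<Oplus>\<^bsub>quot_alg P rel_ideal\<^esub>\<beta>\<in>\<Delta>. c \<beta> \<odot>\<^bsub>quot_alg P rel_ideal\<^esub> (rel_ideal +>\<^bsub>P\<^esub> mpoly_monom B \<beta>)) =
      \<zero>\<^bsub>quot_alg P rel_ideal\<^esub>"
  let ?s = "\<Oplus>\<^bsub>P\<^esub>\<beta>\<in>\<Delta>. c \<beta> \<odot>\<^bsub>P\<^esub> mpoly_monom B \<beta>"
  have s: "?s \<in> carrier P" using c by (intro P.finsum_closed) (auto simp: \<Delta>_monom)
  have "rel_ideal +>\<^bsub>P\<^esub> ?s = \<zero>\<^bsub>quot_alg P rel_ideal\<^esub>"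
    using alg_hom_finsum[OF P.algebra_axioms J.quot_algebra J.quot_proj_hom \<Delta>_finite c,
        of "mpoly_monom B"] z
    by (simp add: Pi_def \<Delta>_monom)
  with s have "?s \<in> rel_ideal" by (simp add: J.quot_proj_zero_iff)
  then have "coord ?s \<gamma> = \<zero>\<^bsub>B\<^esub>" using \<gamma> unfolding rel_ideal_def by blast
  with coord_lincomb[OF c \<gamma>] show "c \<gamma> = \<zero>\<^bsub>B\<^esub>" by (rule trans[OF sym])
next
  fix q assume "q \<in> carrier (quot_alg P rel_ideal)"
  then obtain p where p: "p \<in> carrier P" "q = rel_ideal +>\<^bsub>P\<^esub> p" by (auto simp: J.quot_carrier)
  then show "\<exists>c\<in>\<Delta> \<rightarrow> carrier B. q =
      (\<Oplus>\<^bsub>quot_alg P rel_ideal\<^esub>\<beta>\<in>\<Delta>. c \<beta> \<odot>\<^bsub>quot_alg P rel_ideal\<^esub> (rel_ideal +>\<^bsub>P\<^esub> mpoly_monom B \<beta>))"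
    using quot_proj_lincomb[of p] by (intro bexI[of _ "coord p"]) (auto simp: coord_closed)
qed

lemma quot_proj_monom:
  assumes "\<alpha> \<in> N \<union> border1 n N"
  shows "rel_ideal +>\<^bsub>P\<^esub> mpoly_monom B \<alpha> =
    (\<Oplus>\<^bsub>quot_alg P rel_ideal\<^esub>\<beta>\<in>\<Delta>. a \<alpha> \<beta> \<odot>\<^bsub>quot_alg P rel_ideal\<^esub> (rel_ideal +>\<^bsub>P\<^esub> mpoly_monom B \<beta>))"
proof -
  note \<alpha> = Un_border_expts[OF N_standard assms]
  interpret Q: algebra B "quot_alg P rel_ideal" by (rule J.quot_algebra)
  have "rel_ideal +>\<^bsub>P\<^esub> mpoly_monom B \<alpha> =
      (\<Oplus>\<^bsub>quot_alg P rel_ideal\<^esub>\<beta>\<in>\<Delta>. coord (mpoly_monom B \<alpha>) \<beta> \<odot>\<^bsub>quot_alg P rel_ideal\<^esub> (rel_ideal +>\<^bsub>P\<^esub> mpoly_monom B \<beta>))"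
    by (intro quot_proj_lincomb B.mpoly_monom_in \<alpha>)
  also have "\<dots> = (\<Oplus>\<^bsub>quot_alg P rel_ideal\<^esub>\<beta>\<in>\<Delta>. a \<alpha> \<beta> \<odot>\<^bsub>quot_alg P rel_ideal\<^esub> (rel_ideal +>\<^bsub>P\<^esub> mpoly_monom B \<beta>))"
    using \<alpha> monom_coord_eq[OF assms] a_closed[OF assms] ring_hom_closed[OF J.quot_proj_ring_hom] \<Delta>_monom
    by (intro Q.finsum_cong') (auto simp: coord_monom)
  finally show ?thesis .
qed

text \<open>Every evaluation whose monomial values obey the relations of the point factors through
  the coordinates. Target and coefficient map are arbitrary because the lemma serves three times:
  for a given \<phi>, for the tensor product over C, and for the map from B[x] through f.\<close>

lemma eval_coord:
  assumes "mpoly_eval B A {1..n} h g"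
    and g: "\<And>\<alpha>. \<alpha> \<in> N \<union> border1 n N \<Longrightarrow> g \<alpha> = (\<Oplus>\<^bsub>A\<^esub>\<beta>\<in>\<Delta>. h (a \<alpha> \<beta>) \<otimes>\<^bsub>A\<^esub> g \<beta>)"
    and "p \<in> carrier P"
  shows "mpoly_lin B A h g p = (\<Oplus>\<^bsub>A\<^esub>\<beta>\<in>\<Delta>. h (coord p \<beta>) \<otimes>\<^bsub>A\<^esub> g \<beta>)"
proof -
  interpret E: mpoly_eval B A "{1..n}" h g by fact
  have g_cl: "g \<beta> \<in> carrier A" if "\<beta> \<in> \<Delta>" for \<beta> using that by (intro E.g_closed \<Delta>_expts)
  from assms(3) show ?thesis
  proof (induction rule: B.mpoly_induct)
    case (const k)
    have "(\<Oplus>\<^bsub>A\<^esub>\<beta>\<in>\<Delta>. h (coord (k \<odot>\<^bsub>P\<^esub> \<one>\<^bsub>P\<^esub>) \<beta>) \<otimes>\<^bsub>A\<^esub> g \<beta>) =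
        (\<Oplus>\<^bsub>A\<^esub>\<beta>\<in>\<Delta>. h k \<otimes>\<^bsub>A\<^esub> (h (a {#} \<beta>) \<otimes>\<^bsub>A\<^esub> g \<beta>))"
      using const g_cl \<Delta>_in[OF empty_in_\<Delta>]
      by (intro E.A.finsum_cong') (auto simp: coord_smult coord_one a_closed E.A.m_assoc)
    \<comment> \<open>The exponent 0 lies in \<Delta>, so the relation for it expands
      \<open>g {#}\<close>.\<close>
    also have "\<dots> = h k \<otimes>\<^bsub>A\<^esub> g {#}"
      using const g_cl \<Delta>_in[OF empty_in_\<Delta>] \<Delta>_finite
      by (subst g) (auto intro!: E.A.finsum_rdistr[symmetric] a_closed E.A.m_closed)
    finally show ?case using const by (simp add: E.lin_smult E.lin_one)
  next
    case (add p q)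
    have "(\<Oplus>\<^bsub>A\<^esub>\<beta>\<in>\<Delta>. h (coord (p \<oplus>\<^bsub>P\<^esub> q) \<beta>) \<otimes>\<^bsub>A\<^esub> g \<beta>) =
        (\<Oplus>\<^bsub>A\<^esub>\<beta>\<in>\<Delta>. h (coord p \<beta>) \<otimes>\<^bsub>A\<^esub> g \<beta> \<oplus>\<^bsub>A\<^esub> h (coord q \<beta>) \<otimes>\<^bsub>A\<^esub> g \<beta>)"
      using add.hyps g_cl
      by (intro E.A.finsum_cong') (auto simp: coord_add coord_closed E.A.l_distr)
    with add g_cl show ?case
      by (simp add: E.lin_add E.A.finsum_addf Pi_def coord_closed)
  next
    case (var p i)
    have cl: "a (add_mset i \<gamma>) \<beta> \<in> carrier B" if "\<gamma> \<in> \<Delta>" "\<beta> \<in> \<Delta>" for \<gamma> \<beta>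
      using that var by (auto intro!: a_add_closed)
    have gi: "g {#i#} \<in> carrier A" using var by (intro E.g_closed) auto
    have "E.lin (ring.indexed_var B i \<otimes>\<^bsub>P\<^esub> p) = g {#i#} \<otimes>\<^bsub>A\<^esub> (\<Oplus>\<^bsub>A\<^esub>\<gamma>\<in>\<Delta>. h (coord p \<gamma>) \<otimes>\<^bsub>A\<^esub> g \<gamma>)"
      using var by (simp add: E.eval_var)
    also have "\<dots> = (\<Oplus>\<^bsub>A\<^esub>\<gamma>\<in>\<Delta>. g {#i#} \<otimes>\<^bsub>A\<^esub> (h (coord p \<gamma>) \<otimes>\<^bsub>A\<^esub> g \<gamma>))"
      using var g_cl gi \<Delta>_finite by (intro E.A.finsum_rdistr) (auto simp: coord_closed)
    \<comment> \<open>Each \<gamma> + e_i lies in N or its border, where the relations give the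
      expansion of its monomial.\<close>
    also have "\<dots> = (\<Oplus>\<^bsub>A\<^esub>\<gamma>\<in>\<Delta>. h (coord p \<gamma>) \<otimes>\<^bsub>A\<^esub> (\<Oplus>\<^bsub>A\<^esub>\<beta>\<in>\<Delta>. h (a (add_mset i \<gamma>) \<beta>) \<otimes>\<^bsub>A\<^esub> g \<beta>))"
    proof (rule E.A.finsum_cong')
      fix \<gamma> assume \<gamma>: "\<gamma> \<in> \<Delta>"
      have "g {#i#} \<otimes>\<^bsub>A\<^esub> (h (coord p \<gamma>) \<otimes>\<^bsub>A\<^esub> g \<gamma>) = h (coord p \<gamma>) \<otimes>\<^bsub>A\<^esub> (g {#i#} \<otimes>\<^bsub>A\<^esub> g \<gamma>)"
        using var \<gamma> g_cl gi by (simp add: E.A.m_lcomm coord_closed)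
      also have "g {#i#} \<otimes>\<^bsub>A\<^esub> g \<gamma> = g (add_mset i \<gamma>)"
        using var \<gamma> by (intro E.g_add[symmetric] \<Delta>_expts)
      also have "\<dots> = (\<Oplus>\<^bsub>A\<^esub>\<beta>\<in>\<Delta>. h (a (add_mset i \<gamma>) \<beta>) \<otimes>\<^bsub>A\<^esub> g \<beta>)"
        using var \<gamma> by (intro g \<Delta>_add_in)
      finally show "g {#i#} \<otimes>\<^bsub>A\<^esub> (h (coord p \<gamma>) \<otimes>\<^bsub>A\<^esub> g \<gamma>) =
        h (coord p \<gamma>) \<otimes>\<^bsub>A\<^esub> (\<Oplus>\<^bsub>A\<^esub>\<beta>\<in>\<Delta>. h (a (add_mset i \<gamma>) \<beta>) \<otimes>\<^bsub>A\<^esub> g \<beta>)" .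
    qed (use var cl g_cl in \<open>auto simp: coord_closed intro!: E.A.finsum_closed E.A.m_closed\<close>)
    \<comment> \<open>Regrouping by \<beta> leaves the coordinate row of p times the matrix of x_i,
      which \<open>coord_var\<close> recognises as the coordinates of x_i p.\<close>
    also have "\<dots> = (\<Oplus>\<^bsub>A\<^esub>\<beta>\<in>\<Delta>. (\<Oplus>\<^bsub>A\<^esub>\<gamma>\<in>\<Delta>. h (coord p \<gamma>) \<otimes>\<^bsub>A\<^esub> h (a (add_mset i \<gamma>) \<beta>)) \<otimes>\<^bsub>A\<^esub> g \<beta>)"
      using var cl g_cl \<Delta>_finite by (intro E.A.finsum_matrix_assoc) (auto simp: coord_closed)
    also have "\<dots> = (\<Oplus>\<^bsub>A\<^esub>\<beta>\<in>\<Delta>. h (coord (ring.indexed_var B i \<otimes>\<^bsub>P\<^esub> p) \<beta>) \<otimes>\<^bsub>A\<^esub> g \<beta>)"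
    proof (rule E.A.finsum_cong')
      fix \<beta> assume \<beta>: "\<beta> \<in> \<Delta>"
      have "h (\<Oplus>\<^bsub>B\<^esub>\<gamma>\<in>\<Delta>. coord p \<gamma> \<otimes>\<^bsub>B\<^esub> a (add_mset i \<gamma>) \<beta>) =
          (\<Oplus>\<^bsub>A\<^esub>\<gamma>\<in>\<Delta>. h (coord p \<gamma> \<otimes>\<^bsub>B\<^esub> a (add_mset i \<gamma>) \<beta>))"
        using var \<beta> cl by (subst E.h.hom_finsum) (auto simp: coord_closed o_def)
      also have "\<dots> = (\<Oplus>\<^bsub>A\<^esub>\<gamma>\<in>\<Delta>. h (coord p \<gamma>) \<otimes>\<^bsub>A\<^esub> h (a (add_mset i \<gamma>) \<beta>))"
        using var \<beta> cl by (intro E.A.finsum_cong') (auto simp: coord_closed)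
      finally show "(\<Oplus>\<^bsub>A\<^esub>\<gamma>\<in>\<Delta>. h (coord p \<gamma>) \<otimes>\<^bsub>A\<^esub> h (a (add_mset i \<gamma>) \<beta>)) \<otimes>\<^bsub>A\<^esub> g \<beta> =
          h (coord (ring.indexed_var B i \<otimes>\<^bsub>P\<^esub> p) \<beta>) \<otimes>\<^bsub>A\<^esub> g \<beta>"
        using var \<beta> by (simp add: coord_var)
    qed (use var g_cl B.mpoly_var_in[of i "{1..n}"] in \<open>auto simp: coord_closed\<close>)
    finally show ?case .
  qed
qed

text \<open>Instance of \<open>eval_coord\<close> with \<phi> read as evaluation of B[x] in Q, its
  coefficients going through the structure map.\<close>

lemma hilb_hom_coord:
  assumes "hilb_hom n \<Delta> B Q \<phi>"
    and \<phi>: "\<And>\<alpha>. \<alpha> \<in> N \<union> border1 n N \<Longrightarrow>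
      \<phi> (mpoly_monom B \<alpha>) = (\<Oplus>\<^bsub>Q\<^esub>\<beta>\<in>\<Delta>. a \<alpha> \<beta> \<odot>\<^bsub>Q\<^esub> \<phi> (mpoly_monom B \<beta>))"
    and "p \<in> carrier P"
  shows "\<phi> p = (\<Oplus>\<^bsub>Q\<^esub>\<beta>\<in>\<Delta>. coord p \<beta> \<odot>\<^bsub>Q\<^esub> \<phi> (mpoly_monom B \<beta>))"
proof -
  have hom: "\<phi> \<in> alg_hom B P Q" using assms(1) by (simp add: hilb_hom_def)
  interpret Q: algebra B Q using assms(1) by (simp add: hilb_hom_def)
  interpret h: ring_hom_cring P Q \<phi> by (rule alg_hom_ring_hom_cring[OF P.algebra_axioms Q.algebra_axioms hom])
  have const: "\<phi> (k \<odot>\<^bsub>P\<^esub> \<one>\<^bsub>P\<^esub>) \<otimes>\<^bsub>Q\<^esub> x = k \<odot>\<^bsub>Q\<^esub> x" if "k \<in> carrier B" "x \<in> carrier Q" for k x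
    using that by (simp add: alg_hom_smult[OF hom] Q.smult_one_mult)
  have cl: "\<phi> (mpoly_monom B \<beta>) \<in> carrier Q" if "\<beta> \<in> \<Delta>" for \<beta> using that by (simp add: \<Delta>_monom)
  have "\<phi> p = mpoly_lin B Q (\<lambda>k. \<phi> (k \<odot>\<^bsub>P\<^esub> \<one>\<^bsub>P\<^esub>)) (\<lambda>\<alpha>. \<phi> (mpoly_monom B \<alpha>)) p"
    by (intro mpoly_hom_eq_lin B.cring_axioms Q.M_cring h.homh assms(3))
  also have "\<dots> = (\<Oplus>\<^bsub>Q\<^esub>\<beta>\<in>\<Delta>. \<phi> (coord p \<beta> \<odot>\<^bsub>P\<^esub> \<one>\<^bsub>P\<^esub>) \<otimes>\<^bsub>Q\<^esub> \<phi> (mpoly_monom B \<beta>))"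
  proof (intro eval_coord mpoly_hom_eval B.cring_axioms Q.M_cring h.homh assms(3))
    fix \<alpha> assume \<alpha>: "\<alpha> \<in> N \<union> border1 n N"
    show "\<phi> (mpoly_monom B \<alpha>) = (\<Oplus>\<^bsub>Q\<^esub>\<beta>\<in>\<Delta>. \<phi> (a \<alpha> \<beta> \<odot>\<^bsub>P\<^esub> \<one>\<^bsub>P\<^esub>) \<otimes>\<^bsub>Q\<^esub> \<phi> (mpoly_monom B \<beta>))"
      unfolding \<phi>[OF \<alpha>] using \<alpha> cl by (intro Q.finsum_cong') (auto simp: const a_closed)
  qed
  also have "\<dots> = (\<Oplus>\<^bsub>Q\<^esub>\<beta>\<in>\<Delta>. coord p \<beta> \<odot>\<^bsub>Q\<^esub> \<phi> (mpoly_monom B \<beta>))"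
    using assms(3) cl by (intro Q.finsum_cong') (auto simp: const coord_closed)
  finally show ?thesis .
qed

text \<open>By \<open>hilb_hom_coord\<close> the coordinates are the coefficients of \<phi> p in a
  basis, so \<phi> p vanishes exactly when they all do. The kernel thus depends on the point
  alone.\<close>

lemma hilb_hom_kernel:
  assumes "hilb_hom n \<Delta> B Q \<phi>"
    and "\<And>\<alpha>. \<alpha> \<in> N \<union> border1 n N \<Longrightarrow>
      \<phi> (mpoly_monom B \<alpha>) = (\<Oplus>\<^bsub>Q\<^esub>\<beta>\<in>\<Delta>. a \<alpha> \<beta> \<odot>\<^bsub>Q\<^esub> \<phi> (mpoly_monom B \<beta>))"
  shows "a_kernel P Q \<phi> = rel_ideal"
proof -
  interpret Q: algebra B Q using assms(1) by (simp add: hilb_hom_def)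
  have "\<phi> p = \<zero>\<^bsub>Q\<^esub> \<longleftrightarrow> (\<forall>\<beta>\<in>\<Delta>. coord p \<beta> = \<zero>\<^bsub>B\<^esub>)" if p: "p \<in> carrier P" for p
  proof
    assume "\<phi> p = \<zero>\<^bsub>Q\<^esub>"
    then have "(\<Oplus>\<^bsub>Q\<^esub>\<beta>\<in>\<Delta>. coord p \<beta> \<odot>\<^bsub>Q\<^esub> \<phi> (mpoly_monom B \<beta>)) = \<zero>\<^bsub>Q\<^esub>"
      using hilb_hom_coord[OF assms p] by simp
    moreover have "coord p \<in> \<Delta> \<rightarrow> carrier B" using p by (simp add: coord_closed)
    ultimately show "\<forall>\<beta>\<in>\<Delta>. coord p \<beta> = \<zero>\<^bsub>B\<^esub>"
      using assms(1) unfolding hilb_hom_def is_basis_def by blast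
  next
    assume z: "\<forall>\<beta>\<in>\<Delta>. coord p \<beta> = \<zero>\<^bsub>B\<^esub>"
    have "\<phi> (mpoly_monom B \<beta>) \<in> carrier Q" if "\<beta> \<in> \<Delta>" for \<beta>
      using assms(1) that unfolding hilb_hom_def is_basis_def by blast
    with z have "(\<Oplus>\<^bsub>Q\<^esub>\<beta>\<in>\<Delta>. coord p \<beta> \<odot>\<^bsub>Q\<^esub> \<phi> (mpoly_monom B \<beta>)) = \<zero>\<^bsub>Q\<^esub>"
      by (intro Q.add.finprod_one_eqI) simp
    then show "\<phi> p = \<zero>\<^bsub>Q\<^esub>" using hilb_hom_coord[OF assms p] by simp
  qed
  then show ?thesis unfolding rel_ideal_def a_kernel_def' by blast
qed

end

section \<open>From a quotient with basis \<Delta> to a point\<close>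

lemma is_basis_indep:
  assumes "is_basis B M I v" "c \<in> I \<rightarrow> carrier B" "(\<Oplus>\<^bsub>M\<^esub>i\<in>I. c i \<odot>\<^bsub>M\<^esub> v i) = \<zero>\<^bsub>M\<^esub>" "i \<in> I"
  shows "c i = \<zero>\<^bsub>B\<^esub>"
  using assms unfolding is_basis_def by blast

text \<open>Independence in \<open>is_basis\<close> concerns vanishing combinations; the difference
  of two expansions turns it into comparison of coefficients, with which all equations of a point
  are read off.\<close>

lemma is_basis_unique:
  assumes "module B M" "is_basis B M I v" "finite I" "c \<in> I \<rightarrow> carrier B" "c' \<in> I \<rightarrow> carrier B"
    and eq: "(\<Oplus>\<^bsub>M\<^esub>i\<in>I. c i \<odot>\<^bsub>M\<^esub> v i) = (\<Oplus>\<^bsub>M\<^esub>i\<in>I. c' i \<odot>\<^bsub>M\<^esub> v i)" and "i \<in> I"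
  shows "c i = c' i"
proof -
  interpret M: module B M by fact
  have v: "v i \<in> carrier M" if "i \<in> I" for i using assms(2) that by (auto simp: is_basis_def)
  have c: "c i \<in> carrier B" "c' i \<in> carrier B" if "i \<in> I" for i using assms(4,5) that by auto
  have "(\<Oplus>\<^bsub>M\<^esub>i\<in>I. (c i \<ominus>\<^bsub>B\<^esub> c' i) \<odot>\<^bsub>M\<^esub> v i) =
      (\<Oplus>\<^bsub>M\<^esub>i\<in>I. c i \<odot>\<^bsub>M\<^esub> v i \<oplus>\<^bsub>M\<^esub> \<ominus>\<^bsub>B\<^esub> \<one>\<^bsub>B\<^esub> \<odot>\<^bsub>M\<^esub> (c' i \<odot>\<^bsub>M\<^esub> v i))"
    using v c
    by (intro M.finsum_cong') (auto simp: M.smult_l_distr a_minus_def M.smult_l_minus)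
  also have "\<dots> = (\<Oplus>\<^bsub>M\<^esub>i\<in>I. c i \<odot>\<^bsub>M\<^esub> v i) \<oplus>\<^bsub>M\<^esub> \<ominus>\<^bsub>B\<^esub> \<one>\<^bsub>B\<^esub> \<odot>\<^bsub>M\<^esub> (\<Oplus>\<^bsub>M\<^esub>i\<in>I. c' i \<odot>\<^bsub>M\<^esub> v i)"
    using v c assms(3) by (subst M.finsum_addf) (auto simp: M.finsum_smult_ldistr Pi_iff)
  also have "\<dots> = \<zero>\<^bsub>M\<^esub>"
    unfolding eq using v c by (subst M.smult_l_minus) (auto intro!: M.r_neg M.finsum_closed)
  finally have "(\<Oplus>\<^bsub>M\<^esub>i\<in>I. (c i \<ominus>\<^bsub>B\<^esub> c' i) \<odot>\<^bsub>M\<^esub> v i) = \<zero>\<^bsub>M\<^esub>" .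
  moreover have "(\<lambda>i. c i \<ominus>\<^bsub>B\<^esub> c' i) \<in> I \<rightarrow> carrier B" using c by auto
  ultimately have "c i \<ominus>\<^bsub>B\<^esub> c' i = \<zero>\<^bsub>B\<^esub>"
    using is_basis_indep[OF assms(2) _ _ \<open>i \<in> I\<close>, of "\<lambda>i. c i \<ominus>\<^bsub>B\<^esub> c' i"] by blast
  then show ?thesis using c \<open>i \<in> I\<close> by simp
qed

lemma hilb_homE:
  assumes "hilb_hom n \<Delta> B Q \<phi>"
  shows "algebra B Q" "cring B" "ring_hom_cring (polyring n B) Q \<phi>" "\<phi> \<in> alg_hom B (polyring n B) Q"
    "\<phi> ` carrier (polyring n B) = carrier Q" "is_basis B Q \<Delta> (\<lambda>\<beta>. \<phi> (mpoly_monom B \<beta>))"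
proof -
  show Q: "algebra B Q" and h: "\<phi> \<in> alg_hom B (polyring n B) Q"
    and "\<phi> ` carrier (polyring n B) = carrier Q" "is_basis B Q \<Delta> (\<lambda>\<beta>. \<phi> (mpoly_monom B \<beta>))"
    using assms by (auto simp: hilb_hom_def)
  show B: "cring B" using Q by (rule algebra.R_cring)
  show "ring_hom_cring (polyring n B) Q \<phi>"
    by (rule alg_hom_ring_hom_cring[OF cring.mpoly_algebra[OF B] Q h])
qed

text \<open>Holds the combinatorial data without a ring or a matrix, so that statements can involve
  several rings and several points at once, as base change does.\<close>

locale standard_pair =
  fixes n :: nat and \<Delta> N :: "nat multiset set"
  assumes \<Delta>_standard: "standard_set n \<Delta>" and \<Delta>_finite: "finite \<Delta>" and empty_in_\<Delta>: "{#} \<in> \<Delta>"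
    and N_standard: "standard_set n N" and \<Delta>_subset: "\<Delta> \<subseteq> N"
begin

abbreviation "D \<equiv> N \<union> border1 n N"

lemma \<Delta>_in: "\<gamma> \<in> \<Delta> \<Longrightarrow> \<gamma> \<in> D"
  using \<Delta>_subset by blast

lemma \<Delta>_add_in: "i \<in> {1..n} \<Longrightarrow> \<gamma> \<in> \<Delta> \<Longrightarrow> add_mset i \<gamma> \<in> D"
  using \<Delta>_subset by (intro add_mset_in_Un_border) auto

lemma D_expts: "\<alpha> \<in> D \<Longrightarrow> set_mset \<alpha> \<subseteq> {1..n}"
  by (rule Un_border_expts[OF N_standard])

lemma \<Delta>_expts: "\<gamma> \<in> \<Delta> \<Longrightarrow> set_mset \<gamma> \<subseteq> {1..n}"
  by (intro D_expts \<Delta>_in)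

text \<open>Each of the three families compares two expansions of one element of Q in the basis
  \<Delta>: a monomial of \<Delta> with itself, a product with a variable inside \<open>D\<close>,
  and a monomial beyond \<open>D\<close> reached in two ways.\<close>

lemma hilb_point_of_hilb_hom:
  assumes "hilb_hom n \<Delta> B Q \<phi>"
    and a: "\<And>\<alpha> \<beta>. \<alpha> \<in> D \<Longrightarrow> \<beta> \<in> \<Delta> \<Longrightarrow> a \<alpha> \<beta> \<in> carrier B"
    and \<phi>: "\<And>\<alpha>. \<alpha> \<in> D \<Longrightarrow> \<phi> (mpoly_monom B \<alpha>) = (\<Oplus>\<^bsub>Q\<^esub>\<beta>\<in>\<Delta>. a \<alpha> \<beta> \<odot>\<^bsub>Q\<^esub> \<phi> (mpoly_monom B \<beta>))"
  shows "hilb_point B n \<Delta> N a"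
proof -
  note hh = hilb_homE[OF assms(1)]
  interpret B: cring B by (rule hh(2))
  interpret Q: algebra B Q by (rule hh(1))
  interpret h: ring_hom_cring "polyring n B" Q \<phi> by (rule hh(3))
  have mon: "mpoly_monom B \<alpha> \<in> carrier (polyring n B)" if "\<alpha> \<in> D" for \<alpha>
    using that by (intro B.mpoly_monom_in D_expts)
  have cl: "\<phi> (mpoly_monom B \<alpha>) \<in> carrier Q" if "\<alpha> \<in> D" for \<alpha>
    using mon[OF that] by simp
  have uniq: "c \<beta> = c' \<beta>" if "\<alpha> \<in> carrier Q" "c \<in> \<Delta> \<rightarrow> carrier B" "c' \<in> \<Delta> \<rightarrow> carrier B"
    "\<alpha> = (\<Oplus>\<^bsub>Q\<^esub>\<beta>\<in>\<Delta>. c \<beta> \<odot>\<^bsub>Q\<^esub> \<phi> (mpoly_monom B \<beta>))"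
    "\<alpha> = (\<Oplus>\<^bsub>Q\<^esub>\<beta>\<in>\<Delta>. c' \<beta> \<odot>\<^bsub>Q\<^esub> \<phi> (mpoly_monom B \<beta>))" "\<beta> \<in> \<Delta>" for \<alpha> c c' \<beta>
    using is_basis_unique[OF Q.module hh(6) \<Delta>_finite that(2,3) _ that(6)] that by simp
  \<comment> \<open>The core of the argument: multiplying an expansion by x_i and expanding each x_i
    x^\<gamma> again gives the row of \<alpha> times the matrix of x_i. This holds also when
    \<alpha> + e_i is outside \<open>D\<close>.\<close>
  have mult: "\<phi> (mpoly_monom B (add_mset i \<alpha>)) =
      (\<Oplus>\<^bsub>Q\<^esub>\<beta>\<in>\<Delta>. (\<Oplus>\<^bsub>B\<^esub>\<gamma>\<in>\<Delta>. a \<alpha> \<gamma> \<otimes>\<^bsub>B\<^esub> a (add_mset i \<gamma>) \<beta>) \<odot>\<^bsub>Q\<^esub> \<phi> (mpoly_monom B \<beta>))"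
    if i: "i \<in> {1..n}" and \<alpha>: "\<alpha> \<in> D" for i \<alpha>
  proof -
    have x: "\<phi> (B.indexed_var i) \<in> carrier Q" using h.hom_closed[OF B.mpoly_var_in[OF i]] .
    have step: "\<phi> (mpoly_monom B (add_mset i \<gamma>)) = \<phi> (B.indexed_var i) \<otimes>\<^bsub>Q\<^esub> \<phi> (mpoly_monom B \<gamma>)"
      if "\<gamma> \<in> D" for \<gamma>
      using that i by (simp add: B.mpoly_monom_add_mset_eq[OF D_expts] B.mpoly_var_in mon)
    \<comment> \<open>Scalars are moved from B into Q by the structure map, because
      \<open>finsum_matrix_assoc\<close> computes in a single ring.\<close>
    let ?h = "\<lambda>c. c \<odot>\<^bsub>Q\<^esub> \<one>\<^bsub>Q\<^esub>"
    interpret k: ring_hom_cring B Q ?h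
      by unfold_locales (rule Q.smult_one_hom)
    have hcl: "c \<in> carrier B \<Longrightarrow> ?h c \<in> carrier Q" for c by simp
    have aa: "a (add_mset i \<gamma>) \<beta> \<in> carrier B" if "\<gamma> \<in> \<Delta>" "\<beta> \<in> \<Delta>" for \<gamma> \<beta>
      using that i by (intro a \<Delta>_add_in)
    have "\<phi> (mpoly_monom B (add_mset i \<alpha>)) =
        \<phi> (B.indexed_var i) \<otimes>\<^bsub>Q\<^esub> (\<Oplus>\<^bsub>Q\<^esub>\<gamma>\<in>\<Delta>. a \<alpha> \<gamma> \<odot>\<^bsub>Q\<^esub> \<phi> (mpoly_monom B \<gamma>))"
      using \<alpha> step \<phi> by simp
    also have "\<dots> = (\<Oplus>\<^bsub>Q\<^esub>\<gamma>\<in>\<Delta>. \<phi> (B.indexed_var i) \<otimes>\<^bsub>Q\<^esub> (a \<alpha> \<gamma> \<odot>\<^bsub>Q\<^esub> \<phi> (mpoly_monom B \<gamma>)))"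
      using x \<alpha> \<Delta>_finite cl[OF \<Delta>_in] by (intro Q.finsum_rdistr) (auto simp: a)
    also have "\<dots> = (\<Oplus>\<^bsub>Q\<^esub>\<gamma>\<in>\<Delta>. ?h (a \<alpha> \<gamma>) \<otimes>\<^bsub>Q\<^esub>
        (\<Oplus>\<^bsub>Q\<^esub>\<beta>\<in>\<Delta>. ?h (a (add_mset i \<gamma>) \<beta>) \<otimes>\<^bsub>Q\<^esub> \<phi> (mpoly_monom B \<beta>)))"
    proof (rule Q.finsum_cong')
      fix \<gamma> assume \<gamma>: "\<gamma> \<in> \<Delta>"
      note cl\<gamma> = cl[OF \<Delta>_in[OF \<gamma>]] a[OF \<alpha> \<gamma>]
      have "\<phi> (B.indexed_var i) \<otimes>\<^bsub>Q\<^esub> (a \<alpha> \<gamma> \<odot>\<^bsub>Q\<^esub> \<phi> (mpoly_monom B \<gamma>)) =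
          (a \<alpha> \<gamma> \<odot>\<^bsub>Q\<^esub> \<phi> (mpoly_monom B \<gamma>)) \<otimes>\<^bsub>Q\<^esub> \<phi> (B.indexed_var i)"
        using x cl\<gamma> by (intro Q.m_comm) auto
      also have "\<dots> = a \<alpha> \<gamma> \<odot>\<^bsub>Q\<^esub> \<phi> (mpoly_monom B (add_mset i \<gamma>))"
        using x cl\<gamma> step[OF \<Delta>_in[OF \<gamma>]] Q.m_comm[OF x cl\<gamma>(1)] by (simp add: Q.smult_assoc2)
      also have "\<dots> = ?h (a \<alpha> \<gamma>) \<otimes>\<^bsub>Q\<^esub> \<phi> (mpoly_monom B (add_mset i \<gamma>))"
        using cl\<gamma> cl[OF \<Delta>_add_in[OF i \<gamma>]] by (simp add: Q.smult_one_mult)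
      also have "\<phi> (mpoly_monom B (add_mset i \<gamma>)) =
          (\<Oplus>\<^bsub>Q\<^esub>\<beta>\<in>\<Delta>. ?h (a (add_mset i \<gamma>) \<beta>) \<otimes>\<^bsub>Q\<^esub> \<phi> (mpoly_monom B \<beta>))"
        unfolding \<phi>[OF \<Delta>_add_in[OF i \<gamma>]] using aa[OF \<gamma>] cl[OF \<Delta>_in]
        by (intro Q.finsum_cong') (auto simp: Q.smult_one_mult)
      finally show "\<phi> (B.indexed_var i) \<otimes>\<^bsub>Q\<^esub> (a \<alpha> \<gamma> \<odot>\<^bsub>Q\<^esub> \<phi> (mpoly_monom B \<gamma>)) = ?h (a \<alpha> \<gamma>) \<otimes>\<^bsub>Q\<^esub>
        (\<Oplus>\<^bsub>Q\<^esub>\<beta>\<in>\<Delta>. ?h (a (add_mset i \<gamma>) \<beta>) \<otimes>\<^bsub>Q\<^esub> \<phi> (mpoly_monom B \<beta>))" .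
    qed (use a[OF \<alpha>] aa cl[OF \<Delta>_in] in \<open>auto intro!: Q.m_closed Q.finsum_closed\<close>)
    also have "\<dots> = (\<Oplus>\<^bsub>Q\<^esub>\<beta>\<in>\<Delta>. (\<Oplus>\<^bsub>Q\<^esub>\<gamma>\<in>\<Delta>. ?h (a \<alpha> \<gamma>) \<otimes>\<^bsub>Q\<^esub> ?h (a (add_mset i \<gamma>) \<beta>)) \<otimes>\<^bsub>Q\<^esub> \<phi> (mpoly_monom B \<beta>))"
      using a[OF \<alpha>] aa cl[OF \<Delta>_in] \<Delta>_finite by (intro Q.finsum_matrix_assoc) auto
    also have "\<dots> = (\<Oplus>\<^bsub>Q\<^esub>\<beta>\<in>\<Delta>. (\<Oplus>\<^bsub>B\<^esub>\<gamma>\<in>\<Delta>. a \<alpha> \<gamma> \<otimes>\<^bsub>B\<^esub> a (add_mset i \<gamma>) \<beta>) \<odot>\<^bsub>Q\<^esub> \<phi> (mpoly_monom B \<beta>))"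
    proof (rule Q.finsum_cong')
      fix \<beta> assume \<beta>: "\<beta> \<in> \<Delta>"
      have s: "(\<Oplus>\<^bsub>B\<^esub>\<gamma>\<in>\<Delta>. a \<alpha> \<gamma> \<otimes>\<^bsub>B\<^esub> a (add_mset i \<gamma>) \<beta>) \<in> carrier B"
        using a[OF \<alpha>] aa[OF _ \<beta>] by (intro B.finsum_closed) auto
      have "?h (\<Oplus>\<^bsub>B\<^esub>\<gamma>\<in>\<Delta>. a \<alpha> \<gamma> \<otimes>\<^bsub>B\<^esub> a (add_mset i \<gamma>) \<beta>) =
          (\<Oplus>\<^bsub>Q\<^esub>\<gamma>\<in>\<Delta>. ?h (a \<alpha> \<gamma> \<otimes>\<^bsub>B\<^esub> a (add_mset i \<gamma>) \<beta>))"
        using a[OF \<alpha>] aa[OF _ \<beta>] by (subst k.hom_finsum) (auto simp: o_def)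
      also have "\<dots> = (\<Oplus>\<^bsub>Q\<^esub>\<gamma>\<in>\<Delta>. ?h (a \<alpha> \<gamma>) \<otimes>\<^bsub>Q\<^esub> ?h (a (add_mset i \<gamma>) \<beta>))"
        using a[OF \<alpha>] aa[OF _ \<beta>] by (intro Q.finsum_cong') (auto intro!: k.hom_mult)
      finally show "(\<Oplus>\<^bsub>Q\<^esub>\<gamma>\<in>\<Delta>. ?h (a \<alpha> \<gamma>) \<otimes>\<^bsub>Q\<^esub> ?h (a (add_mset i \<gamma>) \<beta>)) \<otimes>\<^bsub>Q\<^esub> \<phi> (mpoly_monom B \<beta>) =
          (\<Oplus>\<^bsub>B\<^esub>\<gamma>\<in>\<Delta>. a \<alpha> \<gamma> \<otimes>\<^bsub>B\<^esub> a (add_mset i \<gamma>) \<beta>) \<odot>\<^bsub>Q\<^esub> \<phi> (mpoly_monom B \<beta>)"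
        using Q.smult_one_mult[OF s cl[OF \<Delta>_in[OF \<beta>]]] by simp
    qed (use a[OF \<alpha>] aa cl[OF \<Delta>_in] in \<open>auto intro!: Q.smult_closed B.finsum_closed\<close>)
    finally show ?thesis .
  qed
  have sum_cl: "(\<lambda>\<beta>. \<Oplus>\<^bsub>B\<^esub>\<gamma>\<in>\<Delta>. a \<alpha> \<gamma> \<otimes>\<^bsub>B\<^esub> a (add_mset i \<gamma>) \<beta>) \<in> \<Delta> \<rightarrow> carrier B"
    if "i \<in> {1..n}" "\<alpha> \<in> D" for i \<alpha>
    using a[OF that(2)] a[OF \<Delta>_add_in[OF that(1)]] by (auto intro!: B.finsum_closed)
  show ?thesis
  proof (intro hilb_point.intro hilb_point_axioms.intro B.cring_axioms \<Delta>_standard \<Delta>_finite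
      empty_in_\<Delta> N_standard \<Delta>_subset a)
    fix \<alpha> \<beta> assume \<alpha>: "\<alpha> \<in> \<Delta>" and \<beta>: "\<beta> \<in> \<Delta>"
    note cl' = cl[OF \<Delta>_in]
    \<comment> \<open>A monomial of \<Delta> has the trivial expansion with Kronecker coefficients,
      to be compared with its row in \<open>a\<close>.\<close>
    have "(\<Oplus>\<^bsub>Q\<^esub>\<beta>\<in>\<Delta>. (if \<alpha> = \<beta> then \<one>\<^bsub>B\<^esub> else \<zero>\<^bsub>B\<^esub>) \<odot>\<^bsub>Q\<^esub> \<phi> (mpoly_monom B \<beta>)) =
        (\<Oplus>\<^bsub>Q\<^esub>\<beta>\<in>\<Delta>. if \<alpha> = \<beta> then \<phi> (mpoly_monom B \<beta>) else \<zero>\<^bsub>Q\<^esub>)"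
      using cl' by (intro Q.finsum_cong') auto
    also have "\<dots> = \<phi> (mpoly_monom B \<alpha>)"
      using cl' \<Delta>_finite \<alpha> by (intro Q.finsum_singleton) auto
    finally show "a \<alpha> \<beta> = (if \<alpha> = \<beta> then \<one>\<^bsub>B\<^esub> else \<zero>\<^bsub>B\<^esub>)"
      using uniq[of "\<phi> (mpoly_monom B \<alpha>)" "a \<alpha>" "\<lambda>\<beta>. if \<alpha> = \<beta> then \<one>\<^bsub>B\<^esub> else \<zero>\<^bsub>B\<^esub>" \<beta>]
        a[OF \<Delta>_in[OF \<alpha>]] \<phi>[OF \<Delta>_in[OF \<alpha>]] cl'[OF \<alpha>] \<beta> by auto
  next
    fix \<alpha> i \<beta> assume i: "i \<in> {1..n}" and \<alpha>: "add_mset i \<alpha> \<in> D" and \<beta>: "\<beta> \<in> \<Delta>"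
    note \<alpha>' = Un_border_pred[OF N_standard \<alpha>]
    show "a (add_mset i \<alpha>) \<beta> = (\<Oplus>\<^bsub>B\<^esub>\<gamma>\<in>\<Delta>. a \<alpha> \<gamma> \<otimes>\<^bsub>B\<^esub> a (add_mset i \<gamma>) \<beta>)"
      using a[OF \<alpha>] by (intro uniq[OF cl[OF \<alpha>] _ sum_cl[OF i \<alpha>'] \<phi>[OF \<alpha>] mult[OF i \<alpha>'] \<beta>]) auto
  next
    fix \<alpha> \<alpha>' i j \<beta>
    assume *: "\<alpha> \<in> border1 n N" "\<alpha>' \<in> border1 n N" and i: "i \<in> {1..n}" and j: "j \<in> {1..n}"
      and eq: "add_mset i \<alpha> = add_mset j \<alpha>'" and \<beta>: "\<beta> \<in> \<Delta>"
    then have \<alpha>: "\<alpha> \<in> D" "\<alpha>' \<in> D" by auto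
    have "set_mset (add_mset i \<alpha>) \<subseteq> {1..n}" using i D_expts[OF \<alpha>(1)] by simp
    then have "\<phi> (mpoly_monom B (add_mset i \<alpha>)) \<in> carrier Q"
      by (intro h.hom_closed B.mpoly_monom_in)
    \<comment> \<open>Since \<alpha> + e_i = \<alpha>' + e_j, the two instances of
      \<open>mult\<close> expand the same monomial.\<close>
    from uniq[OF this sum_cl[OF i \<alpha>(1)] sum_cl[OF j \<alpha>(2)] mult[OF i \<alpha>(1)] mult[OF j \<alpha>(2), folded eq] \<beta>]
    show "(\<Oplus>\<^bsub>B\<^esub>\<gamma>\<in>\<Delta>. a \<alpha> \<gamma> \<otimes>\<^bsub>B\<^esub> a (add_mset i \<gamma>) \<beta>) = (\<Oplus>\<^bsub>B\<^esub>\<gamma>\<in>\<Delta>. a \<alpha>' \<gamma> \<otimes>\<^bsub>B\<^esub> a (add_mset j \<gamma>) \<beta>)" .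
  qed
qed

text \<open>Expresses a relation between monomials through the kernel alone, hence makes it
  invariant under the equivalence of quotients.\<close>

lemma hilb_hom_eq_kernel:
  assumes "hilb_hom n \<Delta> B Q \<phi>" "\<alpha> \<in> D" "c \<in> \<Delta> \<rightarrow> carrier B"
  shows "\<phi> (mpoly_monom B \<alpha>) = (\<Oplus>\<^bsub>Q\<^esub>\<beta>\<in>\<Delta>. c \<beta> \<odot>\<^bsub>Q\<^esub> \<phi> (mpoly_monom B \<beta>)) \<longleftrightarrow>
    mpoly_monom B \<alpha> \<ominus>\<^bsub>polyring n B\<^esub> (\<Oplus>\<^bsub>polyring n B\<^esub>\<beta>\<in>\<Delta>. c \<beta> \<odot>\<^bsub>polyring n B\<^esub> mpoly_monom B \<beta>)
      \<in> a_kernel (polyring n B) Q \<phi>"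
proof -
  note hh = hilb_homE[OF assms(1)]
  interpret B: cring B by (rule hh(2))
  interpret Q: algebra B Q by (rule hh(1))
  interpret P: algebra B "polyring n B" by (rule B.mpoly_algebra)
  interpret h: ring_hom_cring "polyring n B" Q \<phi> by (rule hh(3))
  have mon: "mpoly_monom B \<alpha> \<in> carrier (polyring n B)" if "\<alpha> \<in> D" for \<alpha>
    using that by (intro B.mpoly_monom_in D_expts)
  define s where "s = (\<Oplus>\<^bsub>polyring n B\<^esub>\<beta>\<in>\<Delta>. c \<beta> \<odot>\<^bsub>polyring n B\<^esub> mpoly_monom B \<beta>)"
  have s: "s \<in> carrier (polyring n B)"
    unfolding s_def using assms(3) mon[OF \<Delta>_in] by (intro P.finsum_closed) auto
  have "\<phi> s = (\<Oplus>\<^bsub>Q\<^esub>\<beta>\<in>\<Delta>. c \<beta> \<odot>\<^bsub>Q\<^esub> \<phi> (mpoly_monom B \<beta>))"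
    unfolding s_def using mon[OF \<Delta>_in]
    by (intro alg_hom_finsum[OF P.algebra_axioms hh(1,4) \<Delta>_finite assms(3)]) auto
  moreover have "\<phi> (mpoly_monom B \<alpha> \<ominus>\<^bsub>polyring n B\<^esub> s) = \<phi> (mpoly_monom B \<alpha>) \<ominus>\<^bsub>Q\<^esub> \<phi> s"
    using s mon[OF assms(2)] by (simp add: a_minus_def)
  moreover have "\<phi> (mpoly_monom B \<alpha>) \<ominus>\<^bsub>Q\<^esub> \<phi> s = \<zero>\<^bsub>Q\<^esub> \<longleftrightarrow> \<phi> (mpoly_monom B \<alpha>) = \<phi> s"
    using s mon[OF assms(2)] by simp
  ultimately show ?thesis
    unfolding s_def[symmetric] a_kernel_iff using s mon[OF assms(2)] by simp
qed

end

section \<open>The representing algebra\<close>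

text \<open>Each summand embeds by adding the zero of the other. This lets the three families of
  equations be treated one at a time.\<close>

lemma set_add_subset_iff:
  assumes "ideal I R" "ideal J R" "ideal L R"
  shows "set_add R I J \<subseteq> L \<longleftrightarrow> I \<subseteq> L \<and> J \<subseteq> L"
proof -
  interpret I: ideal I R by fact
  interpret J: ideal J R by fact
  interpret L: ideal L R by fact
  have mem: "x \<oplus>\<^bsub>R\<^esub> y \<in> set_add R I J" if "x \<in> I" "y \<in> J" for x y
    using that unfolding set_add_def' by blast
  have "x \<in> set_add R I J" if "x \<in> I" for x
    using mem[OF that additive_subgroup.zero_closed[OF ideal.axioms(1)[OF assms(2)]]] I.Icarr[OF that] by simp
  moreover have "x \<in> set_add R I J" if "x \<in> J" for x
    using mem[OF additive_subgroup.zero_closed[OF ideal.axioms(1)[OF assms(1)]] that] J.Icarr[OF that] by simp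
  moreover have "set_add R I J \<subseteq> L" if "I \<subseteq> L" "J \<subseteq> L"
  proof
    fix z assume "z \<in> set_add R I J"
    then obtain x y where "x \<in> I" "y \<in> J" "z = x \<oplus>\<^bsub>R\<^esub> y" unfolding set_add_def' by blast
    with that show "z \<in> L" using additive_subgroup.a_closed[OF ideal.axioms(1)[OF assms(3)]] by blast
  qed
  ultimately show ?thesis by blast
qed

lemma alg_hom_comp:
  "f \<in> alg_hom R A B \<Longrightarrow> g \<in> alg_hom R B C \<Longrightarrow> (\<lambda>x. g (f x)) \<in> alg_hom R A C"
  by (auto simp: alg_hom_def ring_hom_def Pi_iff)

lemma alg_hom_cong:
  assumes "algebra R A" "f \<in> alg_hom R A B" "\<And>x. x \<in> carrier A \<Longrightarrow> g x = f x"
  shows "g \<in> alg_hom R A B"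
proof -
  interpret algebra R A by fact
  from assms(2,3) show ?thesis by (simp add: alg_hom_def ring_hom_def Pi_iff)
qed

text \<open>Since c x = (c 1) x, compatibility with scalars follows from multiplicativity once it
  holds at 1. It upgrades the ring homomorphisms supplied by \<open>mpoly_evalE\<close>.\<close>

lemma alg_homI:
  assumes "algebra R A" "algebra R B" "h \<in> ring_hom A B"
    and "\<And>c. c \<in> carrier R \<Longrightarrow> h (c \<odot>\<^bsub>A\<^esub> \<one>\<^bsub>A\<^esub>) = c \<odot>\<^bsub>B\<^esub> \<one>\<^bsub>B\<^esub>"
  shows "h \<in> alg_hom R A B"
proof -
  interpret A: algebra R A by fact
  interpret B: algebra R B by fact
  have "h (c \<odot>\<^bsub>A\<^esub> x) = c \<odot>\<^bsub>B\<^esub> h x" if c: "c \<in> carrier R" and x: "x \<in> carrier A" for c x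
  proof -
    have "h (c \<odot>\<^bsub>A\<^esub> x) = h ((c \<odot>\<^bsub>A\<^esub> \<one>\<^bsub>A\<^esub>) \<otimes>\<^bsub>A\<^esub> x)" using c x by (simp add: A.smult_one_mult)
    also have "\<dots> = (c \<odot>\<^bsub>B\<^esub> \<one>\<^bsub>B\<^esub>) \<otimes>\<^bsub>B\<^esub> h x"
      using c x assms(4) by (subst ring_hom_mult[OF assms(3)]) auto
    also have "\<dots> = c \<odot>\<^bsub>B\<^esub> h x"
      using c ring_hom_closed[OF assms(3) x] by (rule B.smult_one_mult)
    finally show ?thesis .
  qed
  with assms(3) show ?thesis by (simp add: alg_hom_def)
qed

locale hilb_scheme = standard_pair n \<Delta> N + K: cring K
  for n \<Delta> N and K :: "('k, 'm) ring_scheme"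
begin

abbreviation "T \<equiv> T_ring K n N \<Delta>"

sublocale T: algebra K T
  unfolding T_ring_def by (rule K.mpoly_algebra)

lemma T_var_in: "\<alpha> \<in> D \<Longrightarrow> \<beta> \<in> \<Delta> \<Longrightarrow> T_var K \<alpha> \<beta> \<in> carrier T"
  unfolding T_ring_def T_var_def by (intro K.mpoly_var_in) simp

lemma T_sum_add_in:
  assumes "\<alpha> \<in> D" "i \<in> {1..n}" "\<beta> \<in> \<Delta>"
  shows "T_sum K n N \<Delta> \<alpha> {#i#} \<beta> \<in> carrier T"
  unfolding T_sum_def using assms \<Delta>_add_in[OF assms(2)]
  by (intro T.finsum_closed funcsetI T.m_closed T_var_in) simp_all

text \<open>A generated ideal lies in J as soon as its generators do. Applied with J the kernel of a
  homomorphism, this and the next two lemmas turn the ideals into equations.\<close>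

lemma
  shows I1_ideal: "ideal (I1 K n N \<Delta>) T"
    and I1_subset_iff: "ideal J T \<Longrightarrow> I1 K n N \<Delta> \<subseteq> J \<longleftrightarrow>
      (\<forall>\<alpha>\<in>\<Delta>. \<forall>\<beta>\<in>\<Delta>. T_var K \<alpha> \<beta> \<ominus>\<^bsub>T\<^esub> (if \<alpha> = \<beta> then \<one>\<^bsub>T\<^esub> else \<zero>\<^bsub>T\<^esub>) \<in> J)"
proof -
  let ?G = "{T_var K \<alpha> \<beta> \<ominus>\<^bsub>T\<^esub> (if \<alpha> = \<beta> then \<one>\<^bsub>T\<^esub> else \<zero>\<^bsub>T\<^esub>) | \<alpha> \<beta>. \<alpha> \<in> \<Delta> \<and> \<beta> \<in> \<Delta>}"
  have G: "?G \<subseteq> carrier T" using T_var_in[OF \<Delta>_in] by auto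
  have eq: "I1 K n N \<Delta> = genideal T ?G" by (simp add: I1_def Let_def)
  show "ideal (I1 K n N \<Delta>) T" unfolding eq by (rule T.genideal_ideal[OF G])
  show "I1 K n N \<Delta> \<subseteq> J \<longleftrightarrow>
      (\<forall>\<alpha>\<in>\<Delta>. \<forall>\<beta>\<in>\<Delta>. T_var K \<alpha> \<beta> \<ominus>\<^bsub>T\<^esub> (if \<alpha> = \<beta> then \<one>\<^bsub>T\<^esub> else \<zero>\<^bsub>T\<^esub>) \<in> J)" if "ideal J T"
    unfolding eq T.Idl_subset_ideal[OF that G] by blast
qed

lemma
  shows I2_ideal: "ideal (I2 K n N \<Delta>) T"
    and I2_subset_iff: "ideal J T \<Longrightarrow> I2 K n N \<Delta> \<subseteq> J \<longleftrightarrow>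
      (\<forall>\<alpha> i \<beta>. i \<in> {1..n} \<longrightarrow> add_mset i \<alpha> \<in> D \<longrightarrow> \<beta> \<in> \<Delta> \<longrightarrow>
        T_var K (add_mset i \<alpha>) \<beta> \<ominus>\<^bsub>T\<^esub> T_sum K n N \<Delta> \<alpha> {#i#} \<beta> \<in> J)"
proof -
  let ?G = "{T_var K (\<alpha> + l) \<beta> \<ominus>\<^bsub>T\<^esub> T_sum K n N \<Delta> \<alpha> l \<beta> | \<alpha> l \<beta>.
      \<alpha> \<in> D \<and> l \<in> unit_vectors n \<and> \<alpha> + l \<in> D \<and> \<beta> \<in> \<Delta>}"
  let ?G' = "{T_var K (add_mset i \<alpha>) \<beta> \<ominus>\<^bsub>T\<^esub> T_sum K n N \<Delta> \<alpha> {#i#} \<beta> | \<alpha> i \<beta>.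
      i \<in> {1..n} \<and> add_mset i \<alpha> \<in> D \<and> \<beta> \<in> \<Delta>}"
  \<comment> \<open>Unit vectors are replaced by their indices, the form used in
    \<open>hilb_point\<close>.\<close>
  have GG: "?G = ?G'"
  proof (intro equalityI subsetI)
    fix x assume "x \<in> ?G"
    then obtain \<alpha> i \<beta> where "x = T_var K (add_mset i \<alpha>) \<beta> \<ominus>\<^bsub>T\<^esub> T_sum K n N \<Delta> \<alpha> {#i#} \<beta>"
      "i \<in> {1..n}" "add_mset i \<alpha> \<in> D" "\<beta> \<in> \<Delta>"
      unfolding unit_vectors_def by auto
    then show "x \<in> ?G'" by blast
  next
    fix x assume "x \<in> ?G'"
    then obtain \<alpha> i \<beta> where *: "x = T_var K (\<alpha> + {#i#}) \<beta> \<ominus>\<^bsub>T\<^esub> T_sum K n N \<Delta> \<alpha> {#i#} \<beta>"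
      "{#i#} \<in> unit_vectors n" "\<alpha> + {#i#} \<in> D" "\<beta> \<in> \<Delta>"
      unfolding unit_vectors_def by auto
    \<comment> \<open>Membership of \<alpha> is recovered from that of \<alpha> + e_i, as
      \<open>D\<close> is closed under removing a variable.\<close>
    moreover have "\<alpha> \<in> D" using Un_border_pred[OF N_standard, of i \<alpha>] *(3) by simp
    ultimately show "x \<in> ?G" by blast
  qed
  have G: "?G' \<subseteq> carrier T"
    using T_var_in T_sum_add_in[OF Un_border_pred[OF N_standard]] by blast
  have eq: "I2 K n N \<Delta> = genideal T ?G'" unfolding GG[symmetric] by (simp add: I2_def Let_def)
  show "ideal (I2 K n N \<Delta>) T" unfolding eq by (rule T.genideal_ideal[OF G])
  show "I2 K n N \<Delta> \<subseteq> J \<longleftrightarrow>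
      (\<forall>\<alpha> i \<beta>. i \<in> {1..n} \<longrightarrow> add_mset i \<alpha> \<in> D \<longrightarrow> \<beta> \<in> \<Delta> \<longrightarrow>
        T_var K (add_mset i \<alpha>) \<beta> \<ominus>\<^bsub>T\<^esub> T_sum K n N \<Delta> \<alpha> {#i#} \<beta> \<in> J)" if "ideal J T"
    unfolding eq T.Idl_subset_ideal[OF that G] by blast
qed

lemma
  shows I3_ideal: "ideal (I3 K n N \<Delta>) T"
    and I3_subset_iff: "ideal J T \<Longrightarrow> I3 K n N \<Delta> \<subseteq> J \<longleftrightarrow>
      (\<forall>\<alpha> \<alpha>' i j \<beta>. \<alpha> \<in> border1 n N \<longrightarrow> \<alpha>' \<in> border1 n N \<longrightarrow> i \<in> {1..n} \<longrightarrow> j \<in> {1..n} \<longrightarrow>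
        add_mset i \<alpha> = add_mset j \<alpha>' \<longrightarrow> add_mset i \<alpha> \<in> border2 n N \<longrightarrow> \<beta> \<in> \<Delta> \<longrightarrow>
        T_sum K n N \<Delta> \<alpha> {#i#} \<beta> \<ominus>\<^bsub>T\<^esub> T_sum K n N \<Delta> \<alpha>' {#j#} \<beta> \<in> J)"
proof -
  let ?G = "{T_sum K n N \<Delta> \<alpha> l \<beta> \<ominus>\<^bsub>T\<^esub> T_sum K n N \<Delta> \<alpha>' l' \<beta> | \<alpha> \<alpha>' l l' \<beta>.
      \<alpha> \<in> border1 n N \<and> \<alpha>' \<in> border1 n N \<and> l \<in> unit_vectors n \<and> l' \<in> unit_vectors n \<and>
      \<alpha> + l = \<alpha>' + l' \<and> \<alpha> + l \<in> border2 n N \<and> \<beta> \<in> \<Delta>}"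
  let ?G' = "{T_sum K n N \<Delta> \<alpha> {#i#} \<beta> \<ominus>\<^bsub>T\<^esub> T_sum K n N \<Delta> \<alpha>' {#j#} \<beta> | \<alpha> \<alpha>' i j \<beta>.
      \<alpha> \<in> border1 n N \<and> \<alpha>' \<in> border1 n N \<and> i \<in> {1..n} \<and> j \<in> {1..n} \<and>
      add_mset i \<alpha> = add_mset j \<alpha>' \<and> add_mset i \<alpha> \<in> border2 n N \<and> \<beta> \<in> \<Delta>}"
  have GG: "?G = ?G'"
  proof (intro equalityI subsetI)
    fix x assume "x \<in> ?G"
    then obtain \<alpha> \<alpha>' i j \<beta> where "x = T_sum K n N \<Delta> \<alpha> {#i#} \<beta> \<ominus>\<^bsub>T\<^esub> T_sum K n N \<Delta> \<alpha>' {#j#} \<beta>"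
      "\<alpha> \<in> border1 n N" "\<alpha>' \<in> border1 n N" "i \<in> {1..n}" "j \<in> {1..n}"
      "add_mset i \<alpha> = add_mset j \<alpha>'" "add_mset i \<alpha> \<in> border2 n N" "\<beta> \<in> \<Delta>"
      unfolding unit_vectors_def by auto
    then show "x \<in> ?G'" by blast
  next
    fix x assume "x \<in> ?G'"
    then obtain \<alpha> \<alpha>' i j \<beta> where "x = T_sum K n N \<Delta> \<alpha> {#i#} \<beta> \<ominus>\<^bsub>T\<^esub> T_sum K n N \<Delta> \<alpha>' {#j#} \<beta>"
      "\<alpha> \<in> border1 n N" "\<alpha>' \<in> border1 n N" "{#i#} \<in> unit_vectors n" "{#j#} \<in> unit_vectors n"
      "\<alpha> + {#i#} = \<alpha>' + {#j#}" "\<alpha> + {#i#} \<in> border2 n N" "\<beta> \<in> \<Delta>"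
      unfolding unit_vectors_def by auto
    then show "x \<in> ?G" by blast
  qed
  have G: "?G' \<subseteq> carrier T"
    using T_sum_add_in by blast
  have eq: "I3 K n N \<Delta> = genideal T ?G'" unfolding GG[symmetric] by (simp add: I3_def Let_def)
  show "ideal (I3 K n N \<Delta>) T" unfolding eq by (rule T.genideal_ideal[OF G])
  show "I3 K n N \<Delta> \<subseteq> J \<longleftrightarrow>
      (\<forall>\<alpha> \<alpha>' i j \<beta>. \<alpha> \<in> border1 n N \<longrightarrow> \<alpha>' \<in> border1 n N \<longrightarrow> i \<in> {1..n} \<longrightarrow> j \<in> {1..n} \<longrightarrow>
        add_mset i \<alpha> = add_mset j \<alpha>' \<longrightarrow> add_mset i \<alpha> \<in> border2 n N \<longrightarrow> \<beta> \<in> \<Delta> \<longrightarrow>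
        T_sum K n N \<Delta> \<alpha> {#i#} \<beta> \<ominus>\<^bsub>T\<^esub> T_sum K n N \<Delta> \<alpha>' {#j#} \<beta> \<in> J)" if "ideal J T"
    unfolding eq T.Idl_subset_ideal[OF that G] by blast
qed

lemma hilb_ideal_ideal: "ideal (hilb_ideal K n N \<Delta>) T"
  unfolding hilb_ideal_def by (intro T.add_ideals I1_ideal I2_ideal I3_ideal)

lemma hilb_ideal_subset_iff:
  "ideal J T \<Longrightarrow> hilb_ideal K n N \<Delta> \<subseteq> J \<longleftrightarrow> I1 K n N \<Delta> \<subseteq> J \<and> I2 K n N \<Delta> \<subseteq> J \<and> I3 K n N \<Delta> \<subseteq> J"
  unfolding hilb_ideal_def
  by (simp add: set_add_subset_iff T.add_ideals I1_ideal I2_ideal I3_ideal)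

sublocale R: quotient_algebra K T "hilb_ideal K n N \<Delta>"
  by (intro quotient_algebra.intro T.algebra_axioms hilb_ideal_ideal)

lemma hilb_alg_algebra: "algebra K (hilb_alg K n N \<Delta>)"
  unfolding hilb_alg_def by (rule R.quot_algebra)

text \<open>A difference lies in the kernel exactly when both terms have the same image, so the
  three families of generators become \<open>a_unit\<close>, \<open>a_step\<close> and
  \<open>a_border\<close>. One direction yields \<open>homset_point\<close>, the other
  \<open>homset_of_point\<close>.\<close>

lemma hilb_point_iff:
  assumes "algebra K B" "H \<in> alg_hom K T B"
    and a: "\<And>\<alpha> \<beta>. \<alpha> \<in> D \<Longrightarrow> \<beta> \<in> \<Delta> \<Longrightarrow> H (T_var K \<alpha> \<beta>) = a \<alpha> \<beta>"
  shows "hilb_point B n \<Delta> N a \<longleftrightarrow> hilb_ideal K n N \<Delta> \<subseteq> a_kernel T B H"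
proof -
  interpret B: algebra K B by fact
  interpret H: ring_hom_cring T B H
    by (rule alg_hom_ring_hom_cring[OF T.algebra_axioms assms(1,2)])
  have acl: "a \<alpha> \<beta> \<in> carrier B" if "\<alpha> \<in> D" "\<beta> \<in> \<Delta>" for \<alpha> \<beta>
    using H.hom_closed[OF T_var_in[OF that]] unfolding a[OF that] .
  have Hsum: "H (T_sum K n N \<Delta> \<alpha> {#i#} \<beta>) = (\<Oplus>\<^bsub>B\<^esub>\<gamma>\<in>\<Delta>. a \<alpha> \<gamma> \<otimes>\<^bsub>B\<^esub> a (add_mset i \<gamma>) \<beta>)"
    if "\<alpha> \<in> D" "i \<in> {1..n}" "\<beta> \<in> \<Delta>" for \<alpha> i \<beta>
  proof -
    note in1 = T_var_in[OF that(1)] and in2 = T_var_in[OF \<Delta>_add_in[OF that(2)] that(3)]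
    have "H (T_sum K n N \<Delta> \<alpha> {#i#} \<beta>) = (\<Oplus>\<^bsub>B\<^esub>\<gamma>\<in>\<Delta>. H (T_var K \<alpha> \<gamma> \<otimes>\<^bsub>T\<^esub> T_var K (add_mset i \<gamma>) \<beta>))"
      unfolding T_sum_def using in1 in2 by (subst H.hom_finsum) (auto simp: o_def)
    also have "\<dots> = (\<Oplus>\<^bsub>B\<^esub>\<gamma>\<in>\<Delta>. a \<alpha> \<gamma> \<otimes>\<^bsub>B\<^esub> a (add_mset i \<gamma>) \<beta>)"
      using in1 in2 a[OF that(1)] a[OF \<Delta>_add_in[OF that(2)] that(3)]
        acl[OF that(1)] acl[OF \<Delta>_add_in[OF that(2)] that(3)]
      by (intro B.finsum_cong') auto
    finally show ?thesis .
  qed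
  have ker: "x \<ominus>\<^bsub>T\<^esub> y \<in> a_kernel T B H \<longleftrightarrow> H x = H y" if "x \<in> carrier T" "y \<in> carrier T" for x y
  proof -
    have "H (x \<ominus>\<^bsub>T\<^esub> y) = H x \<ominus>\<^bsub>B\<^esub> H y" using that by (simp add: a_minus_def)
    moreover have "H x \<ominus>\<^bsub>B\<^esub> H y = \<zero>\<^bsub>B\<^esub> \<longleftrightarrow> H x = H y" using that by simp
    ultimately show ?thesis using T.minus_closed[OF that] by (simp only: a_kernel_iff simp_thms)
  qed
  note J = ring_hom_cring_kernel_ideal[OF H.ring_hom_cring_axioms]
  have 1: "I1 K n N \<Delta> \<subseteq> a_kernel T B H \<longleftrightarrow>
      (\<forall>\<alpha> \<beta>. \<alpha> \<in> \<Delta> \<longrightarrow> \<beta> \<in> \<Delta> \<longrightarrow> a \<alpha> \<beta> = (if \<alpha> = \<beta> then \<one>\<^bsub>B\<^esub> else \<zero>\<^bsub>B\<^esub>))"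
  proof -
    have "T_var K \<alpha> \<beta> \<ominus>\<^bsub>T\<^esub> (if \<alpha> = \<beta> then \<one>\<^bsub>T\<^esub> else \<zero>\<^bsub>T\<^esub>) \<in> a_kernel T B H \<longleftrightarrow>
        a \<alpha> \<beta> = (if \<alpha> = \<beta> then \<one>\<^bsub>B\<^esub> else \<zero>\<^bsub>B\<^esub>)" if "\<alpha> \<in> \<Delta>" "\<beta> \<in> \<Delta>" for \<alpha> \<beta>
      using T_var_in[OF \<Delta>_in[OF that(1)] that(2)] a[OF \<Delta>_in[OF that(1)] that(2)]
      by (subst ker) auto
    then show ?thesis unfolding I1_subset_iff[OF J] by blast
  qed
  have 2: "I2 K n N \<Delta> \<subseteq> a_kernel T B H \<longleftrightarrow>
      (\<forall>\<alpha> i \<beta>. i \<in> {1..n} \<longrightarrow> add_mset i \<alpha> \<in> D \<longrightarrow> \<beta> \<in> \<Delta> \<longrightarrow>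
        a (add_mset i \<alpha>) \<beta> = (\<Oplus>\<^bsub>B\<^esub>\<gamma>\<in>\<Delta>. a \<alpha> \<gamma> \<otimes>\<^bsub>B\<^esub> a (add_mset i \<gamma>) \<beta>))"
  proof -
    have "T_var K (add_mset i \<alpha>) \<beta> \<ominus>\<^bsub>T\<^esub> T_sum K n N \<Delta> \<alpha> {#i#} \<beta> \<in> a_kernel T B H \<longleftrightarrow>
        a (add_mset i \<alpha>) \<beta> = (\<Oplus>\<^bsub>B\<^esub>\<gamma>\<in>\<Delta>. a \<alpha> \<gamma> \<otimes>\<^bsub>B\<^esub> a (add_mset i \<gamma>) \<beta>)"
      if "i \<in> {1..n}" "add_mset i \<alpha> \<in> D" "\<beta> \<in> \<Delta>" for \<alpha> i \<beta>
      using that Un_border_pred[OF N_standard that(2)]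
      by (subst ker) (simp_all only: T_var_in T_sum_add_in Hsum a)
    then show ?thesis unfolding I2_subset_iff[OF J] by blast
  qed
  have 3: "I3 K n N \<Delta> \<subseteq> a_kernel T B H \<longleftrightarrow>
      (\<forall>\<alpha> \<alpha>' i j \<beta>. \<alpha> \<in> border1 n N \<longrightarrow> \<alpha>' \<in> border1 n N \<longrightarrow> i \<in> {1..n} \<longrightarrow> j \<in> {1..n} \<longrightarrow>
        add_mset i \<alpha> = add_mset j \<alpha>' \<longrightarrow> add_mset i \<alpha> \<in> border2 n N \<longrightarrow> \<beta> \<in> \<Delta> \<longrightarrow>
        (\<Oplus>\<^bsub>B\<^esub>\<gamma>\<in>\<Delta>. a \<alpha> \<gamma> \<otimes>\<^bsub>B\<^esub> a (add_mset i \<gamma>) \<beta>) = (\<Oplus>\<^bsub>B\<^esub>\<gamma>\<in>\<Delta>. a \<alpha>' \<gamma> \<otimes>\<^bsub>B\<^esub> a (add_mset j \<gamma>) \<beta>))"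
  proof -
    have "T_sum K n N \<Delta> \<alpha> {#i#} \<beta> \<ominus>\<^bsub>T\<^esub> T_sum K n N \<Delta> \<alpha>' {#j#} \<beta> \<in> a_kernel T B H \<longleftrightarrow>
        (\<Oplus>\<^bsub>B\<^esub>\<gamma>\<in>\<Delta>. a \<alpha> \<gamma> \<otimes>\<^bsub>B\<^esub> a (add_mset i \<gamma>) \<beta>) = (\<Oplus>\<^bsub>B\<^esub>\<gamma>\<in>\<Delta>. a \<alpha>' \<gamma> \<otimes>\<^bsub>B\<^esub> a (add_mset j \<gamma>) \<beta>)"
      if "\<alpha> \<in> border1 n N" "\<alpha>' \<in> border1 n N" "i \<in> {1..n}" "j \<in> {1..n}" "\<beta> \<in> \<Delta>" for \<alpha> \<alpha>' i j \<beta>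
    proof -
      have "\<alpha> \<in> D" "\<alpha>' \<in> D" using that by auto
      with that show ?thesis
        by (subst ker) (simp_all only: T_sum_add_in Hsum)
    qed
    then show ?thesis unfolding I3_subset_iff[OF J] by blast
  qed
  show ?thesis
    unfolding hilb_ideal_subset_iff[OF J] 1 2 3 hilb_point_def hilb_point_axioms_def
    using B.cring_axioms \<Delta>_standard \<Delta>_finite empty_in_\<Delta> N_standard \<Delta>_subset acl by blast
qed

lemma homset_comp_proj:
  assumes "u \<in> hilb_homset K n N \<Delta> B"
  shows "(\<lambda>x. u (hilb_ideal K n N \<Delta> +>\<^bsub>T\<^esub> x)) \<in> alg_hom K T B"
  using assms unfolding hilb_homset_def hilb_alg_def
  by (intro alg_hom_comp[OF R.quot_proj_hom]) simp

lemma homset_point: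
  assumes "algebra K B" "u \<in> hilb_homset K n N \<Delta> B"
  shows "hilb_point B n \<Delta> N (\<lambda>\<alpha> \<beta>. u (T_class K n N \<Delta> \<alpha> \<beta>))"
proof -
  interpret B: algebra K B by fact
  have u: "u \<in> alg_hom K (hilb_alg K n N \<Delta>) B" using assms(2) by (simp add: hilb_homset_def)
  interpret u: ring_hom_cring "hilb_alg K n N \<Delta>" B u
    by (rule alg_hom_ring_hom_cring[OF hilb_alg_algebra assms(1) u])
  have "u (hilb_ideal K n N \<Delta> +>\<^bsub>T\<^esub> x) = \<zero>\<^bsub>B\<^esub>" "x \<in> carrier T" if "x \<in> hilb_ideal K n N \<Delta>" for x
  proof -
    show x: "x \<in> carrier T" using that R.J.Icarr by blast
    have "hilb_ideal K n N \<Delta> +>\<^bsub>T\<^esub> x = \<zero>\<^bsub>hilb_alg K n N \<Delta>\<^esub>"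
      unfolding hilb_alg_def using that by (simp only: R.quot_proj_zero_iff[OF x])
    then show "u (hilb_ideal K n N \<Delta> +>\<^bsub>T\<^esub> x) = \<zero>\<^bsub>B\<^esub>" by simp
  qed
  then have ker: "hilb_ideal K n N \<Delta> \<subseteq> a_kernel T B (\<lambda>x. u (hilb_ideal K n N \<Delta> +>\<^bsub>T\<^esub> x))"
    unfolding a_kernel_def' by blast
  have "u (hilb_ideal K n N \<Delta> +>\<^bsub>T\<^esub> T_var K \<alpha> \<beta>) = u (T_class K n N \<Delta> \<alpha> \<beta>)" for \<alpha> \<beta>
    by (simp only: T_class_def)
  from hilb_point_iff[OF assms(1) homset_comp_proj[OF assms(2)] this] ker show ?thesis by blast
qed

text \<open>The polynomial ring is evaluated at the entries of \<open>a\<close>; the equations say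
  that the evaluation kills the ideal, so it descends to the quotient.\<close>

lemma homset_of_point:
  assumes "algebra K B" "hilb_point B n \<Delta> N a"
  obtains u where "u \<in> hilb_homset K n N \<Delta> B"
    "\<And>\<alpha> \<beta>. \<alpha> \<in> D \<Longrightarrow> \<beta> \<in> \<Delta> \<Longrightarrow> u (T_class K n N \<Delta> \<alpha> \<beta>) = a \<alpha> \<beta>"
proof -
  interpret B: algebra K B by fact
  have "(\<lambda>(\<alpha>, \<beta>). a \<alpha> \<beta>) \<in> D \<times> \<Delta> \<rightarrow> carrier B"
    using hilb_point.a_closed[OF assms(2)] by (auto simp only: Pi_iff mem_Times_iff split: prod.split)
  then obtain H where H: "H \<in> ring_hom (mpoly_alg K (D \<times> \<Delta>)) B"
    "\<And>k. k \<in> carrier K \<Longrightarrow> H (k \<odot>\<^bsub>mpoly_alg K (D \<times> \<Delta>)\<^esub> \<one>\<^bsub>mpoly_alg K (D \<times> \<Delta>)\<^esub>) = k \<odot>\<^bsub>B\<^esub> \<one>\<^bsub>B\<^esub>"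
    "\<And>i. i \<in> D \<times> \<Delta> \<Longrightarrow> H (K.indexed_var i) = (case i of (\<alpha>, \<beta>) \<Rightarrow> a \<alpha> \<beta>)"
    by (rule mpoly_evalE[OF K.cring_axioms B.M_cring B.smult_one_hom]) blast
  have hom: "H \<in> alg_hom K T B"
    using alg_homI[OF T.algebra_axioms assms(1)] H(1,2) unfolding T_ring_def by blast
  have var: "H (T_var K \<alpha> \<beta>) = a \<alpha> \<beta>" if "\<alpha> \<in> D" "\<beta> \<in> \<Delta>" for \<alpha> \<beta>
    using H(3)[of "(\<alpha>, \<beta>)"] that unfolding T_var_def by simp
  have "hilb_ideal K n N \<Delta> \<subseteq> a_kernel T B H"
    using hilb_point_iff[OF assms(1) hom var] assms(2) by blast
  then have ker: "H x = \<zero>\<^bsub>B\<^esub>" if "x \<in> hilb_ideal K n N \<Delta>" for x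
    using that unfolding a_kernel_def' by blast
  obtain u where u: "u \<in> alg_hom K (quot_alg T (hilb_ideal K n N \<Delta>)) B"
    "u \<in> extensional (carrier (quot_alg T (hilb_ideal K n N \<Delta>)))"
    "\<And>x. x \<in> carrier T \<Longrightarrow> u (hilb_ideal K n N \<Delta> +>\<^bsub>T\<^esub> x) = H x"
    using R.quot_lift[OF assms(1) hom ker] by blast
  show thesis
  proof
    show "u \<in> hilb_homset K n N \<Delta> B" using u(1,2) by (simp add: hilb_homset_def hilb_alg_def)
    show "u (T_class K n N \<Delta> \<alpha> \<beta>) = a \<alpha> \<beta>" if "\<alpha> \<in> D" "\<beta> \<in> \<Delta>" for \<alpha> \<beta>
      unfolding T_class_def using u(3)[OF T_var_in[OF that]] var[OF that] by simp
  qed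
qed

text \<open>On the carrier the classes of the variables generate the algebra over K; off the carrier
  extensionality fixes both functions.\<close>

lemma homset_eqI:
  assumes "algebra K B" "u \<in> hilb_homset K n N \<Delta> B" "u' \<in> hilb_homset K n N \<Delta> B"
    and eq: "\<And>\<alpha> \<beta>. \<alpha> \<in> D \<Longrightarrow> \<beta> \<in> \<Delta> \<Longrightarrow> u (T_class K n N \<Delta> \<alpha> \<beta>) = u' (T_class K n N \<Delta> \<alpha> \<beta>)"
  shows "u = u'"
proof (rule extensionalityI[where A = "carrier (hilb_alg K n N \<Delta>)"])
  show "u \<in> extensional (carrier (hilb_alg K n N \<Delta>))" "u' \<in> extensional (carrier (hilb_alg K n N \<Delta>))"
    using assms(2,3) by (auto simp: hilb_homset_def)
  fix y assume "y \<in> carrier (hilb_alg K n N \<Delta>)"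
  then obtain x where x: "x \<in> carrier T" "y = hilb_ideal K n N \<Delta> +>\<^bsub>T\<^esub> x"
    unfolding hilb_alg_def R.quot_carrier by blast
  note h = homset_comp_proj[OF assms(2)] and h' = homset_comp_proj[OF assms(3)]
  interpret B: algebra K B by fact
  have "u (hilb_ideal K n N \<Delta> +>\<^bsub>T\<^esub> x) = u' (hilb_ideal K n N \<Delta> +>\<^bsub>T\<^esub> x)"
  proof (rule mpoly_hom_eqI[where I = "D \<times> \<Delta>" and
        \<phi> = "\<lambda>x. u (hilb_ideal K n N \<Delta> +>\<^bsub>T\<^esub> x)" and \<psi> = "\<lambda>x. u' (hilb_ideal K n N \<Delta> +>\<^bsub>T\<^esub> x)",
        OF K.cring_axioms, folded T_ring_def])
    show "(\<lambda>x. u (hilb_ideal K n N \<Delta> +>\<^bsub>T\<^esub> x)) \<in> ring_hom T B" by (rule alg_hom_ring_hom[OF h])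
    show "(\<lambda>x. u' (hilb_ideal K n N \<Delta> +>\<^bsub>T\<^esub> x)) \<in> ring_hom T B" by (rule alg_hom_ring_hom[OF h'])
    show "u (hilb_ideal K n N \<Delta> +>\<^bsub>T\<^esub> (k \<odot>\<^bsub>T\<^esub> \<one>\<^bsub>T\<^esub>)) = u' (hilb_ideal K n N \<Delta> +>\<^bsub>T\<^esub> (k \<odot>\<^bsub>T\<^esub> \<one>\<^bsub>T\<^esub>))"
      if "k \<in> carrier K" for k
      using that alg_hom_smult[OF h, of k "\<one>\<^bsub>T\<^esub>"] alg_hom_smult[OF h', of k "\<one>\<^bsub>T\<^esub>"]
        ring_hom_one[OF alg_hom_ring_hom[OF h]] ring_hom_one[OF alg_hom_ring_hom[OF h']]
      by simp
    show "u (hilb_ideal K n N \<Delta> +>\<^bsub>T\<^esub> K.indexed_var i) = u' (hilb_ideal K n N \<Delta> +>\<^bsub>T\<^esub> K.indexed_var i)"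
      if "i \<in> D \<times> \<Delta>" for i
      using that eq unfolding T_class_def T_var_def by auto
  qed (rule x)
  then show "u y = u' y" unfolding x(2) .
qed

end

section \<open>Base change\<close>

text \<open>Stated for an arbitrary surjection in place of a projection to cosets, since the Q of a
  \<phi> is an abstract algebra. A value is computed at any preimage, and the kernel condition makes
  the choice irrelevant.\<close>

lemma ring_hom_factor:
  assumes "ring_hom_cring P Q \<phi>" "ring_hom_cring P A E" "\<phi> ` carrier P = carrier Q"
    and ker: "\<And>p. p \<in> carrier P \<Longrightarrow> \<phi> p = \<zero>\<^bsub>Q\<^esub> \<Longrightarrow> E p = \<zero>\<^bsub>A\<^esub>"
  obtains \<psi> where "\<psi> \<in> ring_hom Q A" "\<And>p. p \<in> carrier P \<Longrightarrow> \<psi> (\<phi> p) = E p"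
proof -
  interpret f: ring_hom_cring P Q \<phi> by fact
  interpret E: ring_hom_cring P A E by fact
  have eq: "E p = E q" if "p \<in> carrier P" "q \<in> carrier P" "\<phi> p = \<phi> q" for p q
  proof -
    have "\<phi> (p \<ominus>\<^bsub>P\<^esub> q) = \<phi> p \<ominus>\<^bsub>Q\<^esub> \<phi> q" "E (p \<ominus>\<^bsub>P\<^esub> q) = E p \<ominus>\<^bsub>A\<^esub> E q"
      using that(1,2) by (simp_all add: a_minus_def)
    moreover have "\<phi> p \<ominus>\<^bsub>Q\<^esub> \<phi> q = \<zero>\<^bsub>Q\<^esub>" using that by simp
    ultimately have "E p \<ominus>\<^bsub>A\<^esub> E q = \<zero>\<^bsub>A\<^esub>"
      using ker[OF f.R.minus_closed[OF that(1,2)]] by (simp only:)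
    then show ?thesis using that by simp
  qed
  define \<psi> where "\<psi> q = E (SOME p. p \<in> carrier P \<and> \<phi> p = q)" for q
  have \<psi>: "\<psi> (\<phi> p) = E p" if p: "p \<in> carrier P" for p
  proof -
    have "(SOME p'. p' \<in> carrier P \<and> \<phi> p' = \<phi> p) \<in> carrier P \<and> \<phi> (SOME p'. p' \<in> carrier P \<and> \<phi> p' = \<phi> p) = \<phi> p"
      using p by (intro someI[of "\<lambda>p'. p' \<in> carrier P \<and> \<phi> p' = \<phi> p"]) simp
    then show ?thesis unfolding \<psi>_def by (intro eq p) auto
  qed
  have "\<psi> \<in> ring_hom Q A"
  proof (rule ring_hom_memI)
    fix x y assume "x \<in> carrier Q" "y \<in> carrier Q"
    then obtain p q where pq: "p \<in> carrier P" "x = \<phi> p" "q \<in> carrier P" "y = \<phi> q"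
      unfolding assms(3)[symmetric] by blast
    show "\<psi> x \<in> carrier A" using pq by (simp add: \<psi>)
    show "\<psi> (x \<otimes>\<^bsub>Q\<^esub> y) = \<psi> x \<otimes>\<^bsub>A\<^esub> \<psi> y"
      using pq \<psi>[of "p \<otimes>\<^bsub>P\<^esub> q"] by (simp add: \<psi>)
    show "\<psi> (x \<oplus>\<^bsub>Q\<^esub> y) = \<psi> x \<oplus>\<^bsub>A\<^esub> \<psi> y"
      using pq \<psi>[of "p \<oplus>\<^bsub>P\<^esub> q"] by (simp add: \<psi>)
  next
    show "\<psi> \<one>\<^bsub>Q\<^esub> = \<one>\<^bsub>A\<^esub>" using \<psi>[of "\<one>\<^bsub>P\<^esub>"] by simp
  qed
  with \<psi> show thesis by (intro that)
qed

locale tensor_product = C: cring C + Q: algebra B Q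
  for B :: "('b, 'm) ring_scheme" and C :: "('c, 'l) ring_scheme" and Q :: "('b, 'q) module" +
  fixes f :: "'b \<Rightarrow> 'c"
  assumes f_hom: "f \<in> ring_hom B C"
begin

abbreviation "S \<equiv> mpoly_alg C (carrier Q)"
abbreviation "TI \<equiv> tensor_ideal B C f Q"
abbreviation "TA \<equiv> tensor_alg B C f Q"
abbreviation "t \<equiv> one_tensor B C f Q"

sublocale S: algebra C S
  by (rule C.mpoly_algebra)

lemma var_in: "q \<in> carrier Q \<Longrightarrow> C.indexed_var q \<in> carrier S"
  by (rule C.mpoly_var_in)

lemma f_closed: "b \<in> carrier B \<Longrightarrow> f b \<in> carrier C"
  by (rule ring_hom_closed[OF f_hom])

text \<open>Used with two ideals: the tensor ideal itself, which shows that the relations hold in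
  the tensor product, and the kernel of an evaluation, which lets it descend.\<close>

lemma tensor_rels_subset_iff:
  "tensor_rels B C f Q \<subseteq> J \<longleftrightarrow>
    (\<forall>q\<in>carrier Q. \<forall>r\<in>carrier Q.
      C.indexed_var (q \<oplus>\<^bsub>Q\<^esub> r) \<ominus>\<^bsub>S\<^esub> (C.indexed_var q \<oplus>\<^bsub>S\<^esub> C.indexed_var r) \<in> J) \<and>
    (\<forall>q\<in>carrier Q. \<forall>r\<in>carrier Q.
      C.indexed_var (q \<otimes>\<^bsub>Q\<^esub> r) \<ominus>\<^bsub>S\<^esub> (C.indexed_var q \<otimes>\<^bsub>S\<^esub> C.indexed_var r) \<in> J) \<and>
    C.indexed_var \<one>\<^bsub>Q\<^esub> \<ominus>\<^bsub>S\<^esub> \<one>\<^bsub>S\<^esub> \<in> J \<and>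
    (\<forall>b\<in>carrier B. \<forall>q\<in>carrier Q.
      C.indexed_var (b \<odot>\<^bsub>Q\<^esub> q) \<ominus>\<^bsub>S\<^esub> (f b \<odot>\<^bsub>S\<^esub> C.indexed_var q) \<in> J)"
  unfolding tensor_rels_def Let_def by blast

lemma tensor_rels_in: "tensor_rels B C f Q \<subseteq> carrier S"
  unfolding tensor_rels_subset_iff by (auto simp: var_in f_closed)

lemma tensor_ideal_ideal: "ideal TI S"
  unfolding tensor_ideal_def by (rule S.genideal_ideal[OF tensor_rels_in])

lemma tensor_ideal_subset_iff: "ideal J S \<Longrightarrow> TI \<subseteq> J \<longleftrightarrow> tensor_rels B C f Q \<subseteq> J"
  unfolding tensor_ideal_def by (rule S.Idl_subset_ideal[OF _ tensor_rels_in])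

sublocale R: quotient_algebra C S TI
  by (intro quotient_algebra.intro S.algebra_axioms tensor_ideal_ideal)

lemma tensor_algebra: "algebra C TA"
  unfolding tensor_alg_def by (rule R.quot_algebra)

lemma tensor_proj_hom: "(\<lambda>x. TI +>\<^bsub>S\<^esub> x) \<in> alg_hom C S TA"
  unfolding tensor_alg_def by (rule R.quot_proj_hom)

lemma tensor_eqI:
  "x \<in> carrier S \<Longrightarrow> y \<in> carrier S \<Longrightarrow> x \<ominus>\<^bsub>S\<^esub> y \<in> TI \<Longrightarrow> TI +>\<^bsub>S\<^esub> x = TI +>\<^bsub>S\<^esub> y"
  using S.quotient_eq_iff_same_a_r_cos[OF tensor_ideal_ideal] by blast

lemma one_tensor_ring_hom: "t \<in> ring_hom Q TA"
  and one_tensor_smult: "b \<in> carrier B \<Longrightarrow> q \<in> carrier Q \<Longrightarrow> t (b \<odot>\<^bsub>Q\<^esub> q) = f b \<odot>\<^bsub>TA\<^esub> t q"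
proof -
  note \<pi> = alg_hom_ring_hom[OF tensor_proj_hom]
  \<comment> \<open>The tensor ideal is contained in itself, hence contains each of its generating
    relations.\<close>
  note rels = iffD1[OF tensor_rels_subset_iff, OF iffD1[OF tensor_ideal_subset_iff[OF tensor_ideal_ideal] order_refl]]
  show "t \<in> ring_hom Q TA"
  proof (rule ring_hom_memI)
    fix q r assume q: "q \<in> carrier Q" and r: "r \<in> carrier Q"
    show "t q \<in> carrier TA" unfolding one_tensor_def by (rule ring_hom_closed[OF \<pi> var_in[OF q]])
    show "t (q \<otimes>\<^bsub>Q\<^esub> r) = t q \<otimes>\<^bsub>TA\<^esub> t r"
      unfolding one_tensor_def ring_hom_mult[OF \<pi> var_in[OF q] var_in[OF r], symmetric]
      using rels q r by (intro tensor_eqI var_in S.m_closed) auto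
    show "t (q \<oplus>\<^bsub>Q\<^esub> r) = t q \<oplus>\<^bsub>TA\<^esub> t r"
      unfolding one_tensor_def ring_hom_add[OF \<pi> var_in[OF q] var_in[OF r], symmetric]
      using rels q r by (intro tensor_eqI var_in S.a_closed) auto
  next
    show "t \<one>\<^bsub>Q\<^esub> = \<one>\<^bsub>TA\<^esub>"
      unfolding one_tensor_def ring_hom_one[OF \<pi>, symmetric]
      using rels by (intro tensor_eqI var_in) auto
  qed
  show "t (b \<odot>\<^bsub>Q\<^esub> q) = f b \<odot>\<^bsub>TA\<^esub> t q" if b: "b \<in> carrier B" and q: "q \<in> carrier Q" for b q
    unfolding one_tensor_def alg_hom_smult[OF tensor_proj_hom f_closed[OF b] var_in[OF q], symmetric]
    using rels b q f_closed[OF b] by (intro tensor_eqI var_in S.smult_closed) auto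
qed

text \<open>The elements 1 \<otimes> q generate the tensor product as a C-algebra; polynomial
  induction passes along the projection.\<close>

lemma tensor_induct [consumes 1, case_names const add mult]:
  assumes "x \<in> carrier TA"
    and "\<And>c. c \<in> carrier C \<Longrightarrow> Pr (c \<odot>\<^bsub>TA\<^esub> \<one>\<^bsub>TA\<^esub>)"
    and "\<And>x y. x \<in> carrier TA \<Longrightarrow> y \<in> carrier TA \<Longrightarrow> Pr x \<Longrightarrow> Pr y \<Longrightarrow> Pr (x \<oplus>\<^bsub>TA\<^esub> y)"
    and "\<And>q x. q \<in> carrier Q \<Longrightarrow> x \<in> carrier TA \<Longrightarrow> Pr x \<Longrightarrow> Pr (t q \<otimes>\<^bsub>TA\<^esub> x)"
  shows "Pr x"
proof -
  note \<pi> = alg_hom_ring_hom[OF tensor_proj_hom]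
  from assms(1) obtain p where p: "p \<in> carrier S" "x = TI +>\<^bsub>S\<^esub> p"
    unfolding tensor_alg_def R.quot_carrier by blast
  from p(1) have "Pr (TI +>\<^bsub>S\<^esub> p)"
  proof (induction rule: C.mpoly_induct)
    case (const k)
    show ?case
      unfolding alg_hom_smult[OF tensor_proj_hom const S.one_closed] ring_hom_one[OF \<pi>]
      by (rule assms(2)[OF const])
  next
    case (add p q)
    show ?case unfolding ring_hom_add[OF \<pi> add.hyps]
      by (intro assms(3) ring_hom_closed[OF \<pi>] add)
  next
    case (var p q)
    show ?case unfolding ring_hom_mult[OF \<pi> var_in[OF var(2)] var(1)] one_tensor_def[symmetric]
      by (intro assms(4) ring_hom_closed[OF \<pi>] var)
  qed
  with p show ?thesis by simp
qed

text \<open>The variable of q is evaluated at \<psi> q. The defining relations go to zero because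
  \<psi> is a ring homomorphism compatible with scalars along f.\<close>

lemma tensor_lift:
  assumes A: "algebra C A" and \<psi>: "\<psi> \<in> ring_hom Q A"
    and smult: "\<And>b q. b \<in> carrier B \<Longrightarrow> q \<in> carrier Q \<Longrightarrow> \<psi> (b \<odot>\<^bsub>Q\<^esub> q) = f b \<odot>\<^bsub>A\<^esub> \<psi> q"
  obtains u where "u \<in> alg_hom C TA A" "\<And>q. q \<in> carrier Q \<Longrightarrow> u (t q) = \<psi> q"
proof -
  interpret A: algebra C A by fact
  have "\<psi> \<in> carrier Q \<rightarrow> carrier A" using ring_hom_closed[OF \<psi>] by blast
  then obtain \<chi> where \<chi>: "\<chi> \<in> ring_hom S A"
    "\<And>k. k \<in> carrier C \<Longrightarrow> \<chi> (k \<odot>\<^bsub>S\<^esub> \<one>\<^bsub>S\<^esub>) = k \<odot>\<^bsub>A\<^esub> \<one>\<^bsub>A\<^esub>"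
    "\<And>q. q \<in> carrier Q \<Longrightarrow> \<chi> (C.indexed_var q) = \<psi> q"
    by (rule mpoly_evalE[OF C.cring_axioms A.M_cring A.smult_one_hom]) blast
  have hom: "\<chi> \<in> alg_hom C S A" by (rule alg_homI[OF S.algebra_axioms A \<chi>(1)]) (rule \<chi>(2))
  interpret h: ring_hom_cring S A \<chi>
    by (rule alg_hom_ring_hom_cring[OF S.algebra_axioms A hom])
  have ker: "x \<ominus>\<^bsub>S\<^esub> y \<in> a_kernel S A \<chi>" if "x \<in> carrier S" "y \<in> carrier S" "\<chi> x = \<chi> y" for x y
  proof -
    have "\<chi> (x \<ominus>\<^bsub>S\<^esub> y) = \<chi> x \<ominus>\<^bsub>A\<^esub> \<chi> y" using that(1,2) by (simp add: a_minus_def)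
    moreover have "\<chi> x \<ominus>\<^bsub>A\<^esub> \<chi> y = \<zero>\<^bsub>A\<^esub>" using that by simp
    ultimately show ?thesis using S.minus_closed[OF that(1,2)] by (simp only: a_kernel_iff simp_thms)
  qed
  have "TI \<subseteq> a_kernel S A \<chi>"
    unfolding tensor_ideal_subset_iff[OF ring_hom_cring_kernel_ideal[OF h.ring_hom_cring_axioms]]
      tensor_rels_subset_iff
  proof (intro conjI ballI ker var_in S.a_closed S.m_closed S.smult_closed S.one_closed
      Q.a_closed Q.m_closed Q.smult_closed Q.one_closed f_closed)
    fix q r assume q: "q \<in> carrier Q" and r: "r \<in> carrier Q"
    show "\<chi> (C.indexed_var (q \<oplus>\<^bsub>Q\<^esub> r)) = \<chi> (C.indexed_var q \<oplus>\<^bsub>S\<^esub> C.indexed_var r)"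
      using q r by (simp add: h.hom_add var_in \<chi>(3) ring_hom_add[OF \<psi>])
    show "\<chi> (C.indexed_var (q \<otimes>\<^bsub>Q\<^esub> r)) = \<chi> (C.indexed_var q \<otimes>\<^bsub>S\<^esub> C.indexed_var r)"
      using q r by (simp add: h.hom_mult var_in \<chi>(3) ring_hom_mult[OF \<psi>])
  next
    show "\<chi> (C.indexed_var \<one>\<^bsub>Q\<^esub>) = \<chi> \<one>\<^bsub>S\<^esub>"
      by (simp add: \<chi>(3) ring_hom_one[OF \<psi>])
  next
    fix b q assume b: "b \<in> carrier B" and q: "q \<in> carrier Q"
    show "\<chi> (C.indexed_var (b \<odot>\<^bsub>Q\<^esub> q)) = \<chi> (f b \<odot>\<^bsub>S\<^esub> C.indexed_var q)"
      using b q by (simp add: alg_hom_smult[OF hom] f_closed var_in \<chi>(3) smult)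
  qed
  then have zero: "\<chi> x = \<zero>\<^bsub>A\<^esub>" if "x \<in> TI" for x using that unfolding a_kernel_def' by blast
  obtain u where u: "u \<in> alg_hom C (quot_alg S TI) A" "\<And>x. x \<in> carrier S \<Longrightarrow> u (TI +>\<^bsub>S\<^esub> x) = \<chi> x"
    using R.quot_lift[OF A hom zero] by blast
  show thesis
  proof
    show "u \<in> alg_hom C TA A" using u(1) by (simp only: tensor_alg_def)
    show "u (t q) = \<psi> q" if "q \<in> carrier Q" for q
      unfolding one_tensor_def using u(2)[OF var_in[OF that]] \<chi>(3)[OF that] by simp
  qed
qed

end

text \<open>An element of the kernel of \<phi> has zero coordinates, so it is killed by every
  evaluation that obeys the relations of the same point. Such evaluations therefore descend along
  \<phi>.\<close>

lemma (in hilb_point) eval_kernel: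
  assumes "hilb_hom n \<Delta> B Q \<phi>"
    and "\<And>\<alpha>. \<alpha> \<in> N \<union> border1 n N \<Longrightarrow>
      \<phi> (mpoly_monom B \<alpha>) = (\<Oplus>\<^bsub>Q\<^esub>\<beta>\<in>\<Delta>. a \<alpha> \<beta> \<odot>\<^bsub>Q\<^esub> \<phi> (mpoly_monom B \<beta>))"
    and E: "mpoly_eval B A {1..n} h g"
    and g: "\<And>\<alpha>. \<alpha> \<in> N \<union> border1 n N \<Longrightarrow> g \<alpha> = (\<Oplus>\<^bsub>A\<^esub>\<beta>\<in>\<Delta>. h (a \<alpha> \<beta>) \<otimes>\<^bsub>A\<^esub> g \<beta>)"
    and "p \<in> carrier P" "\<phi> p = \<zero>\<^bsub>Q\<^esub>"
  shows "mpoly_lin B A h g p = \<zero>\<^bsub>A\<^esub>"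
proof -
  interpret E: mpoly_eval B A "{1..n}" h g by fact
  have "p \<in> rel_ideal"
    using hilb_hom_kernel[OF assms(1,2)] assms(5,6) unfolding a_kernel_def' by blast
  then have "coord p \<beta> = \<zero>\<^bsub>B\<^esub>" if "\<beta> \<in> \<Delta>" for \<beta> using that unfolding rel_ideal_def by blast
  then have "(\<Oplus>\<^bsub>A\<^esub>\<beta>\<in>\<Delta>. h (coord p \<beta>) \<otimes>\<^bsub>A\<^esub> g \<beta>) = \<zero>\<^bsub>A\<^esub>"
    using \<Delta>_expts by (intro E.A.add.finprod_one_eqI) (simp add: E.g_closed)
  then show ?thesis using eval_coord[OF E g assms(5)] by simp
qed

section \<open>Base change of a quotient with basis \<Delta>\<close>

context standard_pair
begin

text \<open>Applying 1 \<otimes> _ to the relations of \<phi> gives those of the base change with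
  the entries f(a), from which spanning follows by \<open>eval_coord\<close>. The matrix
  \<open>a'\<close> is asked to agree with f(a) on \<open>D\<close> and \<Delta> only, as it will be
  read off from an extensional composite.\<close>

lemma hilb_hom_base_change:
  fixes C :: "('c, 'l) ring_scheme"
  assumes hh: "hilb_hom n \<Delta> B Q \<phi>" and f: "f \<in> ring_hom B C" and "cring C"
    and ptB: "hilb_point B n \<Delta> N a" and ptC: "hilb_point C n \<Delta> N a'"
    and a': "\<And>\<alpha> \<beta>. \<alpha> \<in> D \<Longrightarrow> \<beta> \<in> \<Delta> \<Longrightarrow> a' \<alpha> \<beta> = f (a \<alpha> \<beta>)"
    and \<phi>: "\<And>\<alpha>. \<alpha> \<in> D \<Longrightarrow> \<phi> (mpoly_monom B \<alpha>) = (\<Oplus>\<^bsub>Q\<^esub>\<beta>\<in>\<Delta>. a \<alpha> \<beta> \<odot>\<^bsub>Q\<^esub> \<phi> (mpoly_monom B \<beta>))"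
  defines "TA \<equiv> tensor_alg B C f Q" and "bc \<equiv> base_change_hom B C f Q \<phi>"
  shows "hilb_hom n \<Delta> C TA bc"
    and "\<And>\<alpha>. \<alpha> \<in> D \<Longrightarrow> bc (mpoly_monom C \<alpha>) = (\<Oplus>\<^bsub>TA\<^esub>\<beta>\<in>\<Delta>. a' \<alpha> \<beta> \<odot>\<^bsub>TA\<^esub> bc (mpoly_monom C \<beta>))"
proof -
  note hhE = hilb_homE[OF hh]
  interpret B: cring B by (rule hhE(2))
  interpret C: cring C by fact
  interpret Q: algebra B Q by (rule hhE(1))
  interpret t: tensor_product B C Q f
    by (intro tensor_product.intro tensor_product_axioms.intro C.cring_axioms Q.algebra_axioms f)
  interpret T: algebra C TA unfolding TA_def by (rule t.tensor_algebra)
  interpret P: algebra C "polyring n C" by (rule C.mpoly_algebra)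
  interpret PB: algebra B "polyring n B" by (rule B.mpoly_algebra)
  interpret \<phi>: ring_hom_cring "polyring n B" Q \<phi> by (rule hhE(3))
  interpret th: ring_hom_cring Q TA "t.t"
    unfolding TA_def
    by (intro ring_hom_cring.intro ring_hom_cring_axioms.intro Q.M_cring algebra.M_cring[OF t.tensor_algebra]
        t.one_tensor_ring_hom)
  define g where "g \<alpha> = t.t (\<phi> (mpoly_monom B \<alpha>))" for \<alpha>
  have g_cl: "g \<alpha> \<in> carrier TA" if "set_mset \<alpha> \<subseteq> {1..n}" for \<alpha>
    unfolding g_def using that by (intro th.hom_closed \<phi>.hom_closed B.mpoly_monom_in)
  have ev: "mpoly_eval C TA {1..n} (\<lambda>c. c \<odot>\<^bsub>TA\<^esub> \<one>\<^bsub>TA\<^esub>) g"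
  proof (intro mpoly_eval.intro mpoly_linear.intro mpoly_linear_axioms.intro mpoly_eval_axioms.intro
      C.cring_axioms T.M_cring T.smult_one_hom g_cl)
    show "g {#} = \<one>\<^bsub>TA\<^esub>"
      unfolding g_def by (simp add: B.mpoly_monom_empty flip: mpoly_simps(3)[of B "{1..n}"])
    fix i \<alpha> assume "i \<in> {1..n}" "set_mset \<alpha> \<subseteq> {1..n}"
    then show "g (add_mset i \<alpha>) = g {#i#} \<otimes>\<^bsub>TA\<^esub> g \<alpha>"
      unfolding g_def
      by (simp only: B.mpoly_monom_add_mset_eq B.mpoly_monom_single \<phi>.hom_mult th.hom_mult
          B.mpoly_var_in B.mpoly_monom_in \<phi>.hom_closed)
  qed
  interpret ev: mpoly_eval C TA "{1..n}" "\<lambda>c. c \<odot>\<^bsub>TA\<^esub> \<one>\<^bsub>TA\<^esub>" g by (rule ev)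
  \<comment> \<open>The definition scales by p \<alpha>, while \<open>lin\<close> multiplies by p
    \<alpha> times 1; both agree once p has its coefficients in C.\<close>
  have bc_eq: "bc p = ev.lin p" if p: "p \<in> carrier (polyring n C)" for p
    unfolding bc_def base_change_hom_def mpoly_lin_def TA_def[symmetric] g_def[symmetric]
    using ev.coeff[OF p] ev.g_supp[OF p]
    by (intro T.finsum_cong') (auto simp: T.smult_one_mult)
  have bc_hom: "bc \<in> alg_hom C (polyring n C) TA"
  proof (rule alg_hom_cong[OF P.algebra_axioms _ bc_eq])
    show "ev.lin \<in> alg_hom C (polyring n C) TA"
      by (rule alg_homI[OF P.algebra_axioms T.algebra_axioms ev.eval_ring_hom])
        (simp add: ev.lin_smult ev.lin_one ev.g_empty)
  qed
  interpret bc: ring_hom_cring "polyring n C" TA bc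
    by (rule alg_hom_ring_hom_cring[OF P.algebra_axioms T.algebra_axioms bc_hom])
  have bc_monom: "bc (mpoly_monom C \<alpha>) = g \<alpha>" if "set_mset \<alpha> \<subseteq> {1..n}" for \<alpha>
    using that by (simp add: bc_eq C.mpoly_monom_in ev.lin_monom)
  have aB: "a \<alpha> \<beta> \<in> carrier B" if "\<alpha> \<in> D" "\<beta> \<in> \<Delta>" for \<alpha> \<beta>
    by (rule hilb_point.a_closed[OF ptB that])
  have a'C: "a' \<alpha> \<beta> \<in> carrier C" if "\<alpha> \<in> D" "\<beta> \<in> \<Delta>" for \<alpha> \<beta>
    by (rule hilb_point.a_closed[OF ptC that])
  have \<phi>_cl: "\<phi> (mpoly_monom B \<beta>) \<in> carrier Q" if "\<beta> \<in> \<Delta>" for \<beta>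
    using that by (intro \<phi>.hom_closed B.mpoly_monom_in \<Delta>_expts)
  have g_rel: "g \<alpha> = (\<Oplus>\<^bsub>TA\<^esub>\<beta>\<in>\<Delta>. a' \<alpha> \<beta> \<odot>\<^bsub>TA\<^esub> g \<beta>)" if \<alpha>: "\<alpha> \<in> D" for \<alpha>
  proof -
    have "g \<alpha> = (\<Oplus>\<^bsub>TA\<^esub>\<beta>\<in>\<Delta>. t.t (a \<alpha> \<beta> \<odot>\<^bsub>Q\<^esub> \<phi> (mpoly_monom B \<beta>)))"
      unfolding g_def \<phi>[OF \<alpha>] using aB[OF \<alpha>] \<phi>_cl by (subst th.hom_finsum) (auto simp: o_def)
    also have "\<dots> = (\<Oplus>\<^bsub>TA\<^esub>\<beta>\<in>\<Delta>. a' \<alpha> \<beta> \<odot>\<^bsub>TA\<^esub> g \<beta>)"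
      using aB[OF \<alpha>] a'C[OF \<alpha>] \<phi>_cl g_cl[OF \<Delta>_expts] unfolding g_def
      by (intro T.finsum_cong') (auto simp: t.one_tensor_smult[folded TA_def] a'[OF \<alpha>])
    finally show ?thesis .
  qed
  show rel: "bc (mpoly_monom C \<alpha>) = (\<Oplus>\<^bsub>TA\<^esub>\<beta>\<in>\<Delta>. a' \<alpha> \<beta> \<odot>\<^bsub>TA\<^esub> bc (mpoly_monom C \<beta>))" if \<alpha>: "\<alpha> \<in> D" for \<alpha>
  proof -
    have "bc (mpoly_monom C \<alpha>) = (\<Oplus>\<^bsub>TA\<^esub>\<beta>\<in>\<Delta>. a' \<alpha> \<beta> \<odot>\<^bsub>TA\<^esub> g \<beta>)"
      using bc_monom[OF D_expts[OF \<alpha>]] g_rel[OF \<alpha>] by (rule trans)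
    also have "\<dots> = (\<Oplus>\<^bsub>TA\<^esub>\<beta>\<in>\<Delta>. a' \<alpha> \<beta> \<odot>\<^bsub>TA\<^esub> bc (mpoly_monom C \<beta>))"
      using a'C[OF \<alpha>] bc_monom[OF \<Delta>_expts] bc.hom_closed[OF C.mpoly_monom_in[OF \<Delta>_expts]]
      by (intro T.finsum_cong') auto
    finally show ?thesis .
  qed
  \<comment> \<open>The same relation in the shape of \<open>eval_coord\<close>, with the structure
    map as coefficient map.\<close>
  have g_rel': "g \<alpha> = (\<Oplus>\<^bsub>TA\<^esub>\<beta>\<in>\<Delta>. (a' \<alpha> \<beta> \<odot>\<^bsub>TA\<^esub> \<one>\<^bsub>TA\<^esub>) \<otimes>\<^bsub>TA\<^esub> g \<beta>)" if \<alpha>: "\<alpha> \<in> D" for \<alpha>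
    unfolding g_rel[OF \<alpha>] using a'C[OF \<alpha>] g_cl[OF \<Delta>_expts]
    by (intro T.finsum_cong') (auto simp: T.smult_one_mult)
  \<comment> \<open>As \<phi> is surjective, this puts every generator 1 \<otimes> q into the image
    of \<open>bc\<close>; surjectivity then follows by \<open>tensor_induct\<close>.\<close>
  have t_image: "t.t (\<phi> p) \<in> bc ` carrier (polyring n C)" if "p \<in> carrier (polyring n B)" for p
    using that
  proof (induction rule: B.mpoly_induct)
    case (const b)
    have "t.t (\<phi> (b \<odot>\<^bsub>polyring n B\<^esub> \<one>\<^bsub>polyring n B\<^esub>)) = f b \<odot>\<^bsub>TA\<^esub> \<one>\<^bsub>TA\<^esub>"
      using t.one_tensor_smult[OF const Q.one_closed] const
      by (simp add: alg_hom_smult[OF hhE(4)] TA_def[symmetric])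
    also have "\<dots> = bc (f b \<odot>\<^bsub>polyring n C\<^esub> \<one>\<^bsub>polyring n C\<^esub>)"
      using t.f_closed[OF const] by (simp add: alg_hom_smult[OF bc_hom])
    finally show ?case using t.f_closed[OF const] by (intro image_eqI) auto
  next
    case (add p q)
    then obtain p' q' where "p' \<in> carrier (polyring n C)" "t.t (\<phi> p) = bc p'"
      "q' \<in> carrier (polyring n C)" "t.t (\<phi> q) = bc q'" by blast
    with add.hyps show ?case by (intro image_eqI[of _ _ "p' \<oplus>\<^bsub>polyring n C\<^esub> q'"]) auto
  next
    case (var p i)
    then obtain p' where p': "p' \<in> carrier (polyring n C)" "t.t (\<phi> p) = bc p'" by blast
    have "t.t (\<phi> (B.indexed_var i)) = bc (C.indexed_var i)"
      using bc_monom[of "{#i#}"] var(2) by (simp add: g_def B.mpoly_monom_single C.mpoly_monom_single)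
    with var(1,2) p' have "t.t (\<phi> (B.indexed_var i \<otimes>\<^bsub>polyring n B\<^esub> p)) =
        bc (C.indexed_var i \<otimes>\<^bsub>polyring n C\<^esub> p')"
      by (simp only: \<phi>.hom_mult th.hom_mult bc.hom_mult B.mpoly_var_in C.mpoly_var_in \<phi>.hom_closed)
    then show ?case using P.m_closed[OF C.mpoly_var_in[OF var(2)] p'(1)] by (rule image_eqI)
  qed
  have surj: "x \<in> bc ` carrier (polyring n C)" if "x \<in> carrier TA" for x
    using that[unfolded TA_def]
  proof (induction rule: t.tensor_induct)
    case (const c)
    then have "c \<odot>\<^bsub>TA\<^esub> \<one>\<^bsub>TA\<^esub> = bc (c \<odot>\<^bsub>polyring n C\<^esub> \<one>\<^bsub>polyring n C\<^esub>)"
      by (simp add: alg_hom_smult[OF bc_hom])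
    with const show ?case unfolding TA_def[symmetric] by (intro image_eqI) auto
  next
    case (add x y)
    then obtain p q where pq: "p \<in> carrier (polyring n C)" "q \<in> carrier (polyring n C)" "x = bc p" "y = bc q"
      by blast
    then show ?case unfolding TA_def[symmetric]
      by (intro image_eqI[of _ _ "p \<oplus>\<^bsub>polyring n C\<^esub> q"]) auto
  next
    case (mult q x)
    then obtain p' where p': "p' \<in> carrier (polyring n B)" "q = \<phi> p'" unfolding hhE(5)[symmetric] by blast
    obtain r where r: "r \<in> carrier (polyring n C)" "t.t q = bc r" using t_image[OF p'(1)] p'(2) by blast
    obtain s where s: "s \<in> carrier (polyring n C)" "x = bc s" using mult by blast
    show ?case unfolding TA_def[symmetric] r(2) s(2)
      using r(1) s(1) by (intro image_eqI[of _ _ "r \<otimes>\<^bsub>polyring n C\<^esub> s"]) auto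
  qed
  \<comment> \<open>The quotient of C[x] attached to \<open>a'\<close>, in which \<Delta> is already
    known to be a basis; it is the target that detects independence.\<close>
  obtain Q' :: "('c, (nat multiset \<Rightarrow> 'c) set) module" and \<phi>' where hh': "hilb_hom n \<Delta> C Q' \<phi>'"
    and \<phi>': "\<And>\<alpha>. \<alpha> \<in> D \<Longrightarrow> \<phi>' (mpoly_monom C \<alpha>) = (\<Oplus>\<^bsub>Q'\<^esub>\<beta>\<in>\<Delta>. a' \<alpha> \<beta> \<odot>\<^bsub>Q'\<^esub> \<phi>' (mpoly_monom C \<beta>))"
    using hilb_point.quot_hilb_hom[OF ptC] hilb_point.quot_proj_monom[OF ptC] by blast
  note hhE' = hilb_homE[OF hh']
  interpret Q': algebra C Q' by (rule hhE'(1))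
  interpret \<phi>': ring_hom_cring "polyring n C" Q' \<phi>' by (rule hhE'(3))
  have \<phi>'_cl: "\<phi>' (mpoly_monom C \<alpha>) \<in> carrier Q'" if "set_mset \<alpha> \<subseteq> {1..n}" for \<alpha>
    using that by (intro \<phi>'.hom_closed C.mpoly_monom_in)
  have h_hom: "(\<lambda>b. f b \<odot>\<^bsub>Q'\<^esub> \<one>\<^bsub>Q'\<^esub>) \<in> ring_hom B Q'"
    using ring_hom_trans[OF f Q'.smult_one_hom] by (simp only: o_def)
  \<comment> \<open>This evaluation is the composite of the coefficient map B[x] -> C[x] with
    \<phi>'.\<close>
  have ev': "mpoly_eval B Q' {1..n} (\<lambda>b. f b \<odot>\<^bsub>Q'\<^esub> \<one>\<^bsub>Q'\<^esub>) (\<lambda>\<alpha>. \<phi>' (mpoly_monom C \<alpha>))"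
  proof (intro mpoly_eval.intro mpoly_linear.intro mpoly_linear_axioms.intro mpoly_eval_axioms.intro
      B.cring_axioms Q'.M_cring h_hom \<phi>'_cl)
    show "\<phi>' (mpoly_monom C {#}) = \<one>\<^bsub>Q'\<^esub>"
      by (simp add: C.mpoly_monom_empty flip: mpoly_simps(3)[of C "{1..n}"])
    fix i \<alpha> assume "i \<in> {1..n}" "set_mset \<alpha> \<subseteq> {1..n}"
    then show "\<phi>' (mpoly_monom C (add_mset i \<alpha>)) = \<phi>' (mpoly_monom C {#i#}) \<otimes>\<^bsub>Q'\<^esub> \<phi>' (mpoly_monom C \<alpha>)"
      by (simp only: C.mpoly_monom_add_mset_eq C.mpoly_monom_single \<phi>'.hom_mult
          C.mpoly_var_in C.mpoly_monom_in)
  qed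
  interpret ev': mpoly_eval B Q' "{1..n}" "\<lambda>b. f b \<odot>\<^bsub>Q'\<^esub> \<one>\<^bsub>Q'\<^esub>" "\<lambda>\<alpha>. \<phi>' (mpoly_monom C \<alpha>)" by (rule ev')
  have g': "\<phi>' (mpoly_monom C \<alpha>) =
      (\<Oplus>\<^bsub>Q'\<^esub>\<beta>\<in>\<Delta>. (f (a \<alpha> \<beta>) \<odot>\<^bsub>Q'\<^esub> \<one>\<^bsub>Q'\<^esub>) \<otimes>\<^bsub>Q'\<^esub> \<phi>' (mpoly_monom C \<beta>))" if \<alpha>: "\<alpha> \<in> D" for \<alpha>
    unfolding \<phi>'[OF \<alpha>] using a'C[OF \<alpha>] \<phi>'_cl[OF \<Delta>_expts] a'[OF \<alpha>]
    by (intro Q'.finsum_cong') (auto simp: Q'.smult_one_mult)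
  \<comment> \<open>The evaluation and \<phi> obey the relations of the same point \<open>a\<close>,
    so the evaluation factors through Q and then, being compatible with f, through the tensor
    product.\<close>
  have ker: "ev'.lin p = \<zero>\<^bsub>Q'\<^esub>" if "p \<in> carrier (polyring n B)" "\<phi> p = \<zero>\<^bsub>Q\<^esub>" for p
    by (rule hilb_point.eval_kernel[OF ptB hh \<phi> ev' g' that])
  have lin': "ring_hom_cring (polyring n B) Q' ev'.lin"
    by (intro ring_hom_cring.intro ring_hom_cring_axioms.intro PB.M_cring Q'.M_cring ev'.eval_ring_hom)
  obtain \<psi> where \<psi>: "\<psi> \<in> ring_hom Q Q'" "\<And>p. p \<in> carrier (polyring n B) \<Longrightarrow> \<psi> (\<phi> p) = ev'.lin p"
    using ring_hom_factor[OF hhE(3) lin' hhE(5) ker] by blast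
  have \<psi>_smult: "\<psi> (b \<odot>\<^bsub>Q\<^esub> q) = f b \<odot>\<^bsub>Q'\<^esub> \<psi> q" if b: "b \<in> carrier B" and q: "q \<in> carrier Q" for b q
  proof -
    obtain p where p: "p \<in> carrier (polyring n B)" "q = \<phi> p" using q unfolding hhE(5)[symmetric] by blast
    have "\<psi> (b \<odot>\<^bsub>Q\<^esub> q) = \<psi> (\<phi> (b \<odot>\<^bsub>polyring n B\<^esub> p))"
      unfolding p(2) by (simp only: alg_hom_smult[OF hhE(4) b p(1)])
    also have "\<dots> = (f b \<odot>\<^bsub>Q'\<^esub> \<one>\<^bsub>Q'\<^esub>) \<otimes>\<^bsub>Q'\<^esub> ev'.lin p"
      using b p(1) by (simp only: \<psi>(2) PB.smult_closed ev'.lin_smult)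
    also have "\<dots> = f b \<odot>\<^bsub>Q'\<^esub> \<psi> q"
      unfolding p(2) \<psi>(2)[OF p(1)] by (rule Q'.smult_one_mult[OF t.f_closed[OF b] ev'.lin_closed[OF p(1)]])
    finally show ?thesis .
  qed
  obtain u where u: "u \<in> alg_hom C TA Q'" "\<And>q. q \<in> carrier Q \<Longrightarrow> u (t.t q) = \<psi> q"
    unfolding TA_def using t.tensor_lift[OF hhE'(1) \<psi>(1) \<psi>_smult] by blast
  have u_g: "u (g \<beta>) = \<phi>' (mpoly_monom C \<beta>)" if "\<beta> \<in> \<Delta>" for \<beta>
    unfolding g_def u(2)[OF \<phi>_cl[OF that]] \<psi>(2)[OF B.mpoly_monom_in[OF \<Delta>_expts[OF that]]]
    by (rule ev'.lin_monom[OF \<Delta>_expts[OF that]])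
  show "hilb_hom n \<Delta> C TA bc"
    unfolding hilb_hom_def is_basis_def
  proof (intro conjI ballI impI T.algebra_axioms bc_hom)
    show "bc ` carrier (polyring n C) = carrier TA" using surj by auto
    show "(\<lambda>\<beta>. bc (mpoly_monom C \<beta>)) \<in> \<Delta> \<rightarrow> carrier TA"
      using bc.hom_closed[OF C.mpoly_monom_in[OF \<Delta>_expts]] by blast
  next
    fix c \<gamma> assume c: "c \<in> \<Delta> \<rightarrow> carrier C" and \<gamma>: "\<gamma> \<in> \<Delta>"
      and z: "(\<Oplus>\<^bsub>TA\<^esub>\<beta>\<in>\<Delta>. c \<beta> \<odot>\<^bsub>TA\<^esub> bc (mpoly_monom C \<beta>)) = \<zero>\<^bsub>TA\<^esub>"
    interpret u: ring_hom_cring TA Q' u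
      by (rule alg_hom_ring_hom_cring[OF T.algebra_axioms hhE'(1) u(1)])
    \<comment> \<open>The combination is carried to \<open>Q'\<close> by \<open>u\<close>, with the
      same coefficients but now against a basis.\<close>
    have "(\<Oplus>\<^bsub>Q'\<^esub>\<beta>\<in>\<Delta>. c \<beta> \<odot>\<^bsub>Q'\<^esub> \<phi>' (mpoly_monom C \<beta>)) =
        (\<Oplus>\<^bsub>Q'\<^esub>\<beta>\<in>\<Delta>. c \<beta> \<odot>\<^bsub>Q'\<^esub> u (bc (mpoly_monom C \<beta>)))"
      using c \<phi>'_cl[OF \<Delta>_expts] u_g bc_monom[OF \<Delta>_expts] u.hom_closed[OF g_cl[OF \<Delta>_expts]]
      by (intro Q'.finsum_cong') (auto simp: Pi_iff)
    also have "\<dots> = u (\<Oplus>\<^bsub>TA\<^esub>\<beta>\<in>\<Delta>. c \<beta> \<odot>\<^bsub>TA\<^esub> bc (mpoly_monom C \<beta>))"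
      using bc.hom_closed[OF C.mpoly_monom_in[OF \<Delta>_expts]]
      by (intro alg_hom_finsum[OF T.algebra_axioms hhE'(1) u(1) \<Delta>_finite c, symmetric]) blast
    also have "\<dots> = \<zero>\<^bsub>Q'\<^esub>" unfolding z by (rule u.hom_zero)
    finally show "c \<gamma> = \<zero>\<^bsub>C\<^esub>" by (rule is_basis_indep[OF hhE'(6) c _ \<gamma>])
  next
    fix x assume "x \<in> carrier TA"
    then obtain p where p: "p \<in> carrier (polyring n C)" "x = ev.lin p" using surj bc_eq by blast
    \<comment> \<open>The coefficients for spanning are the coordinates with respect to the point
      \<open>a'\<close> over C.\<close>
    let ?c = "hilb_point.coord C n \<Delta> a' p"
    have c: "?c \<in> \<Delta> \<rightarrow> carrier C" using hilb_point.coord_closed[OF ptC p(1)] by blast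
    have "x = (\<Oplus>\<^bsub>TA\<^esub>\<beta>\<in>\<Delta>. (?c \<beta> \<odot>\<^bsub>TA\<^esub> \<one>\<^bsub>TA\<^esub>) \<otimes>\<^bsub>TA\<^esub> g \<beta>)"
      unfolding p(2) by (rule hilb_point.eval_coord[OF ptC ev g_rel' p(1)])
    also have "\<dots> = (\<Oplus>\<^bsub>TA\<^esub>\<beta>\<in>\<Delta>. ?c \<beta> \<odot>\<^bsub>TA\<^esub> bc (mpoly_monom C \<beta>))"
      using c g_cl[OF \<Delta>_expts] bc_monom[OF \<Delta>_expts]
      by (intro T.finsum_cong') (auto simp: T.smult_one_mult Pi_iff)
    finally show "\<exists>c\<in>\<Delta> \<rightarrow> carrier C. x = (\<Oplus>\<^bsub>TA\<^esub>\<beta>\<in>\<Delta>. c \<beta> \<odot>\<^bsub>TA\<^esub> bc (mpoly_monom C \<beta>))"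
      using c by (intro bexI[of _ ?c])
  qed
qed

end

section \<open>Representability\<close>

context hilb_scheme
begin

lemma homset_closed:
  assumes "algebra K B" "u \<in> hilb_homset K n N \<Delta> B" "\<alpha> \<in> D"
  shows "(\<lambda>\<beta>. u (T_class K n N \<Delta> \<alpha> \<beta>)) \<in> \<Delta> \<rightarrow> carrier B"
  using hilb_point.a_closed[OF homset_point[OF assms(1,2)] assms(3)] by blast

text \<open>The quotient by \<open>rel_ideal\<close> consists of residue classes of B[x], so it has
  the type required of the elements of \<open>hilb_data\<close>.\<close>

lemma hilb_rep_nonempty:
  assumes "algebra K B" "u \<in> hilb_homset K n N \<Delta> B"
  obtains Q \<phi> where "(Q, \<phi>) \<in> hilb_rep K n N \<Delta> B u"
  using hilb_point.quot_hilb_hom[OF homset_point[OF assms]]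
    hilb_point.quot_proj_monom[OF homset_point[OF assms]]
  unfolding hilb_rep_def hilb_data_def hilb_corresponds_def by blast

text \<open>Two quotients that correspond to u have the same kernel, the ideal of the point;
  conversely the relations can be read off from the kernel. The two algebras may live over different
  types.\<close>

lemma corresponds_iff_kernel:
  assumes B: "algebra K B" and u: "u \<in> hilb_homset K n N \<Delta> B"
    and Q: "hilb_hom n \<Delta> B Q \<phi>" and Q': "hilb_hom n \<Delta> B Q' \<phi>'"
    and c: "hilb_corresponds K n N \<Delta> B u Q \<phi>"
  shows "hilb_corresponds K n N \<Delta> B u Q' \<phi>' \<longleftrightarrow>
    a_kernel (polyring n B) Q' \<phi>' = a_kernel (polyring n B) Q \<phi>"
proof
  assume c': "hilb_corresponds K n N \<Delta> B u Q' \<phi>'"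
  have "a_kernel (polyring n B) Q' \<phi>' = hilb_point.rel_ideal B n \<Delta> (\<lambda>\<alpha> \<beta>. u (T_class K n N \<Delta> \<alpha> \<beta>))"
    by (rule hilb_point.hilb_hom_kernel[OF homset_point[OF B u] Q'
      bspec[OF c'[unfolded hilb_corresponds_def]]])
  moreover have "a_kernel (polyring n B) Q \<phi> = hilb_point.rel_ideal B n \<Delta> (\<lambda>\<alpha> \<beta>. u (T_class K n N \<Delta> \<alpha> \<beta>))"
    by (rule hilb_point.hilb_hom_kernel[OF homset_point[OF B u] Q
      bspec[OF c[unfolded hilb_corresponds_def]]])
  ultimately show "a_kernel (polyring n B) Q' \<phi>' = a_kernel (polyring n B) Q \<phi>" by (rule trans[OF _ sym])
next
  assume eq: "a_kernel (polyring n B) Q' \<phi>' = a_kernel (polyring n B) Q \<phi>"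
  show "hilb_corresponds K n N \<Delta> B u Q' \<phi>'"
    unfolding hilb_corresponds_def
  proof
    fix \<alpha> assume \<alpha>: "\<alpha> \<in> D"
    note cl = homset_closed[OF B u \<alpha>]
    show "\<phi>' (mpoly_monom B \<alpha>) =
        (\<Oplus>\<^bsub>Q'\<^esub>\<beta>\<in>\<Delta>. u (T_class K n N \<Delta> \<alpha> \<beta>) \<odot>\<^bsub>Q'\<^esub> \<phi>' (mpoly_monom B \<beta>))"
      unfolding hilb_hom_eq_kernel[OF Q' \<alpha> cl] eq hilb_hom_eq_kernel[OF Q \<alpha> cl, symmetric]
      by (rule bspec[OF c[unfolded hilb_corresponds_def] \<alpha>])
  qed
qed

text \<open>From left to right, an element of the nonempty \<open>hilb_rep\<close> carries the
  correspondence, which passes to \<phi> by equality of kernels. From right to left both sets are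
  cut out by the same condition.\<close>

lemma hilb_rep_eq_class_iff:
  assumes B: "algebra K B" and u: "u \<in> hilb_homset K n N \<Delta> B" and Q: "hilb_hom n \<Delta> B Q \<phi>"
  shows "hilb_rep K n N \<Delta> B u = hilb_class n \<Delta> B Q \<phi> \<longleftrightarrow> hilb_corresponds K n N \<Delta> B u Q \<phi>"
proof
  assume eq: "hilb_rep K n N \<Delta> B u = hilb_class n \<Delta> B Q \<phi>"
  obtain Q' \<phi>' where rep: "(Q', \<phi>') \<in> hilb_rep K n N \<Delta> B u" by (rule hilb_rep_nonempty[OF B u])
  then have Q': "hilb_hom n \<Delta> B Q' \<phi>'" "hilb_corresponds K n N \<Delta> B u Q' \<phi>'"
    by (auto simp: hilb_rep_def hilb_data_def)
  from rep[unfolded eq] have "a_kernel (polyring n B) Q \<phi> = a_kernel (polyring n B) Q' \<phi>'"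
    by (simp add: hilb_class_def)
  then show "hilb_corresponds K n N \<Delta> B u Q \<phi>"
    unfolding corresponds_iff_kernel[OF B u Q'(1) Q Q'(2)] .
next
  assume "hilb_corresponds K n N \<Delta> B u Q \<phi>"
  from corresponds_iff_kernel[OF B u Q _ this]
  show "hilb_rep K n N \<Delta> B u = hilb_class n \<Delta> B Q \<phi>"
    unfolding hilb_rep_def hilb_class_def hilb_data_def by blast
qed

text \<open>Spanning provides coefficients for each monomial in \<open>D\<close>; chosen at once
  they form a point, hence a homomorphism. This is surjectivity of the representation.\<close>

lemma ex_corresponding_hom:
  assumes B: "algebra K B" and Q: "hilb_hom n \<Delta> B Q \<phi>"
  obtains u where "u \<in> hilb_homset K n N \<Delta> B" "hilb_corresponds K n N \<Delta> B u Q \<phi>"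
proof -
  note hh = hilb_homE[OF Q]
  interpret B: cring B by (rule hh(2))
  interpret Q: algebra B Q by (rule hh(1))
  have "\<exists>c\<in>\<Delta> \<rightarrow> carrier B. \<phi> (mpoly_monom B \<alpha>) = (\<Oplus>\<^bsub>Q\<^esub>\<beta>\<in>\<Delta>. c \<beta> \<odot>\<^bsub>Q\<^esub> \<phi> (mpoly_monom B \<beta>))"
    if "\<alpha> \<in> D" for \<alpha>
  proof -
    have "\<phi> (mpoly_monom B \<alpha>) \<in> carrier Q"
      using hh(5) B.mpoly_monom_in[OF D_expts[OF that]] by blast
    then show ?thesis using hh(6) unfolding is_basis_def by blast
  qed
  then obtain a where a: "\<And>\<alpha>. \<alpha> \<in> D \<Longrightarrow> a \<alpha> \<in> \<Delta> \<rightarrow> carrier B"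
    "\<And>\<alpha>. \<alpha> \<in> D \<Longrightarrow> \<phi> (mpoly_monom B \<alpha>) = (\<Oplus>\<^bsub>Q\<^esub>\<beta>\<in>\<Delta>. a \<alpha> \<beta> \<odot>\<^bsub>Q\<^esub> \<phi> (mpoly_monom B \<beta>))"
    by metis
  have a_cl: "a \<alpha> \<beta> \<in> carrier B" if "\<alpha> \<in> D" "\<beta> \<in> \<Delta>" for \<alpha> \<beta> using a(1)[OF that(1)] that(2) by blast
  have "hilb_point B n \<Delta> N a" by (rule hilb_point_of_hilb_hom[OF Q a_cl a(2)])
  then obtain u where u: "u \<in> hilb_homset K n N \<Delta> B"
    "\<And>\<alpha> \<beta>. \<alpha> \<in> D \<Longrightarrow> \<beta> \<in> \<Delta> \<Longrightarrow> u (T_class K n N \<Delta> \<alpha> \<beta>) = a \<alpha> \<beta>"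
    using homset_of_point[OF B] by blast
  have \<phi>_cl: "\<phi> (mpoly_monom B \<beta>) \<in> carrier Q" if "\<beta> \<in> \<Delta>" for \<beta>
    using hh(5) B.mpoly_monom_in[OF \<Delta>_expts[OF that]] by blast
  have "hilb_corresponds K n N \<Delta> B u Q \<phi>"
    unfolding hilb_corresponds_def
  proof
    fix \<alpha> assume \<alpha>: "\<alpha> \<in> D"
    show "\<phi> (mpoly_monom B \<alpha>) =
        (\<Oplus>\<^bsub>Q\<^esub>\<beta>\<in>\<Delta>. u (T_class K n N \<Delta> \<alpha> \<beta>) \<odot>\<^bsub>Q\<^esub> \<phi> (mpoly_monom B \<beta>))"
      unfolding a(2)[OF \<alpha>] using a_cl[OF \<alpha>] u(2)[OF \<alpha>] \<phi>_cl
      by (intro Q.finsum_cong') auto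
  qed
  with u(1) show thesis by (rule that)
qed

lemma hilb_functor_iff:
  "Y \<in> hilb_functor n \<Delta> B \<longleftrightarrow> (\<exists>Q \<phi>. (Q, \<phi>) \<in> hilb_data n \<Delta> B \<and> Y = hilb_class n \<Delta> B Q \<phi>)"
proof -
  have "hilb_rel n \<Delta> B `` {(Q, \<phi>)} = hilb_class n \<Delta> B Q \<phi>" if "(Q, \<phi>) \<in> hilb_data n \<Delta> B" for Q \<phi>
    using that unfolding hilb_rel_def hilb_class_def by auto
  then show ?thesis unfolding hilb_functor_def quotient_def by force
qed

lemma hilb_rep_bij:
  assumes B: "algebra K B"
  shows "bij_betw (hilb_rep K n N \<Delta> B) (hilb_homset K n N \<Delta> B) (hilb_functor n \<Delta> B)"
proof (rule bij_betwI')
  fix u u' assume u: "u \<in> hilb_homset K n N \<Delta> B" and u': "u' \<in> hilb_homset K n N \<Delta> B"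
  show "hilb_rep K n N \<Delta> B u = hilb_rep K n N \<Delta> B u' \<longleftrightarrow> u = u'"
  proof
    \<comment> \<open>Equal classes share a quotient \<phi>, in which the values of u and u' are
      coefficients of the same elements in the basis \<Delta>.\<close>
    assume eq: "hilb_rep K n N \<Delta> B u = hilb_rep K n N \<Delta> B u'"
    obtain Q \<phi> where rep: "(Q, \<phi>) \<in> hilb_rep K n N \<Delta> B u" by (rule hilb_rep_nonempty[OF B u])
    have Q: "hilb_hom n \<Delta> B Q \<phi>"
      and c: "hilb_corresponds K n N \<Delta> B u Q \<phi>" and c': "hilb_corresponds K n N \<Delta> B u' Q \<phi>"
      using rep rep[unfolded eq] by (auto simp: hilb_rep_def hilb_data_def)
    note hh = hilb_homE[OF Q]
    show "u = u'"
    proof (rule homset_eqI[OF B u u'])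
      fix \<alpha> \<beta> assume \<alpha>: "\<alpha> \<in> D" and \<beta>: "\<beta> \<in> \<Delta>"
      show "u (T_class K n N \<Delta> \<alpha> \<beta>) = u' (T_class K n N \<Delta> \<alpha> \<beta>)"
        using is_basis_unique[OF algebra.module[OF hh(1)] hh(6) \<Delta>_finite
            homset_closed[OF B u \<alpha>] homset_closed[OF B u' \<alpha>] _ \<beta>]
          bspec[OF c[unfolded hilb_corresponds_def] \<alpha>] bspec[OF c'[unfolded hilb_corresponds_def] \<alpha>]
        by (simp only:)
    qed
  qed simp
next
  fix u assume u: "u \<in> hilb_homset K n N \<Delta> B"
  obtain Q \<phi> where rep: "(Q, \<phi>) \<in> hilb_rep K n N \<Delta> B u" by (rule hilb_rep_nonempty[OF B u])
  then have Q: "(Q, \<phi>) \<in> hilb_data n \<Delta> B" "hilb_hom n \<Delta> B Q \<phi>" "hilb_corresponds K n N \<Delta> B u Q \<phi>"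
    by (auto simp: hilb_rep_def hilb_data_def)
  with hilb_rep_eq_class_iff[OF B u Q(2)] show "hilb_rep K n N \<Delta> B u \<in> hilb_functor n \<Delta> B"
    unfolding hilb_functor_iff by blast
next
  fix Y assume "Y \<in> hilb_functor n \<Delta> B"
  then obtain Q \<phi> where data: "(Q, \<phi>) \<in> hilb_data n \<Delta> B" and Y: "Y = hilb_class n \<Delta> B Q \<phi>"
    unfolding hilb_functor_iff by blast
  from data have Q: "hilb_hom n \<Delta> B Q \<phi>" by (simp add: hilb_data_def)
  obtain u where u: "u \<in> hilb_homset K n N \<Delta> B" "hilb_corresponds K n N \<Delta> B u Q \<phi>"
    by (rule ex_corresponding_hom[OF B Q])
  with hilb_rep_eq_class_iff[OF B u(1) Q] Y
  show "\<exists>u\<in>hilb_homset K n N \<Delta> B. Y = hilb_rep K n N \<Delta> B u" by blast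
qed

lemma T_class_in: "\<alpha> \<in> D \<Longrightarrow> \<beta> \<in> \<Delta> \<Longrightarrow> T_class K n N \<Delta> \<alpha> \<beta> \<in> carrier (hilb_alg K n N \<Delta>)"
  unfolding T_class_def hilb_alg_def R.quot_carrier using T_var_in by blast

lemma hilb_map_rep:
  assumes B: "algebra K B" and C: "algebra K C" and f: "f \<in> alg_hom K B C"
    and u: "u \<in> hilb_homset K n N \<Delta> B"
  shows "hilb_map n \<Delta> B C f (hilb_rep K n N \<Delta> B u) =
    hilb_rep K n N \<Delta> C (compose (carrier (hilb_alg K n N \<Delta>)) f u)"
proof -
  let ?u = "compose (carrier (hilb_alg K n N \<Delta>)) f u"
  have "u \<in> alg_hom K (hilb_alg K n N \<Delta>) B" using u by (simp add: hilb_homset_def)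
  from alg_hom_comp[OF this f] have "?u \<in> alg_hom K (hilb_alg K n N \<Delta>) C"
    by (rule alg_hom_cong[OF hilb_alg_algebra]) (simp add: compose_eq)
  then have u': "?u \<in> hilb_homset K n N \<Delta> C" by (simp add: hilb_homset_def)
  \<comment> \<open>\<open>hilb_map\<close> is a union over all representatives; every one of them
    contributes this same class.\<close>
  have eq: "hilb_class n \<Delta> C (tensor_alg B C f Q) (base_change_hom B C f Q \<phi>) = hilb_rep K n N \<Delta> C ?u"
    if rep: "(Q, \<phi>) \<in> hilb_rep K n N \<Delta> B u" for Q \<phi>
  proof -
    from rep have Q: "hilb_hom n \<Delta> B Q \<phi>" "hilb_corresponds K n N \<Delta> B u Q \<phi>"
      by (auto simp: hilb_rep_def hilb_data_def)
    have comp: "?u (T_class K n N \<Delta> \<alpha> \<beta>) = f (u (T_class K n N \<Delta> \<alpha> \<beta>))" if "\<alpha> \<in> D" "\<beta> \<in> \<Delta>" for \<alpha> \<beta>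
      by (rule compose_eq[OF T_class_in[OF that]])
    note bc = hilb_hom_base_change[OF Q(1) alg_hom_ring_hom[OF f] algebra.M_cring[OF C]
        homset_point[OF B u] homset_point[OF C u'] comp bspec[OF Q(2)[unfolded hilb_corresponds_def]]]
    have "hilb_corresponds K n N \<Delta> C ?u (tensor_alg B C f Q) (base_change_hom B C f Q \<phi>)"
      unfolding hilb_corresponds_def by (intro ballI bc(2))
    then show ?thesis using hilb_rep_eq_class_iff[OF C u' bc(1)] by blast
  qed
  \<comment> \<open>With a representative at hand, the union is nonempty and equals the common
    class.\<close>
  obtain Q \<phi> where "(Q, \<phi>) \<in> hilb_rep K n N \<Delta> B u" by (rule hilb_rep_nonempty[OF B u])
  with eq show ?thesis unfolding hilb_map_def by fastforce
qed

end

theorem proposition3: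
  fixes K :: "('k, 'm) ring_scheme"
    and n d :: nat
    and \<Delta> N :: "nat multiset set"
  assumes "cring K"
    and "standard_set n \<Delta>" and "finite \<Delta>" and "card \<Delta> = d" and "d \<ge> 1"
    and "standard_set n N" and "\<Delta> \<subseteq> N"
  shows "algebra K (hilb_alg K n N \<Delta>) \<and>
    (\<forall>B :: ('k, 'b) module. algebra K B \<longrightarrow>
       bij_betw (hilb_rep K n N \<Delta> B) (hilb_homset K n N \<Delta> B) (hilb_functor n \<Delta> B)) \<and>
    (\<forall>(B :: ('k, 'b) module) (C :: ('k, 'c) module) f u.
       algebra K B \<and> algebra K C \<and> f \<in> alg_hom K B C \<and> u \<in> hilb_homset K n N \<Delta> B \<longrightarrow>
       hilb_map n \<Delta> B C f (hilb_rep K n N \<Delta> B u) =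
         hilb_rep K n N \<Delta> C (compose (carrier (hilb_alg K n N \<Delta>)) f u)) \<and>
    (\<forall>(B :: ('k, 'b) module) (Q :: ('b, 'q) module) \<phi> u.
       algebra K B \<and> hilb_hom n \<Delta> B Q \<phi> \<and> u \<in> hilb_homset K n N \<Delta> B \<longrightarrow>
       (hilb_rep K n N \<Delta> B u = hilb_class n \<Delta> B Q \<phi> \<longleftrightarrow> hilb_corresponds K n N \<Delta> B u Q \<phi>))"
proof -
  \<comment> \<open>The condition d \<ge> 1 enters here: a nonempty standard set contains the
    exponent 0, whose basis vector starts the coordinates.\<close>
  have "\<Delta> \<noteq> {}" using assms(4,5) by auto
  then obtain \<gamma> where "\<gamma> \<in> \<Delta>" by blast
  then have "{#} \<in> \<Delta>" by (rule standard_set_subset[OF assms(2)]) simp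
  then interpret hilb_scheme n \<Delta> N K
    by (intro hilb_scheme.intro standard_pair.intro assms)
  show ?thesis
    using hilb_alg_algebra hilb_rep_bij hilb_map_rep hilb_rep_eq_class_iff by blast
qed

end
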